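(* Let $\mathbb{X}=\{\mathbf{x}_1,\dots,\mathbf{x}_N\}\subset\mathbb{R}^d$ consist of distinct points, $P=\sum_kp_k\delta_{\mathbf{x}_k}$ with $p_k>0$, $\sum_kp_k=1$, and let $Q$ be a probability on $\mathbb{R}^d$ with $Q\ll\ell_d$ whose support is connected with Lebesgue negligible boundary. Let $c(\mathbf{x},\mathbf{y})=h(\mathbf{x}-\mathbf{y})$ with $h:\mathbb{R}^d\to[0,\infty)$ differentiable and satisfying (A1)–(A3), and assume $\int c(\mathbf{x}_i,\mathbf{y})\,dQ(\mathbf{y})<\infty$ for all $i$. Let $\mathbf{z}\in\operatorname{Opt}^0_c(P,Q)$. Let $P_n,Q_m$ be the empirical measures of independent i.i.d. samples of sizes $n$ from $P$ and $m$ from $Q$, and let $X\sim\mathcal{N}(0,\sigma^2(P,\mathbf{z}))$ and $Y\sim\mathcal{N}(0,\sigma^2_c(Q,\mathbf{z}))$ be independent. Then (i) $\sqrt{n}(\mathcal{T}_c(P_n,Q)-\mathcal{T}_c(P,Q))\xrightarrow{w}X$. If moreover $\int c(\mathbf{x}_i,\mathbf{y})^2dQ(\mathbf{y})<\infty$ for all $i$, then (ii) $\sqrt{m}(\mathcal{T}_c(P,Q_m)-\mathcal{T}_c(P,Q))\xrightarrow{w}Y$; (iii) if $n,m\to\infty$ with $\frac{m}{n+m}\to\lambda\in(0,1)$, $\sqrt{\tfrac{nm}{n+m}}(\mathcal{T}_c(P_n,Q_m)-\mathcal{T}_c(P,Q))\xrightarrow{w}\sqrt{\lambda}X+\sqr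t{1-\lambda}Y$.
   Context: $\ell_d$ is Lebesgue measure. (A1): $h$ strictly convex. (A2): given $r>0$, $\theta\in(0,\pi)$ there is $M>0$ such that for every $|\mathbf{p}|>M$ there is $\mathbf{w}\neq0$ such that on the cone $\{\mathbf{x}: |\mathbf{x}-\mathbf{p}||\mathbf{w}|\cos(\theta/2)\leq\langle\mathbf{w},\mathbf{x}-\mathbf{p}\rangle\leq r|\mathbf{w}|\}$ the function $h$ attains its maximum at $\mathbf{p}$. (A3): $\lim_{|\mathbf{x}|\to\infty}h(\mathbf{x})/|\mathbf{x}|=\infty$. $\mathcal{T}_c(\mu,\nu)=\inf_{\pi\in\Pi(\mu,\nu)}\int c\,d\pi$; $g_c(P,Q,\mathbf{z})=\sum_iz_ip_i+\int\min_i\{c(\mathbf{x}_i,\mathbf{y})-z_i\}dQ(\mathbf{y})$; $\operatorname{Opt}^0_c(P,Q)=\{\mathbf{z}:\mathcal{T}_c(P,Q)=g_c(P,Q,\mathbf{z}), z_1=0\}$. $\sigma^2(P,\mathbf{z})=\sum_iz_i^2p_i-(\sum_iz_ip_i)^2$ (the variance of $\sum_iz_iW_i$ with $\mathbf{W}\sim\mathcal{N}(0,\Sigma(\mathbf{p}))$, $\Sigma(\mathbf{p})_{ij}=p_i\delta_{ij}-p_ip_j$). $\sigma_c^2(Q,\mathbf{z})=\int f_{\mathbf{z}}^2dQ-\left(\int f_{\mathbf{z}}dQ\right)^2$ with $f_{\mathbf{z}}(\mathbf{y})=\inf_i\{c(\mathbf{x}_i,\mathbf{y})-z_i\}$. 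*)

theory Defs
  imports "HOL-Probability.Probability"
begin

definition strictly_convex :: "('a::real_vector \<Rightarrow> real) \<Rightarrow> bool" where
  "strictly_convex h \<longleftrightarrow>
     (\<forall>x y t. x \<noteq> y \<and> 0 < t \<and> t < 1 \<longrightarrow>
        h ((1 - t) *\<^sub>R x + t *\<^sub>R y) < (1 - t) * h x + t * h y)"

definition cone_condition :: "('a::euclidean_space \<Rightarrow> real) \<Rightarrow> bool" where
  "cone_condition h \<longleftrightarrow>
     (\<forall>r \<theta>. r > 0 \<and> 0 < \<theta> \<and> \<theta> < pi \<longrightarrow>
       (\<exists>M>0. \<forall>p. norm p > M \<longrightarrow>
          (\<exists>w. w \<noteq> 0 \<and>
             (\<forall>x. norm (x - p) * norm w * cos (\<theta> / 2) \<le> inner w (x - p)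
                  \<and> inner w (x - p) \<le> r * norm w \<longrightarrow> h x \<le> h p))))"

definition superlinear :: "('a::real_normed_vector \<Rightarrow> real) \<Rightarrow> bool" where
  "superlinear h \<longleftrightarrow> filterlim (\<lambda>x. h x / norm x) at_top at_infinity"

definition msupport :: "'a::metric_space measure \<Rightarrow> 'a set" where
  "msupport Q = {x. \<forall>e>0. emeasure Q (ball x e) > 0}"

definition discrete_law :: "nat \<Rightarrow> (nat \<Rightarrow> 'a::topological_space) \<Rightarrow> (nat \<Rightarrow> real) \<Rightarrow> 'a measure" where
  "discrete_law N x p = distr (density (count_space {..<N}) (\<lambda>i. ennreal (p i))) borel x"

definition empirical :: "(nat \<Rightarrow> 'a::topological_space) \<Rightarrow> nat \<Rightarrow> 'a measure" where
  "empirical f n = scale_measure (ennreal (1 / real n)) (distr (count_space {..<n}) borel f)"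

definition couplings :: "'a::euclidean_space measure \<Rightarrow> 'a measure \<Rightarrow> ('a \<times> 'a) measure set" where
  "couplings \<mu> \<nu> = {\<pi>. prob_space \<pi> \<and> sets \<pi> = sets borel \<and>
       distr \<pi> borel fst = \<mu> \<and> distr \<pi> borel snd = \<nu>}"

definition transport_cost :: "('a::euclidean_space \<Rightarrow> 'a \<Rightarrow> real) \<Rightarrow> 'a measure \<Rightarrow> 'a measure \<Rightarrow> real" where
  "transport_cost c \<mu> \<nu> =
     enn2real (INF \<pi>\<in>couplings \<mu> \<nu>. \<integral>\<^sup>+ u. ennreal (c (fst u) (snd u)) \<partial>\<pi>)"

definition fz :: "('a \<Rightarrow> 'a \<Rightarrow> real) \<Rightarrow> nat \<Rightarrow> (nat \<Rightarrow> 'a) \<Rightarrow> (nat \<Rightarrow> real) \<Rightarrow> 'a \<Rightarrow> real" where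
  "fz c N x z y = Min ((\<lambda>i. c (x i) y - z i) ` {..<N})"

definition g_c :: "('a \<Rightarrow> 'a \<Rightarrow> real) \<Rightarrow> nat \<Rightarrow> (nat \<Rightarrow> 'a) \<Rightarrow> (nat \<Rightarrow> real) \<Rightarrow> 'a measure \<Rightarrow> (nat \<Rightarrow> real) \<Rightarrow> real" where
  "g_c c N x p Q z = (\<Sum>i<N. z i * p i) + (\<integral>y. fz c N x z y \<partial>Q)"

text \<open>\<open>Opt^0_c(P,Q)\<close> with \<open>P = \<Sum>_{i<N} p_i \<delta>_{x_i}\<close>; the index \<open>1\<close> of the paper is \<open>0\<close> here.\<close>
definition Opt0 :: "('a::euclidean_space \<Rightarrow> 'a \<Rightarrow> real) \<Rightarrow> nat \<Rightarrow> (nat \<Rightarrow> 'a) \<Rightarrow> (nat \<Rightarrow> real) \<Rightarrow> 'a measure \<Rightarrow> (nat \<Rightarrow> real) set" where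
  "Opt0 c N x p Q = {z. transport_cost c (discrete_law N x p) Q = g_c c N x p Q z \<and> z 0 = 0}"

definition sigma2_P :: "nat \<Rightarrow> (nat \<Rightarrow> real) \<Rightarrow> (nat \<Rightarrow> real) \<Rightarrow> real" where
  "sigma2_P N p z = (\<Sum>i<N. (z i)\<^sup>2 * p i) - (\<Sum>i<N. z i * p i)\<^sup>2"

definition sigma2_Q :: "('a \<Rightarrow> 'a \<Rightarrow> real) \<Rightarrow> nat \<Rightarrow> (nat \<Rightarrow> 'a) \<Rightarrow> 'a measure \<Rightarrow> (nat \<Rightarrow> real) \<Rightarrow> real" where
  "sigma2_Q c N x Q z = (\<integral>y. (fz c N x z y)\<^sup>2 \<partial>Q) - (\<integral>y. fz c N x z y \<partial>Q)\<^sup>2"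

definition normal_law :: "real \<Rightarrow> real measure" where
  "normal_law v = (if v = 0 then return borel 0 else density lborel (normal_density 0 (sqrt v)))"

end

theory Submission
  imports Defs
begin

text \<open>
  By duality the cost \<open>T(q, R)\<close> of transporting the law with masses \<open>q\<^sub>i\<close> at \<open>x\<^sub>i\<close> to \<open>R\<close> is the supremum
  over \<open>w\<close> of the concave function \<open>g(q, R, w)\<close>, which is affine in \<open>(q, R)\<close>. If \<open>z\<close> maximises \<open>g(p, Q, \<cdot>)\<close>, then
  \<open>0 \<le> T(q, R) - g(q, R, z)\<close>, and the difference is at most the supremum over \<open>w\<close> of
  \<open>\<Sum>\<^sub>i (w\<^sub>i - z\<^sub>i) (q\<^sub>i - p\<^sub>i) + \<integral> (f\<^sub>w - f\<^sub>z) d(R - Q)\<close>. The maximiser with \<open>w\<^sub>0 = z\<^sub>0\<close> is unique, because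
  the difference of two optimal \<open>f\<^sub>z\<close> is continuous and finitely valued on the connected support of \<open>Q\<close>;
  hence, by concavity, only \<open>w\<close> in a small cube around \<open>z\<close> matter. On a cube of half-width \<open>e\<close> the
  supremum, scaled by the square root of the sample size, is of order \<open>e\<close> in probability: the class
  \<open>f\<^sub>w\<close> is Lipschitz in the finite-dimensional parameter \<open>w\<close>, so dyadic chaining with Hoeffding's
  inequality applies. The remaining linear term \<open>g(q, R, z) - g(p, Q, z)\<close> is a normalised sum of
  independent variables, to which the central limit theorem applies.
\<close>

section \<open>The potentials \<open>f\<^sub>z\<close>\<close>

text \<open>The cost is unbounded, but moving the parameters by at most \<open>d\<close> moves
  \<open>fz\<close> by at most \<open>d\<close> at every point. Chaining sees only increments of
  \<open>fz\<close>, so Hoeffding's inequality applies with a range proportional to the cube; square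
  integrability of the cost enters at the fixed \<open>z\<close>, through the central limit theorem.

  Duality must also hold for empirical measures, where ties between labels carry positive mass. A
  maximiser for the true minimum does not say how to split a tied point, so couplings with
  prescribed masses come from a smoothed minimum, whose first-order conditions are equalities.

  The bound of order \<open>e\<close> has to hold with a constant that depends on the probability of
  the bad event but not on \<open>e\<close>; only then may the cube be chosen after the constant.

  Convergence in law is a statement about \<open>distr\<close>, so the cost must be a measurable
  function of the sample. This is not evident from an infimum over couplings that vary with the
  sample.\<close>

lemma fz_le: "i < N \<Longrightarrow> fz c N x z y \<le> c (x i) y - z i"
  unfolding fz_def by (rule Min_le) auto

lemma fz_attained:
  assumes "N \<ge> 1"
  obtains i where "i < N" "fz c N x z y = c (x i) y - z i"
proof -
  have "fz c N x z y \<in> (\<lambda>i. c (x i) y - z i) ` {..<N}"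
    unfolding fz_def by (rule Min_in) (use assms in \<open>auto simp: lessThan_empty_iff\<close>)
  then show ?thesis using that by auto
qed

lemma fz_greatest:
  assumes "N \<ge> 1" "\<And>i. i < N \<Longrightarrow> t \<le> c (x i) y - z i"
  shows "t \<le> fz c N x z y"
  using assms(1) by (rule fz_attained[where c = c and x = x and y = y and z = z]) (use assms(2) in auto)

text \<open>Insert the label that is active for one parameter into the minimum for the other. The
  bound is uniform in \<open>y\<close>, which makes increments of the potentials bounded random
  variables.\<close>

lemma fz_lipschitz:
  assumes "N \<ge> 1" "\<And>i. i < N \<Longrightarrow> \<bar>w i - w' i\<bar> \<le> d"
  shows "\<bar>fz c N x w y - fz c N x w' y\<bar> \<le> d"
proof -
  have *: "fz c N x v y \<le> fz c N x v' y + d" if "\<And>i. i < N \<Longrightarrow> \<bar>v i - v' i\<bar> \<le> d" for v v'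
  proof (rule fz_attained[OF assms(1), where c = c and x = x and y = y and z = v'])
    fix i assume "i < N" "fz c N x v' y = c (x i) y - v' i"
    then show ?thesis using fz_le[of i N c x v y] that[of i] by linarith
  qed
  show ?thesis using *[of w w'] *[of w' w] assms(2) by (fastforce simp: abs_minus_commute abs_le_iff)
qed

lemma fz_cong: "(\<And>i. i < N \<Longrightarrow> w i = w' i) \<Longrightarrow> fz c N x w y = fz c N x w' y"
  unfolding fz_def by (intro arg_cong[where f = Min] image_cong) auto

lemma fz_concave:
  assumes "N \<ge> 1" "0 \<le> s" "s \<le> 1"
  shows "(1 - s) * fz c N x w y + s * fz c N x w' y \<le> fz c N x (\<lambda>i. (1 - s) * w i + s * w' i) y"
proof (rule fz_greatest[OF assms(1)])
  fix i assume i: "i < N"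
  have "(1 - s) * fz c N x w y \<le> (1 - s) * (c (x i) y - w i)" "s * fz c N x w' y \<le> s * (c (x i) y - w' i)"
    using fz_le[OF i] assms by (auto intro!: mult_left_mono)
  then show "(1 - s) * fz c N x w y + s * fz c N x w' y \<le> c (x i) y - ((1 - s) * w i + s * w' i)"
    by (simp add: algebra_simps)
qed

lemma fz_shift:
  assumes "N \<ge> 1"
  shows "fz c N x (\<lambda>i. w i + t) y = fz c N x w y - t"
proof (rule antisym)
  show "fz c N x (\<lambda>i. w i + t) y \<le> fz c N x w y - t"
    by (rule fz_attained[OF assms, where c = c and x = x and y = y and z = w])
       (use fz_le[where c = c and x = x and y = y and z = "\<lambda>i. w i + t"] in force)
  show "fz c N x w y - t \<le> fz c N x (\<lambda>i. w i + t) y"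
    by (rule fz_greatest[OF assms]) (use fz_le[where c = c and x = x and y = y and z = w] in force)
qed

lemma fz_nonneg:
  assumes "N \<ge> 1" "\<And>u v. 0 \<le> c u v" "\<And>i. i < N \<Longrightarrow> z i \<le> 0"
  shows "0 \<le> fz c N x z y"
  by (rule fz_greatest[OF assms(1)]) (use assms(2) assms(3) in \<open>smt (verit)\<close>)

lemma fz_measurable:
  assumes "\<And>i. i < N \<Longrightarrow> (\<lambda>y. c (x i) (g y)) \<in> borel_measurable M"
  shows "(\<lambda>y. fz c N x z (g y)) \<in> borel_measurable M"
  unfolding fz_def by (rule borel_measurable_Min) (use assms in auto)

text \<open>Two potentials differ by a bounded function, so over a finite measure either all of them
  are integrable or none is. Duality relies on this rather than on integrability of the single
  costs.\<close>

lemma (in finite_measure) fz_integrable_perturb: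
  assumes "N \<ge> 1" "\<And>i. i < N \<Longrightarrow> c (x i) \<in> borel_measurable M" "integrable M (fz c N x z)"
  shows "integrable M (fz c N x w)"
proof -
  define d where "d = (\<Sum>i<N. \<bar>w i - z i\<bar>)"
  have "\<bar>fz c N x w y - fz c N x z y\<bar> \<le> d" for y
    by (rule fz_lipschitz[OF assms(1)]) (auto simp: d_def intro!: member_le_sum)
  then have *: "integrable M (\<lambda>y. fz c N x w y - fz c N x z y)"
    using fz_measurable[of N c x "\<lambda>y. y" M] assms(2)
    by (intro integrable_const_bound[where B = d]) auto
  show ?thesis using Bochner_Integration.integrable_add[OF * assms(3)] by simp
qed

lemma (in finite_measure) fz_integrable:
  assumes "N \<ge> 1" "\<And>u v. 0 \<le> c u v" "\<And>i. i < N \<Longrightarrow> integrable M (c (x i))"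
  shows "integrable M (fz c N x w)"
proof (rule fz_integrable_perturb[OF assms(1), where z = "\<lambda>_. 0"])
  show "integrable M (fz c N x (\<lambda>_. 0))"
  proof (rule Bochner_Integration.integrable_bound[OF assms(3)[of 0]])
    show "fz c N x (\<lambda>_. 0) \<in> borel_measurable M"
      using fz_measurable[of N c x "\<lambda>y. y" M] assms(3) by auto
    show "AE y in M. norm (fz c N x (\<lambda>_. 0) y) \<le> norm (c (x 0) y)"
      using fz_le[of 0 N c x "\<lambda>_. 0"] fz_nonneg[of N c "\<lambda>_. 0" x] assms(1,2) by auto
  qed (use assms(1) in auto)
qed (use assms in auto)

text \<open>Parameters are functions on all of \<open>nat\<close>, but the Lipschitz bound makes
  \<open>F\<close> blind to the coordinates from \<open>n\<close> on. Setting those to 0 leaves a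
  product of compact sets, compact by Tychonoff, on which \<open>F\<close> is continuous.\<close>

lemma lipschitz_attains_max_on_box:
  fixes F :: "(nat \<Rightarrow> real) \<Rightarrow> real"
  assumes lip: "\<And>w w'. \<bar>F w - F w'\<bar> \<le> K * (\<Sum>i<n. \<bar>w i - w' i\<bar>)"
    and lu: "\<And>i. i < n \<Longrightarrow> l i \<le> u i"
  obtains w where "\<forall>i<n. l i \<le> w i \<and> w i \<le> u i"
    "\<forall>w'. (\<forall>i<n. l i \<le> w' i \<and> w' i \<le> u i) \<longrightarrow> F w' \<le> F w"
proof -
  define B where "B = PiE UNIV (\<lambda>i. if i < n then {l i..u i} else {0::real})"
  have "compactin (product_topology (\<lambda>_. euclidean) UNIV) B"
    unfolding B_def compactin_PiE by auto
  then have "compact B" by (simp add: euclidean_product_topology)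
  moreover have "(\<lambda>i. if i < n then l i else 0) \<in> B" using lu by (auto simp: B_def)
  then have "B \<noteq> {}" by auto
  moreover have "continuous_on B F"
    unfolding continuous_on_def
  proof
    fix w assume "w \<in> B"
    have "continuous_on UNIV (\<lambda>v. K * (\<Sum>i<n. \<bar>v i - w i\<bar>))"
      by (intro continuous_intros continuous_on_product_coordinates)
    then have "((\<lambda>v. K * (\<Sum>i<n. \<bar>v i - w i\<bar>)) \<longlongrightarrow> K * (\<Sum>i<n. \<bar>w i - w i\<bar>)) (at w within B)"
      unfolding continuous_on_def by (meson UNIV_I tendsto_within_subset top_greatest)
    then have "((\<lambda>v. K * (\<Sum>i<n. \<bar>v i - w i\<bar>)) \<longlongrightarrow> 0) (at w within B)" by simp
    then have "((\<lambda>v. F v - F w) \<longlongrightarrow> 0) (at w within B)"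
      by (rule Lim_null_comparison[rotated]) (use lip in auto)
    then show "(F \<longlongrightarrow> F w) (at w within B)" by (rule LIM_zero_cancel)
  qed
  ultimately obtain w where w: "w \<in> B" "\<And>v. v \<in> B \<Longrightarrow> F v \<le> F w"
    using continuous_attains_sup[of B F] by blast
  show ?thesis
  proof (rule that[of w]; intro allI impI)
    show "l i \<le> w i \<and> w i \<le> u i" if "i < n" for i
      using w(1) that by (auto simp: B_def PiE_def Pi_def split: if_splits)
    fix w' assume w': "\<forall>i<n. l i \<le> w' i \<and> w' i \<le> u i"
    define v where "v = (\<lambda>i. if i < n then w' i else 0)"
    have "v \<in> B" using w' by (auto simp: v_def B_def)
    moreover have "(\<Sum>i<n. \<bar>v i - w' i\<bar>) = 0" by (auto simp: v_def)
    then have "F v = F w'" using lip[of v w'] by simp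
    ultimately show "F w' \<le> F w" using w(2) by metis
  qed
qed

section \<open>Soft minimum\<close>

text \<open>Log-sum-exp at temperature \<open>e\<close>: for \<open>e > 0\<close> and
  \<open>n \<ge> 1\<close> a smooth concave function below the minimum, tending to it as
  \<open>e\<close> tends to 0.\<close>

definition softmin :: "nat \<Rightarrow> real \<Rightarrow> (nat \<Rightarrow> real) \<Rightarrow> real" where
  "softmin n e a = - e * ln (\<Sum>i<n. exp (- a i / e))"

text \<open>The Gibbs weights, which are the partial derivatives of \<open>softmin\<close>.\<close>

definition softweight :: "nat \<Rightarrow> real \<Rightarrow> (nat \<Rightarrow> real) \<Rightarrow> nat \<Rightarrow> real" where
  "softweight n e a i = exp (- a i / e) / (\<Sum>j<n. exp (- a j / e))"

lemma sum_exp_pos: "n \<ge> 1 \<Longrightarrow> 0 < (\<Sum>i<n. exp (a i :: real))" for n :: nat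
  by (rule sum_pos) (auto simp: lessThan_empty_iff)

lemma softweight_nonneg: "0 \<le> softweight n e a i"
  unfolding softweight_def by (auto intro!: divide_nonneg_nonneg sum_nonneg)

lemma sum_softweight: "n \<ge> 1 \<Longrightarrow> (\<Sum>i<n. softweight n e a i) = 1"
  unfolding softweight_def sum_divide_distrib[symmetric] using sum_exp_pos[of n "\<lambda>i. - a i / e"] by simp

lemma softweight_le_1: "n \<ge> 1 \<Longrightarrow> i < n \<Longrightarrow> softweight n e a i \<le> 1"
  using sum_softweight[of n e a] member_le_sum[of i "{..<n}" "softweight n e a"] softweight_nonneg[of n e a]
  by auto

lemma softmin_mono:
  assumes "n \<ge> 1" "e > 0" "\<And>i. i < n \<Longrightarrow> a i \<le> b i"
  shows "softmin n e a \<le> softmin n e b"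
proof -
  have "(\<Sum>i<n. exp (- b i / e)) \<le> (\<Sum>i<n. exp (- a i / e))"
    using assms by (intro sum_mono) (auto intro!: divide_right_mono)
  then have "ln (\<Sum>i<n. exp (- b i / e)) \<le> ln (\<Sum>i<n. exp (- a i / e))"
    using sum_exp_pos[OF assms(1)] by (subst ln_le_cancel_iff) auto
  then show ?thesis using assms(2) by (simp add: softmin_def)
qed

lemma softmin_shift:
  assumes "n \<ge> 1" "e > 0"
  shows "softmin n e (\<lambda>i. a i + t) = softmin n e a + t"
proof -
  have "(\<Sum>i<n. exp (- (a i + t) / e)) = exp (- t / e) * (\<Sum>i<n. exp (- a i / e))"
    unfolding sum_distrib_left
    by (intro sum.cong) (auto simp: exp_add[symmetric] diff_divide_distrib add_divide_distrib)
  moreover have "ln (exp (- t / e) * (\<Sum>i<n. exp (- a i / e))) = - t / e + ln (\<Sum>i<n. exp (- a i / e))"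
    using sum_exp_pos[OF assms(1), of "\<lambda>i. - a i / e"] by (subst ln_mult) auto
  ultimately show ?thesis using assms(2) by (simp add: softmin_def field_simps)
qed

lemma softmin_lipschitz:
  assumes "n \<ge> 1" "e > 0" "\<And>i. i < n \<Longrightarrow> \<bar>a i - b i\<bar> \<le> d"
  shows "\<bar>softmin n e a - softmin n e b\<bar> \<le> d"
proof -
  have "softmin n e a \<le> softmin n e (\<lambda>i. b i + d)" "softmin n e b \<le> softmin n e (\<lambda>i. a i + d)"
    using assms by (auto intro!: softmin_mono simp: abs_le_iff)
       (metis add.commute assms(3) abs_le_iff diff_le_eq minus_diff_eq)+
  then show ?thesis using assms by (simp add: softmin_shift)
qed

lemma softmin_le:
  assumes "e > 0" "i < n"
  shows "softmin n e a \<le> a i"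
proof -
  have "exp (- a i / e) \<le> (\<Sum>i<n. exp (- a i / e))"
    using assms by (intro member_le_sum) auto
  then have "- a i / e \<le> ln (\<Sum>i<n. exp (- a i / e))"
    using sum_exp_pos[of n] assms by (subst ln_ge_iff) auto
  then show ?thesis using assms(1) by (simp add: softmin_def field_simps)
qed

text \<open>The entropy term is bounded crudely by \<open>- w * ln w \<le> 1 - w\<close>.\<close>

lemma softweight_sum_le_softmin:
  assumes "n \<ge> 1" "e > 0"
  shows "(\<Sum>i<n. softweight n e a i * a i) \<le> softmin n e a + e * n"
proof -
  define S where "S = (\<Sum>j<n. exp (- a j / e))"
  have S: "S > 0" using sum_exp_pos[OF assms(1)] by (simp add: S_def)
  have *: "softweight n e a i * (a i - softmin n e a) \<le> e" if "i < n" for i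
  proof -
    define w where "w = softweight n e a i"
    have w: "w > 0" "w \<le> 1" using softweight_le_1[OF assms(1) that, of e a] S
      by (auto simp: w_def softweight_def S_def)
    have "ln w = - a i / e - ln S" using S unfolding w_def softweight_def S_def[symmetric] by (simp add: ln_div)
    then have "a i - softmin n e a = e * ln (1 / w)"
      using assms(2) w unfolding softmin_def S_def[symmetric] by (simp add: ln_div field_simps)
    moreover have "ln (1 / w) \<le> 1 / w - 1" using w by (intro ln_le_minus_one) auto
    ultimately have "w * (a i - softmin n e a) \<le> w * (e * (1 / w - 1))"
      using w assms(2) by (auto intro!: mult_left_mono)
    also have "\<dots> = e - e * w" using w by (simp add: field_simps)
    also have "\<dots> \<le> e" using w assms(2) by simp
    finally show ?thesis by (simp add: w_def)
  qed
  have "(\<Sum>i<n. softweight n e a i * a i) - softmin n e a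
      = (\<Sum>i<n. softweight n e a i * a i) - (\<Sum>i<n. softweight n e a i) * softmin n e a"
    using sum_softweight[OF assms(1)] by simp
  also have "\<dots> = (\<Sum>i<n. softweight n e a i * (a i - softmin n e a))"
    by (simp add: sum_distrib_right sum_subtractf right_diff_distrib)
  also have "\<dots> \<le> (\<Sum>i<n. e)" by (intro sum_mono) (use * in auto)
  finally show ?thesis by (simp add: mult.commute)
qed

text \<open>The supergradient inequality of a concave function along one axis, without derivatives.
  Changing coordinate \<open>i\<close> multiplies the sum \<open>S\<close> by a
  \<open>w\<close>-average of \<open>exp 0\<close> and \<open>exp (- t / e)\<close>, and convexity
  of \<open>exp\<close> bounds that average from below by \<open>exp (- w * t / e)\<close>.\<close>

lemma softmin_tangent:
  assumes n: "n \<ge> 1" and e: "e > 0" and i: "i < n"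
  shows "softmin n e (a(i := a i + t)) \<le> softmin n e a + t * softweight n e a i"
proof -
  define S where "S = (\<Sum>j<n. exp (- a j / e))"
  define w where "w = softweight n e a i"
  have S: "S > 0" using sum_exp_pos[OF n] by (simp add: S_def)
  have w: "w \<ge> 0" "w \<le> 1" using softweight_le_1[OF n i, of e a] softweight_nonneg[of n e a i] by (auto simp: w_def)
  have wS: "w * S = exp (- a i / e)" using S unfolding w_def softweight_def S_def[symmetric] by simp
  have "(\<Sum>j<n. exp (- (a(i := a i + t)) j / e))
      = exp (- (a i + t) / e) + (\<Sum>j\<in>{..<n} - {i}. exp (- a j / e))"
    using i by (subst sum.remove[of _ i]) auto
  also have "(\<Sum>j\<in>{..<n} - {i}. exp (- a j / e)) = S - exp (- a i / e)"
    unfolding S_def using i by (subst sum.remove[of "{..<n}" i]) auto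
  also have "exp (- (a i + t) / e) = exp (- a i / e) * exp (- t / e)"
    by (simp add: exp_add[symmetric] add_divide_distrib diff_divide_distrib)
  also have "exp (- a i / e) * exp (- t / e) + (S - exp (- a i / e)) = S * ((1 - w) * exp 0 + w * exp (- t / e))"
    unfolding wS[symmetric] by (simp add: algebra_simps)
  finally have eq: "(\<Sum>j<n. exp (- (a(i := a i + t)) j / e)) = S * ((1 - w) * exp 0 + w * exp (- t / e))" .
  have "exp ((1 - w) *\<^sub>R 0 + w *\<^sub>R (- t / e)) \<le> (1 - w) * exp 0 + w * exp (- t / e)"
    using convex_onD[OF convex_on_exp[of 1], of w 0 "- t / e"] w by simp
  then have "S * exp (- w * t / e) \<le> (\<Sum>j<n. exp (- (a(i := a i + t)) j / e))"
    unfolding eq using S by (intro mult_left_mono) auto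
  then have "ln (S * exp (- w * t / e)) \<le> ln (\<Sum>j<n. exp (- (a(i := a i + t)) j / e))"
    using S by (subst ln_le_cancel_iff) (auto intro: sum_exp_pos[OF n])
  also have "ln (S * exp (- w * t / e)) = ln S - w * t / e" using S by (subst ln_mult) auto
  finally have "e * (ln S - w * t / e) \<le> e * ln (\<Sum>j<n. exp (- (a(i := a i + t)) j / e))"
    using e by (intro mult_left_mono) auto
  then show ?thesis using e unfolding softmin_def S_def w_def by (simp add: algebra_simps)
qed

section \<open>Duality\<close>

text \<open>Maximising the dual functional with \<open>min\<close> replaced by the soft minimum yields a partition of
  unity whose masses are exactly \<open>q\<close> by the first-order conditions, and which is optimal
  up to the entropy bound.\<close>

lemma (in prob_space) entropic_partition:
  fixes e :: real and q :: "nat \<Rightarrow> real" and c :: "'a \<Rightarrow> 'a \<Rightarrow> real"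
  assumes n: "n \<ge> 1" and e: "e > 0"
    and q_pos: "\<And>i. i < n \<Longrightarrow> q i > 0" and q_sum: "(\<Sum>i<n. q i) = 1"
    and c_nonneg: "\<And>u v. 0 \<le> c u v" and c_meas: "\<And>i. i < n \<Longrightarrow> c (x i) \<in> borel_measurable M"
    and int0: "integrable M (fz c n x (\<lambda>_. 0))"
  obtains z \<phi> where "\<forall>i<n. z i \<le> 0" "\<forall>i<n. \<phi> i \<in> borel_measurable M"
    "\<forall>i y. 0 \<le> \<phi> i y" "\<forall>y. (\<Sum>i<n. \<phi> i y) = 1" "\<forall>i<n. (\<integral>y. \<phi> i y \<partial>M) = q i"
    "\<forall>y. (\<Sum>i<n. \<phi> i y * (c (x i) y - z i)) \<le> fz c n x z y + e * n"
proof -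
  define a where "a z y i = c (x i) y - z i" for z y i
  define sm where "sm z y = softmin n e (a z y)" for z y
  define J where "J z = (\<Sum>i<n. z i * q i) + (\<integral>y. sm z y \<partial>M)" for z
  have sm_le: "sm z y \<le> fz c n x z y" for z y
    by (rule fz_greatest[OF n]) (auto simp: sm_def a_def intro: order.trans[OF softmin_le[OF e]])
  have sw_ge: "fz c n x z y \<le> (\<Sum>i<n. softweight n e (a z y) i * a z y i)" for z y
  proof -
    have "fz c n x z y = (\<Sum>i<n. softweight n e (a z y) i * fz c n x z y)"
      using sum_softweight[OF n] by (simp add: sum_distrib_right[symmetric])
    also have "\<dots> \<le> (\<Sum>i<n. softweight n e (a z y) i * a z y i)"
      by (intro sum_mono mult_left_mono) (auto simp: a_def softweight_nonneg fz_le)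
    finally show ?thesis .
  qed
  have sm_ge: "fz c n x z y - e * n \<le> sm z y" for z y
    using sw_ge[of z y] softweight_sum_le_softmin[OF n e, of "a z y"] by (simp add: sm_def)
  have a_meas [measurable]: "(\<lambda>y. a z y i) \<in> borel_measurable M" if "i < n" for z i
    using c_meas[OF that] by (simp add: a_def)
  have fz_int: "integrable M (fz c n x z)" for z
    by (rule fz_integrable_perturb[OF n c_meas int0])
  have sm_meas: "sm z \<in> borel_measurable M" for z
    unfolding sm_def[abs_def] softmin_def by measurable
  have sm_int: "integrable M (sm z)" for z
  proof (rule Bochner_Integration.integrable_bound)
    show "integrable M (\<lambda>y. \<bar>fz c n x z y\<bar> + e * n)" using fz_int by auto
    show "AE y in M. norm (sm z y) \<le> norm (\<bar>fz c n x z y\<bar> + e * n)"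
      using sm_le[of z] sm_ge[of z] e by (intro AE_I2) (smt (verit) mult_nonneg_nonneg of_nat_0_le_iff real_norm_def)
  qed (rule sm_meas)
  have q_le: "q i \<le> 1" if "i < n" for i
    using q_sum member_le_sum[of i "{..<n}" q] that q_pos by (auto intro: less_imp_le)
  have J_lip: "\<bar>J z - J z'\<bar> \<le> 2 * (\<Sum>i<n. \<bar>z i - z' i\<bar>)" for z z'
  proof -
    define d where "d = (\<Sum>i<n. \<bar>z i - z' i\<bar>)"
    have "\<bar>sm z y - sm z' y\<bar> \<le> d" for y
      unfolding sm_def by (rule softmin_lipschitz[OF n e])
        (auto simp: a_def d_def abs_minus_commute intro!: member_le_sum)
    then have "\<bar>\<integral>y. sm z y - sm z' y \<partial>M\<bar> \<le> d"
      by (intro order.trans[OF integral_abs_bound] integral_le_const) (use sm_int in auto)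
    then have 1: "\<bar>(\<integral>y. sm z y \<partial>M) - (\<integral>y. sm z' y \<partial>M)\<bar> \<le> d" using sm_int by simp
    have "\<bar>(\<Sum>i<n. z i * q i) - (\<Sum>i<n. z' i * q i)\<bar> = \<bar>\<Sum>i<n. (z i - z' i) * q i\<bar>"
      by (simp add: sum_subtractf left_diff_distrib)
    also have "\<dots> \<le> (\<Sum>i<n. \<bar>z i - z' i\<bar> * 1)"
      by (intro order.trans[OF sum_abs] sum_mono) (auto simp: abs_mult abs_of_pos[OF q_pos] q_le intro!: mult_left_le)
    finally show ?thesis using 1 by (simp add: J_def d_def)
  qed
  define qm where "qm = Min (q ` {..<n})"
  have qm: "0 < qm" "\<And>i. i < n \<Longrightarrow> qm \<le> q i"
    using n q_pos by (auto simp: qm_def Min_gr_iff lessThan_empty_iff)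
  \<comment> \<open>The events that some cost exceeds \<open>k\<close> decrease to the empty set
    because costs are finite, so one of them has probability at most half of the least mass
    \<open>qm\<close>.\<close>
  obtain K :: nat where K: "prob {y \<in> space M. \<exists>i<n. c (x i) y > real K} \<le> qm / 2"
  proof -
    define A where "A k = {y \<in> space M. \<exists>i\<in>{..<n}. c (x i) y > real k}" for k :: nat
    have "range A \<subseteq> events" unfolding A_def using c_meas by auto
    moreover have "decseq A" unfolding A_def decseq_def by (force dest: order.strict_trans1[OF of_nat_mono])
    ultimately have "(\<lambda>k. prob (A k)) \<longlonglongrightarrow> prob (\<Inter>k. A k)" by (rule finite_Lim_measure_decseq)
    moreover have "(\<Inter>k. A k) = {}"
    proof (rule ccontr)
      assume "(\<Inter>k. A k) \<noteq> {}"
      then obtain y where y: "\<And>k. y \<in> A k" by auto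
      obtain k :: nat where k: "(\<Sum>i<n. c (x i) y) \<le> real k" using real_arch_simple by blast
      from y[of k] obtain i where "i < n" "c (x i) y > real k" by (auto simp: A_def)
      moreover have "c (x i) y \<le> (\<Sum>i<n. c (x i) y)" using \<open>i < n\<close> c_nonneg by (intro member_le_sum) auto
      ultimately show False using k by linarith
    qed
    ultimately have "(\<lambda>k. prob (A k)) \<longlonglongrightarrow> 0" by simp
    then have "eventually (\<lambda>k. prob (A k) < qm / 2) sequentially"
      by (rule order_tendstoD) (use qm in auto)
    then obtain k where "prob (A k) < qm / 2" by (auto simp: eventually_sequentially)
    then show ?thesis by (intro that[of k]) (auto simp: A_def Bex_def)
  qed
  define B where "B = {y \<in> space M. \<exists>i\<in>{..<n}. c (x i) y > real K}"
  have B: "B \<in> events" "prob B \<le> qm / 2"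
    using c_meas K by (auto simp: B_def Bex_def)
  \<comment> \<open>The largest coordinate is 0 and the smallest is \<open>- V\<close>. The linear
    part loses \<open>V * qm\<close>. The soft minimum can gain a multiple of \<open>V\<close> only
    on \<open>B\<close>, since elsewhere label \<open>j\<close> caps it at \<open>K\<close>; as
    \<open>B\<close> has probability at most \<open>qm / 2\<close>, half of the loss
    survives.\<close>
  have coercive: "J z \<le> (\<integral>y. fz c n x (\<lambda>_. 0) y \<partial>M) + K - V * qm / 2"
    if z: "\<And>i. i < n \<Longrightarrow> z i \<le> 0" "\<And>i. i < n \<Longrightarrow> - V \<le> z i" and j: "j < n" "z j = 0" and k: "k < n" "z k = - V" for z j k V
  proof -
    have V: "V \<ge> 0" using z k by force
    have "(\<Sum>i<n. z i * q i) = z k * q k + (\<Sum>i\<in>{..<n} - {k}. z i * q i)"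
      using k by (subst sum.remove[of _ k]) auto
    also have "\<dots> \<le> z k * q k"
      using z q_pos by (auto intro!: sum_nonpos mult_nonpos_nonneg intro: less_imp_le)
    also have "\<dots> \<le> - V * qm" using k qm(2)[of k] V by (auto intro!: mult_left_mono)
    finally have 1: "(\<Sum>i<n. z i * q i) \<le> - V * qm" .
    have "sm z y \<le> fz c n x (\<lambda>_. 0) y + K + V * indicator B y" if y: "y \<in> space M" for y
    proof (cases "y \<in> B")
      case True
      obtain i where i: "i < n" "fz c n x (\<lambda>_. 0) y = c (x i) y - 0" by (rule fz_attained[OF n])
      have "sm z y \<le> c (x i) y - z i" by (rule order.trans[OF sm_le fz_le[OF i(1)]])
      then show ?thesis using True i z(2)[OF i(1)] by (simp add: indicator_def)
    next
      case False
      then have "c (x j) y \<le> K" using y j by (auto simp: B_def not_less)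
      moreover have "sm z y \<le> c (x j) y" using sm_le[of z y] fz_le[OF j(1), of c x z y] j by auto
      moreover have "0 \<le> fz c n x (\<lambda>_. 0) y" by (rule fz_nonneg[OF n c_nonneg]) auto
      ultimately show ?thesis using False by simp
    qed
    then have "(\<integral>y. sm z y \<partial>M) \<le> (\<integral>y. fz c n x (\<lambda>_. 0) y + K + V * indicator B y \<partial>M)"
      by (intro integral_mono sm_int) (use int0 B in \<open>auto simp: emeasure_eq_measure\<close>)
    also have "\<dots> = (\<integral>y. fz c n x (\<lambda>_. 0) y \<partial>M) + K + V * prob B"
      using int0 B by (simp add: emeasure_eq_measure prob_space)
    also have "V * prob B \<le> V * (qm / 2)" using V B by (intro mult_left_mono) auto
    finally show ?thesis using 1 by (simp add: J_def)
  qed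
  \<comment> \<open>Chosen so that \<open>V > W\<close> pushes the bound \<open>coercive\<close>
    below \<open>J\<close> at the zero parameter, whose entropy loss is at most
    \<open>e * n\<close>. A maximiser over the box is then a global one.\<close>
  define W where "W = 2 * (K + e * n) / qm + 1"
  have W: "W \<ge> 0" using qm e by (simp add: W_def)
  obtain z where z: "\<forall>i<n. - W \<le> z i \<and> z i \<le> 0"
    and "\<forall>v. (\<forall>i<n. - W \<le> v i \<and> v i \<le> 0) \<longrightarrow> J v \<le> J z"
    by (rule lipschitz_attains_max_on_box[OF J_lip, of "\<lambda>_. - W" "\<lambda>_. 0"]) (use W in simp)
  then have z_max: "\<And>v. (\<And>i. i < n \<Longrightarrow> - W \<le> v i \<and> v i \<le> 0) \<Longrightarrow> J v \<le> J z" by simp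
  have opt: "J v \<le> J z" for v
  proof -
    \<comment> \<open>\<open>J\<close> is invariant under adding a constant because the masses sum
      to 1, so an arbitrary \<open>v\<close> may be moved to have maximum 0.\<close>
    define t where "t = Max (v ` {..<n})"
    define v' where "v' i = v i + - t" for i
    have t_in: "t \<in> v ` {..<n}" unfolding t_def by (rule Max_in) (use n in \<open>auto simp: lessThan_empty_iff\<close>)
    then obtain j where j: "j < n" "v' j = 0" by (auto simp: v'_def)
    have v'_le: "v' i \<le> 0" if "i < n" for i using that by (auto simp: v'_def t_def)
    have "sm v' y = sm v y + t" for y
    proof -
      have "a v' y = (\<lambda>i. a v y i + t)" by (auto simp: a_def v'_def)
      then show ?thesis by (simp add: sm_def softmin_shift[OF n e])
    qed
    then have "(\<integral>y. sm v' y \<partial>M) = (\<integral>y. sm v y \<partial>M) + t" using sm_int[of v] by (simp add: prob_space)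
    moreover have "(\<Sum>i<n. v' i * q i) = (\<Sum>i<n. v i * q i) - t"
      using q_sum by (simp add: v'_def left_diff_distrib sum_subtractf sum_distrib_left[symmetric])
    ultimately have eq: "J v' = J v" by (simp add: J_def)
    define V where "V = Max ((\<lambda>i. - v' i) ` {..<n})"
    have "V \<in> (\<lambda>i. - v' i) ` {..<n}" unfolding V_def by (rule Max_in) (use n in \<open>auto simp: lessThan_empty_iff\<close>)
    then obtain k where k: "k < n" "v' k = - V" by auto
    have V: "- V \<le> v' i" if "i < n" for i
    proof -
      have "- v' i \<le> V" unfolding V_def using that by (intro Max_ge) auto
      then show ?thesis by simp
    qed
    show ?thesis
    proof (cases "V \<le> W")
      case True
      then have "J v' \<le> J z" using V v'_le by (intro z_max) force
      then show ?thesis using eq by simp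
    next
      case False
      then have "2 * (K + e * n) < V * qm" using qm by (simp add: W_def field_simps)
      then have "J v' \<le> (\<integral>y. fz c n x (\<lambda>_. 0) y \<partial>M) - e * n"
        using coercive[OF v'_le V j k] by simp
      also have "\<dots> \<le> J (\<lambda>_. 0)"
      proof -
        have "(\<integral>y. fz c n x (\<lambda>_. 0) y - e * n \<partial>M) \<le> (\<integral>y. sm (\<lambda>_. 0) y \<partial>M)"
          by (intro integral_mono sm_int sm_ge) (use int0 in auto)
        then show ?thesis using int0 by (simp add: J_def prob_space)
      qed
      also have "\<dots> \<le> J z" using W by (intro z_max) auto
      finally show ?thesis using eq by simp
    qed
  qed
  define \<phi> where "\<phi> i y = softweight n e (a z y) i" for i y
  have sw_meas: "(\<lambda>y. softweight n e (a v y) i) \<in> borel_measurable M" if "i < n" for v i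
    unfolding softweight_def using that by measurable
  have mass: "(\<integral>y. \<phi> i y \<partial>M) = q i" if i: "i < n" for i
  proof -
    define v where "v t = z(i := z i + t)" for t
    define \<psi> where "\<psi> t y = softweight n e (a (v t) y) i" for t y
    have \<psi>_int: "integrable M (\<psi> t)" for t
      unfolding \<psi>_def using sw_meas[OF i] softweight_le_1[OF n i] softweight_nonneg
      by (intro integrable_const_bound[where B = 1]) (auto simp: abs_of_nonneg)
    \<comment> \<open>The tangent is taken at the perturbed point \<open>v t\<close>, not at
      \<open>z\<close>; combined with \<open>J (v t) \<le> J z\<close> this gives the useful
      direction. Dividing by positive and by negative \<open>t\<close> and letting \<open>t\<close>
      tend to 0 yields both inequalities for the mass.\<close>
    have ineq: "t * q i \<le> t * (\<integral>y. \<psi> t y \<partial>M)" for t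
    proof -
      have "sm z y \<le> sm (v t) y + t * \<psi> t y" for y
      proof -
        have "a z y = (a (v t) y)(i := a (v t) y i + t)" by (auto simp: a_def v_def)
        then show ?thesis unfolding sm_def \<psi>_def using softmin_tangent[OF n e i] by metis
      qed
      then have "(\<integral>y. sm z y \<partial>M) \<le> (\<integral>y. sm (v t) y + t * \<psi> t y \<partial>M)"
        by (intro integral_mono sm_int) (use sm_int \<psi>_int in auto)
      also have "\<dots> = (\<integral>y. sm (v t) y \<partial>M) + t * (\<integral>y. \<psi> t y \<partial>M)" using sm_int \<psi>_int by simp
      finally have 1: "(\<integral>y. sm z y \<partial>M) \<le> (\<integral>y. sm (v t) y \<partial>M) + t * (\<integral>y. \<psi> t y \<partial>M)" .
      have "(\<Sum>k<n. v t k * q k) = (\<Sum>k<n. z k * q k) + t * q i"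
        using i by (simp add: v_def sum.remove[of "{..<n}" i] algebra_simps)
      then show ?thesis using opt[of "v t"] 1 by (simp add: J_def)
    qed
    have lim: "(\<lambda>k. \<integral>y. \<psi> (s k) y \<partial>M) \<longlonglongrightarrow> (\<integral>y. \<phi> i y \<partial>M)" if s: "s \<longlonglongrightarrow> 0" for s
    proof (rule integral_dominated_convergence[where w = "\<lambda>_. 1"])
      show "\<phi> i \<in> borel_measurable M" using sw_meas[OF i] by (simp add: \<phi>_def[abs_def])
      show "\<And>k. \<psi> (s k) \<in> borel_measurable M" using \<psi>_int by blast
      have v_lim: "(\<lambda>k. v (s k) j) \<longlonglongrightarrow> z j" for j
        using tendsto_add[OF tendsto_const[of "z i"] s] by (cases "j = i") (auto simp: v_def)
      have "(\<lambda>k. \<psi> (s k) y) \<longlonglongrightarrow> \<phi> i y" for y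
        unfolding \<psi>_def \<phi>_def softweight_def a_def
        by (intro tendsto_intros v_lim) (use e sum_exp_pos[OF n] in \<open>auto simp: less_imp_neq[symmetric]\<close>)
      then show "AE y in M. (\<lambda>k. \<psi> (s k) y) \<longlonglongrightarrow> \<phi> i y" by simp
      show "\<And>k. AE y in M. norm (\<psi> (s k) y) \<le> 1"
        using softweight_le_1[OF n i] softweight_nonneg by (auto simp: \<psi>_def abs_of_nonneg)
    qed auto
    show ?thesis
    proof (rule antisym)
      have "(\<lambda>k. - inverse (real (Suc k))) \<longlonglongrightarrow> 0"
        using tendsto_minus[OF LIMSEQ_inverse_real_of_nat] by simp
      then show "(\<integral>y. \<phi> i y \<partial>M) \<le> q i"
        by (rule lim[THEN LIMSEQ_le_const2]) (use ineq[of "- inverse (real (Suc _))"] in auto)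
      show "q i \<le> (\<integral>y. \<phi> i y \<partial>M)"
        by (rule lim[OF LIMSEQ_inverse_real_of_nat, THEN LIMSEQ_le_const]) (use ineq[of "inverse (real (Suc _))"] in auto)
    qed
  qed
  show ?thesis
  proof (rule that[of z \<phi>])
    show "\<forall>y. (\<Sum>i<n. \<phi> i y * (c (x i) y - z i)) \<le> fz c n x z y + e * n"
    proof
      show "(\<Sum>i<n. \<phi> i y * (c (x i) y - z i)) \<le> fz c n x z y + e * n" for y
        using softweight_sum_le_softmin[OF n e, of "a z y"] sm_le[of z y] by (simp add: \<phi>_def sm_def a_def)
    qed
  qed (use z mass sw_meas sum_softweight[OF n] in \<open>auto simp: \<phi>_def[abs_def] softweight_nonneg\<close>)
qed

section \<open>Laws on finitely many points, couplings, and the two inequalities of duality\<close>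

lemma sets_discrete_law [simp]: "sets (discrete_law N x p) = sets borel"
  by (simp add: discrete_law_def)

lemma nn_integral_discrete_law:
  assumes "g \<in> borel_measurable borel"
  shows "(\<integral>\<^sup>+ u. g u \<partial>discrete_law N x p) = (\<Sum>i<N. ennreal (p i) * g (x i))"
  unfolding discrete_law_def using assms
  by (subst nn_integral_distr) (auto simp: nn_integral_density nn_integral_count_space_finite)

lemma emeasure_discrete_law:
  assumes "A \<in> sets borel"
  shows "emeasure (discrete_law N x p) A = (\<Sum>i<N. ennreal (p i) * indicator A (x i))"
  using nn_integral_discrete_law[of "indicator A" N x p] assms by simp

text \<open>\<open>\<phi> i y\<close> is read as the share of the mass at \<open>y\<close> that is
  matched with \<open>x i\<close>. The plan is built on pairs of an index and a point and then
  pushed forward, so coinciding points \<open>x i\<close> merge by themselves.\<close>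

lemma coupling_of_partition:
  fixes Q :: "'a::euclidean_space measure"
  assumes "prob_space Q" and sets_Q: "sets Q = sets borel"
    and \<phi>_meas: "\<And>i. i < n \<Longrightarrow> \<phi> i \<in> borel_measurable Q"
    and \<phi>_nonneg: "\<And>i y. 0 \<le> \<phi> i y" and \<phi>_sum: "\<And>y. (\<Sum>i<n. \<phi> i y) = 1"
    and \<phi>_mass: "\<And>i. i < n \<Longrightarrow> (\<integral>y. \<phi> i y \<partial>Q) = q i"
  obtains \<pi> where "\<pi> \<in> couplings (discrete_law n x q) Q"
    "\<forall>g \<in> borel_measurable borel.
       (\<integral>\<^sup>+ u. g u \<partial>\<pi>) = (\<Sum>i<n. \<integral>\<^sup>+ y. ennreal (\<phi> i y) * g (x i, y) \<partial>Q)"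
proof -
  interpret Q: prob_space Q by fact
  have \<phi>_le: "\<phi> i y \<le> 1" if "i < n" for i y
    using member_le_sum[of i "{..<n}" "\<lambda>i. \<phi> i y"] \<phi>_sum \<phi>_nonneg that by auto
  have \<phi>_nn: "(\<integral>\<^sup>+ y. ennreal (\<phi> i y) \<partial>Q) = ennreal (q i)" if "i < n" for i
    using \<phi>_mass[OF that] \<phi>_le[OF that] \<phi>_nonneg \<phi>_meas[OF that]
    by (subst nn_integral_eq_integral) (auto intro!: Q.integrable_const_bound[where B = 1])
  define D where "D = density (count_space {..<n} \<Otimes>\<^sub>M Q) (\<lambda>(i, y). ennreal (\<phi> i y))"
  define \<pi> where "\<pi> = distr D (borel :: ('a \<times> 'a) measure) (\<lambda>(i, y). (x i, y))"
  have m1: "(\<lambda>(i, y). ennreal (\<phi> i y)) \<in> borel_measurable (count_space {..<n} \<Otimes>\<^sub>M Q)"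
    by (rule measurable_pair_measure_countable1) (use \<phi>_meas in auto)
  have m2: "(\<lambda>(i, y). (x i, y)) \<in> (count_space {..<n} \<Otimes>\<^sub>M Q) \<rightarrow>\<^sub>M (borel :: ('a \<times> 'a) measure)"
  proof (rule measurable_pair_measure_countable1)
    fix i
    have "(\<lambda>y. (x i, y)) \<in> borel \<rightarrow>\<^sub>M (borel :: ('a \<times> 'a) measure)"
      by (intro borel_measurable_continuous_onI continuous_intros)
    then show "(\<lambda>y. case (i, y) of (i, y) \<Rightarrow> (x i, y)) \<in> Q \<rightarrow>\<^sub>M (borel :: ('a \<times> 'a) measure)"
      by (subst measurable_cong_sets[OF sets_Q refl]) simp
  qed auto
  have nn: "(\<integral>\<^sup>+ u. g u \<partial>\<pi>) = (\<Sum>i<n. \<integral>\<^sup>+ y. ennreal (\<phi> i y) * g (x i, y) \<partial>Q)"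
    if g: "g \<in> borel_measurable borel" for g
  proof -
    have mg: "(\<lambda>w. g (case w of (i, y) \<Rightarrow> (x i, y))) \<in> borel_measurable (count_space {..<n} \<Otimes>\<^sub>M Q)"
      using m2 g by (rule measurable_compose)
    have "(\<integral>\<^sup>+ u. g u \<partial>\<pi>) = (\<integral>\<^sup>+ w. g (case w of (i, y) \<Rightarrow> (x i, y)) \<partial>D)"
      unfolding \<pi>_def using g m2 by (intro nn_integral_distr) (auto simp: D_def)
    also have "\<dots> = (\<integral>\<^sup>+ w. (case w of (i, y) \<Rightarrow> ennreal (\<phi> i y)) * g (case w of (i, y) \<Rightarrow> (x i, y)) \<partial>(count_space {..<n} \<Otimes>\<^sub>M Q))"
      unfolding D_def using mg m1 by (intro nn_integral_density) auto
    also have "\<dots> = (\<integral>\<^sup>+ i. \<integral>\<^sup>+ y. ennreal (\<phi> i y) * g (x i, y) \<partial>Q \<partial>count_space {..<n})"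
      using mg m1 by (subst Q.nn_integral_fst[symmetric]) auto
    also have "\<dots> = (\<Sum>i<n. \<integral>\<^sup>+ y. ennreal (\<phi> i y) * g (x i, y) \<partial>Q)"
      by (simp add: nn_integral_count_space_finite)
    finally show ?thesis .
  qed
  have borel_fst: "fst \<in> (borel :: ('a \<times> 'a) measure) \<rightarrow>\<^sub>M borel"
    and borel_snd: "snd \<in> (borel :: ('a \<times> 'a) measure) \<rightarrow>\<^sub>M borel"
    by (auto intro!: borel_measurable_continuous_onI continuous_intros)
  have sets_\<pi>: "sets \<pi> = sets borel" by (simp add: \<pi>_def)
  have fst_eq: "distr \<pi> borel fst = discrete_law n x q"
  proof (rule measure_eqI)
    fix A assume "A \<in> sets (distr \<pi> borel fst)"
    then have A: "A \<in> sets borel" by simp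
    have fm: "fst \<in> \<pi> \<rightarrow>\<^sub>M borel"
      by (subst measurable_cong_sets[OF sets_\<pi> refl]) (fact borel_fst)
    have "emeasure (distr \<pi> borel fst) A = (\<integral>\<^sup>+ u. indicator A u \<partial>distr \<pi> borel fst)" using A by simp
    also have "\<dots> = (\<integral>\<^sup>+ u. indicator A (fst u) \<partial>\<pi>)" using fm A by (intro nn_integral_distr) auto
    also have "\<dots> = (\<Sum>i<n. \<integral>\<^sup>+ y. ennreal (\<phi> i y) * indicator A (x i) \<partial>Q)"
      by (subst nn) (use A in \<open>auto intro!: measurable_compose[OF borel_fst, of "indicator A"]\<close>)
    also have "\<dots> = (\<Sum>i<n. ennreal (q i) * indicator A (x i))"
      using \<phi>_meas by (intro sum.cong) (auto simp: nn_integral_multc \<phi>_nn)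
    finally show "emeasure (distr \<pi> borel fst) A = emeasure (discrete_law n x q) A"
      by (simp add: emeasure_discrete_law[OF A])
  qed simp
  have snd_eq: "distr \<pi> borel snd = Q"
  proof (rule measure_eqI)
    fix A assume "A \<in> sets (distr \<pi> borel snd)"
    then have A: "A \<in> sets borel" by simp
    have sm: "snd \<in> \<pi> \<rightarrow>\<^sub>M borel"
      by (subst measurable_cong_sets[OF sets_\<pi> refl]) (fact borel_snd)
    have "emeasure (distr \<pi> borel snd) A = (\<integral>\<^sup>+ u. indicator A u \<partial>distr \<pi> borel snd)" using A by simp
    also have "\<dots> = (\<integral>\<^sup>+ u. indicator A (snd u) \<partial>\<pi>)" using sm A by (intro nn_integral_distr) auto
    also have "\<dots> = (\<Sum>i<n. \<integral>\<^sup>+ y. ennreal (\<phi> i y) * indicator A y \<partial>Q)"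
      by (subst nn) (use A in \<open>auto intro!: measurable_compose[OF borel_snd, of "indicator A"]\<close>)
    also have "\<dots> = (\<integral>\<^sup>+ y. (\<Sum>i<n. ennreal (\<phi> i y) * indicator A y) \<partial>Q)"
      using \<phi>_meas A sets_Q by (subst nn_integral_sum) auto
    also have "\<dots> = (\<integral>\<^sup>+ y. indicator A y \<partial>Q)"
      using \<phi>_sum \<phi>_nonneg by (simp add: sum_distrib_right[symmetric] sum_ennreal)
    finally show "emeasure (distr \<pi> borel snd) A = emeasure Q A" using A sets_Q by simp
  qed (use sets_Q in simp)
  have "prob_space \<pi>"
  proof
    have "emeasure \<pi> (space \<pi>) = (\<integral>\<^sup>+ u. 1 \<partial>\<pi>)" by simp
    also have "\<dots> = (\<Sum>i<n. \<integral>\<^sup>+ y. ennreal (\<phi> i y) \<partial>Q)" by (subst nn) auto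
    also have "\<dots> = (\<integral>\<^sup>+ y. (\<Sum>i<n. ennreal (\<phi> i y)) \<partial>Q)" using \<phi>_meas by (subst nn_integral_sum) auto
    also have "\<dots> = 1" using \<phi>_sum \<phi>_nonneg by (simp add: sum_ennreal Q.emeasure_space_1)
    finally show "emeasure \<pi> (space \<pi>) = 1" .
  qed
  then have "\<pi> \<in> couplings (discrete_law n x q) Q"
    using fst_eq snd_eq sets_\<pi> by (simp add: couplings_def)
  then show ?thesis using nn that by blast
qed

text \<open>\<open>transport_cost\<close> before \<open>enn2real\<close>, which sends an infinite
  value to 0. Suprema and finiteness have to be argued at this level.\<close>

definition transport_cost_enn :: "('a::euclidean_space \<Rightarrow> 'a \<Rightarrow> real) \<Rightarrow> 'a measure \<Rightarrow> 'a measure \<Rightarrow> ennreal" where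
  "transport_cost_enn c \<mu> \<nu> = (INF \<pi>\<in>couplings \<mu> \<nu>. \<integral>\<^sup>+ u. ennreal (c (fst u) (snd u)) \<partial>\<pi>)"

lemma borel_measurable_section:
  assumes "(\<lambda>u. c (fst u) (snd u)) \<in> borel_measurable (borel :: ('a::euclidean_space \<times> 'a) measure)"
  shows "c u \<in> borel_measurable borel"
proof -
  have "(\<lambda>y. (u, y)) \<in> borel \<rightarrow>\<^sub>M (borel :: ('a \<times> 'a) measure)"
    by (intro borel_measurable_continuous_onI continuous_intros)
  from measurable_compose[OF this assms] show ?thesis by simp
qed

text \<open>Under every coupling \<open>fz c n x z y \<le> c u y + \<omega> u\<close> holds almost
  surely, and integrating \<open>\<omega>\<close> against the first marginal gives at most the
  linear part. Nonpositive \<open>z\<close> makes the potential and the linear part nonnegative, so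
  \<open>ennreal\<close> truncates nothing.\<close>

lemma weak_duality:
  assumes n: "n \<ge> 1" and q: "\<And>i. i < n \<Longrightarrow> q i \<ge> 0" and z: "\<And>i. i < n \<Longrightarrow> z i \<le> 0"
    and c_nonneg: "\<And>u v. 0 \<le> c u v"
    and c_meas: "(\<lambda>u. c (fst u) (snd u)) \<in> borel_measurable (borel :: ('a::euclidean_space \<times> 'a) measure)"
  shows "(\<integral>\<^sup>+ y. ennreal (fz c n x z y) \<partial>Q)
    \<le> transport_cost_enn c (discrete_law n x q) Q + ennreal (\<Sum>i<n. - z i * q i)"
proof -
  \<comment> \<open>\<open>B\<close> is at least every \<open>- z i\<close>. It is the value given
    to labels that sit elsewhere, so that they never lower the minimum at an actual point.\<close>
  define B where "B = (\<Sum>i<n. - z i)"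
  have B: "- z i \<le> B" if "i < n" for i
    unfolding B_def by (rule member_le_sum) (use z that in auto)
  \<comment> \<open>The points \<open>x i\<close> need not be distinct, so the potential at a point is the best one
      among its labels.\<close>
  define \<omega> where "\<omega> u = Min ((\<lambda>k. if x k = u then - z k else B) ` {..<n})" for u
  have \<omega>_meas [measurable]: "\<omega> \<in> borel_measurable borel"
    unfolding \<omega>_def by (rule borel_measurable_Min) auto
  have \<omega>_le: "\<omega> (x i) \<le> - z i" if "i < n" for i
    unfolding \<omega>_def by (rule Min_le) (use that in \<open>auto intro!: image_eqI[of _ _ i]\<close>)
  have \<omega>_att: "\<exists>k<n. \<omega> u = (if x k = u then - z k else B)" for u
  proof -
    have "\<omega> u \<in> (\<lambda>k. if x k = u then - z k else B) ` {..<n}"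
      unfolding \<omega>_def by (rule Min_in, simp, subst image_is_empty) (use n in \<open>simp add: lessThan_empty_iff\<close>)
    then show ?thesis by auto
  qed
  have \<omega>_nonneg: "0 \<le> \<omega> u" for u
    using \<omega>_att[of u] z B n by (smt (verit) less_le_trans zero_less_one)
  have key: "fz c n x z y \<le> c (x j) y + \<omega> (x j)" if j: "j < n" for j y
  proof -
    obtain k where k: "k < n" "\<omega> (x j) = (if x k = x j then - z k else B)" using \<omega>_att by blast
    show ?thesis
    proof (cases "x k = x j")
      case True
      then show ?thesis using fz_le[OF k(1), of c x z y] k by simp
    next
      case False
      then show ?thesis using fz_le[OF j, of c x z y] k B[OF j] by simp
    qed
  qed
  have main: "(\<integral>\<^sup>+ y. ennreal (fz c n x z y) \<partial>Q)
      \<le> (\<integral>\<^sup>+ u. ennreal (c (fst u) (snd u)) \<partial>\<pi>) + ennreal (\<Sum>i<n. - z i * q i)"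
    if \<pi>: "\<pi> \<in> couplings (discrete_law n x q) Q" for \<pi>
  proof -
    have sets_\<pi>: "sets \<pi> = sets borel" and fst_\<pi>: "distr \<pi> borel fst = discrete_law n x q"
      and snd_\<pi>: "distr \<pi> borel snd = Q" using \<pi> by (auto simp: couplings_def)
    have [measurable]: "fst \<in> \<pi> \<rightarrow>\<^sub>M borel" "snd \<in> \<pi> \<rightarrow>\<^sub>M borel"
      by (subst measurable_cong_sets[OF sets_\<pi> refl], intro borel_measurable_continuous_onI continuous_intros)+
    have c_meas' [measurable]: "(\<lambda>u. c (fst u) (snd u)) \<in> borel_measurable \<pi>"
      using c_meas by (subst measurable_cong_sets[OF sets_\<pi> refl])
    have fz_meas [measurable]: "fz c n x z \<in> borel_measurable borel"
      using fz_measurable[of n c x "\<lambda>y. y" borel z] borel_measurable_section[OF c_meas] by simp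
    have "AE u in discrete_law n x q. u \<in> x ` {..<n}"
    proof (rule AE_I')
      have "closed (x ` {..<n})" by (intro finite_imp_closed) auto
      then have "- x ` {..<n} \<in> sets borel" by auto
      then show "- x ` {..<n} \<in> null_sets (discrete_law n x q)"
        by (auto simp: null_sets_def emeasure_discrete_law)
    qed auto
    then have "AE u in distr \<pi> borel fst. u \<in> x ` {..<n}" unfolding fst_\<pi> .
    then have AE: "AE u in \<pi>. fst u \<in> x ` {..<n}" by (rule AE_distrD[rotated]) measurable
    have "(\<integral>\<^sup>+ y. ennreal (fz c n x z y) \<partial>Q) = (\<integral>\<^sup>+ u. ennreal (fz c n x z (snd u)) \<partial>\<pi>)"
      by (subst snd_\<pi>[symmetric], subst nn_integral_distr) auto
    also have "\<dots> \<le> (\<integral>\<^sup>+ u. ennreal (c (fst u) (snd u)) + ennreal (\<omega> (fst u)) \<partial>\<pi>)"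
    proof (rule nn_integral_mono_AE)
      show "AE u in \<pi>. ennreal (fz c n x z (snd u)) \<le> ennreal (c (fst u) (snd u)) + ennreal (\<omega> (fst u))"
        using AE
      proof eventually_elim
        case (elim u)
        then obtain j where "j < n" "fst u = x j" by auto
        then show ?case using key[of j "snd u"] c_nonneg \<omega>_nonneg
          by (simp add: ennreal_plus[symmetric] ennreal_leI del: ennreal_plus)
      qed
    qed
    also have "\<dots> = (\<integral>\<^sup>+ u. ennreal (c (fst u) (snd u)) \<partial>\<pi>) + (\<integral>\<^sup>+ u. ennreal (\<omega> (fst u)) \<partial>\<pi>)"
      by (intro nn_integral_add) measurable
    also have "(\<integral>\<^sup>+ u. ennreal (\<omega> (fst u)) \<partial>\<pi>) = (\<integral>\<^sup>+ u. ennreal (\<omega> u) \<partial>discrete_law n x q)"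
      by (subst fst_\<pi>[symmetric], subst nn_integral_distr) auto
    also have "\<dots> = (\<Sum>i<n. ennreal (q i) * ennreal (\<omega> (x i)))" by (intro nn_integral_discrete_law) measurable
    also have "\<dots> = ennreal (\<Sum>i<n. q i * \<omega> (x i))"
      using q \<omega>_nonneg by (subst sum_ennreal[symmetric]) (auto simp: ennreal_mult)
    also have "\<dots> \<le> ennreal (\<Sum>i<n. - z i * q i)"
      using q \<omega>_le by (intro ennreal_leI sum_mono) (metis lessThan_iff mult.commute mult_left_mono)
    finally show ?thesis by (simp add: add_left_mono)
  qed
    have "(\<integral>\<^sup>+ y. ennreal (fz c n x z y) \<partial>Q) - ennreal (\<Sum>i<n. - z i * q i) \<le> transport_cost_enn c (discrete_law n x q) Q"
      unfolding transport_cost_enn_def using main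
      by (intro INF_greatest) (simp add: ennreal_minus_le_iff add.commute)
    then show ?thesis by (simp add: ennreal_minus_le_iff add.commute)
qed

lemma strong_duality:
  fixes e :: real and Q :: "'a::euclidean_space measure"
  assumes Q: "prob_space Q" "sets Q = sets borel"
    and n: "n \<ge> 1" and e: "e > 0"
    and q_pos: "\<And>i. i < n \<Longrightarrow> q i > 0" and q_sum: "(\<Sum>i<n. q i) = 1"
    and c_nonneg: "\<And>u v. 0 \<le> c u v"
    and c_meas: "(\<lambda>u. c (fst u) (snd u)) \<in> borel_measurable (borel :: ('a \<times> 'a) measure)"
    and int0: "integrable Q (fz c n x (\<lambda>_. 0))"
  obtains z where "\<forall>i<n. z i \<le> 0"
    "transport_cost_enn c (discrete_law n x q) Q \<le> ennreal (g_c c n x q Q z + e)"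
proof -
  interpret Q: prob_space Q by fact
  have c_sec: "c u \<in> borel_measurable Q" for u
    using borel_measurable_section[OF c_meas] by (subst measurable_cong_sets[OF Q(2) refl])
  \<comment> \<open>The entropy error is \<open>n\<close> times the temperature, so temperature
    \<open>e / n\<close> leaves \<open>e\<close> in total.\<close>
  have en: "e / n > 0" using n e by simp
  obtain z \<phi> where "\<forall>i<n. z i \<le> 0" "\<forall>i<n. \<phi> i \<in> borel_measurable Q"
    "\<forall>i y. 0 \<le> \<phi> i y" "\<forall>y. (\<Sum>i<n. \<phi> i y) = 1"
    "\<forall>i<n. (\<integral>y. \<phi> i y \<partial>Q) = q i"
    and \<phi>_opt: "\<forall>y. (\<Sum>i<n. \<phi> i y * (c (x i) y - z i)) \<le> fz c n x z y + (e / n) * n"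
    by (rule Q.entropic_partition[of n "e / n" q c x, OF n en q_pos q_sum c_nonneg c_sec int0])
  then have z: "\<And>i. i < n \<Longrightarrow> z i \<le> 0" and \<phi>_meas: "\<And>i. i < n \<Longrightarrow> \<phi> i \<in> borel_measurable Q"
    and \<phi>_nonneg: "\<And>i y. 0 \<le> \<phi> i y" and \<phi>_sum: "\<And>y. (\<Sum>i<n. \<phi> i y) = 1"
    and \<phi>_mass: "\<And>i. i < n \<Longrightarrow> (\<integral>y. \<phi> i y \<partial>Q) = q i" by auto
  obtain \<pi> where \<pi>: "\<pi> \<in> couplings (discrete_law n x q) Q"
    and nn: "\<forall>g \<in> borel_measurable borel.
       (\<integral>\<^sup>+ u. g u \<partial>\<pi>) = (\<Sum>i<n. \<integral>\<^sup>+ y. ennreal (\<phi> i y) * g (x i, y) \<partial>Q)"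
    by (rule coupling_of_partition[of Q n \<phi> q x, OF Q \<phi>_meas \<phi>_nonneg \<phi>_sum \<phi>_mass])
  define f where "f y = fz c n x z y + e + (\<Sum>i<n. \<phi> i y * z i)" for y
  have le_f: "(\<Sum>i<n. \<phi> i y * c (x i) y) \<le> f y" for y
    using \<phi>_opt[rule_format, of y] n by (simp add: f_def right_diff_distrib sum_subtractf)
  have f_nonneg: "0 \<le> f y" for y
    by (rule order.trans[OF _ le_f]) (auto intro!: sum_nonneg mult_nonneg_nonneg \<phi>_nonneg c_nonneg)
  have fz_int: "integrable Q (fz c n x z)" by (rule Q.fz_integrable_perturb[of n c x, OF n c_sec int0])
  have \<phi>_le: "\<phi> i y \<le> 1" if "i < n" for i y
    using member_le_sum[of i "{..<n}" "\<lambda>i. \<phi> i y"] \<phi>_sum \<phi>_nonneg that by auto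
  have \<phi>_int: "integrable Q (\<phi> i)" if "i < n" for i
    using \<phi>_meas[OF that] \<phi>_le[OF that] \<phi>_nonneg by (intro Q.integrable_const_bound[where B = 1]) auto
  have f_int: "integrable Q f" unfolding f_def using fz_int \<phi>_int
    by (intro Bochner_Integration.integrable_add Bochner_Integration.integrable_sum integrable_mult_left) auto
  have "(\<integral>\<^sup>+ u. ennreal (c (fst u) (snd u)) \<partial>\<pi>) = (\<Sum>i<n. \<integral>\<^sup>+ y. ennreal (\<phi> i y) * ennreal (c (x i) y) \<partial>Q)"
    using nn[rule_format, OF measurable_compose[OF c_meas measurable_ennreal]] by simp
  also have "\<dots> = (\<integral>\<^sup>+ y. (\<Sum>i<n. ennreal (\<phi> i y) * ennreal (c (x i) y)) \<partial>Q)"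
    using \<phi>_meas c_sec by (subst nn_integral_sum) auto
  also have "\<dots> = (\<integral>\<^sup>+ y. ennreal (\<Sum>i<n. \<phi> i y * c (x i) y) \<partial>Q)"
    using \<phi>_nonneg c_nonneg by (simp add: ennreal_mult[symmetric] sum_ennreal)
  also have "\<dots> \<le> (\<integral>\<^sup>+ y. ennreal (f y) \<partial>Q)" by (intro nn_integral_mono ennreal_leI le_f)
  also have "\<dots> = ennreal (\<integral>y. f y \<partial>Q)" using f_int f_nonneg by (intro nn_integral_eq_integral) auto
  also have "(\<integral>y. f y \<partial>Q) = (\<integral>y. fz c n x z y \<partial>Q) + e + (\<Sum>i<n. q i * z i)"
  proof -
    have "(\<integral>y. (\<Sum>i<n. \<phi> i y * z i) \<partial>Q) = (\<Sum>i<n. q i * z i)"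
      using \<phi>_int \<phi>_mass by (subst Bochner_Integration.integral_sum) auto
    moreover have "integrable Q (\<lambda>y. \<Sum>i<n. \<phi> i y * z i)"
      using \<phi>_int by (intro Bochner_Integration.integrable_sum integrable_mult_left) auto
    ultimately show ?thesis unfolding f_def using fz_int by (simp add: Q.prob_space)
  qed
  also have "\<dots> = g_c c n x q Q z + e" by (simp add: g_c_def mult.commute)
  finally have "(\<integral>\<^sup>+ u. ennreal (c (fst u) (snd u)) \<partial>\<pi>) \<le> ennreal (g_c c n x q Q z + e)" .
  then have "transport_cost_enn c (discrete_law n x q) Q \<le> ennreal (g_c c n x q Q z + e)"
    unfolding transport_cost_enn_def by (intro INF_lower2[OF \<pi>])
  then show ?thesis using z that by blast
qed

text \<open>The samples take values outside the finite set of the \<open>x i\<close> on a null set only, but measurability of the cost needs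
  every sample point; hence duality is proved for arbitrary points and without integrability of the
  cost, and the supremum is taken over a countable set.\<close>

lemma transport_cost_enn_eq_SUP:
  fixes Q :: "'a::euclidean_space measure"
  assumes Q: "prob_space Q" "sets Q = sets borel" and n: "n \<ge> 1"
    and q_pos: "\<And>i. i < n \<Longrightarrow> q i > 0" and q_sum: "(\<Sum>i<n. q i) = 1"
    and c_nonneg: "\<And>u v. 0 \<le> c u v"
    and c_meas: "(\<lambda>u. c (fst u) (snd u)) \<in> borel_measurable (borel :: ('a \<times> 'a) measure)"
  shows "transport_cost_enn c (discrete_law n x q) Q
    = (SUP z\<in>PiE {..<n} (\<lambda>_. {r \<in> \<rat>. r \<le> 0}).
         (\<integral>\<^sup>+ y. ennreal (fz c n x z y) \<partial>Q) - ennreal (\<Sum>i<n. - z i * q i))" (is "?T = (SUP z\<in>?Z. ?F z)")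
proof (rule antisym)
  interpret Q: prob_space Q by fact
  have c_sec: "c u \<in> borel_measurable Q" for u
    using borel_measurable_section[OF c_meas] by (subst measurable_cong_sets[OF Q(2) refl])
  have fz_meas: "fz c n x z \<in> borel_measurable Q" for z
    using fz_measurable[of n c x "\<lambda>y. y" Q] c_sec by simp
  show "(SUP z\<in>?Z. ?F z) \<le> ?T"
  proof (rule SUP_least)
    fix z assume "z \<in> ?Z"
    then have "(\<integral>\<^sup>+ y. ennreal (fz c n x z y) \<partial>Q) \<le> ?T + ennreal (\<Sum>i<n. - z i * q i)"
      using q_pos by (intro weak_duality[OF n _ _ c_nonneg c_meas]) (auto intro: less_imp_le)
    then show "?F z \<le> ?T" by (simp add: ennreal_minus_le_iff add.commute)
  qed
  show "?T \<le> (SUP z\<in>?Z. ?F z)"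
  proof (cases "integrable Q (fz c n x (\<lambda>_. 0))")
    case False
    \<comment> \<open>Without integrability the zero potential alone has the dual value
      \<open>top\<close>; \<open>z0\<close> is its representative in the index set.\<close>
    define z0 :: "nat \<Rightarrow> real" where "z0 = (\<lambda>i\<in>{..<n}. 0)"
    have "fz c n x z0 = fz c n x (\<lambda>_. 0)" by (intro ext fz_cong) (auto simp: z0_def)
    moreover have "(\<integral>\<^sup>+ y. ennreal (fz c n x (\<lambda>_. 0) y) \<partial>Q) = \<infinity>"
      using False fz_meas fz_nonneg[of n c "\<lambda>_. 0" x, OF n c_nonneg]
      by (subst (asm) integrable_iff_bounded) (auto simp: less_top[symmetric] abs_of_nonneg)
    ultimately have F0: "?F z0 = top" by simp
    have "?T \<le> ?F z0" unfolding F0 by (rule top_greatest)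
    also have "?F z0 \<le> (SUP z\<in>?Z. ?F z)"
      by (intro SUP_upper) (unfold z0_def, rule restrict_PiE_iff[THEN iffD2], simp)
    finally show ?thesis .
  next
    case True
    show ?thesis
    proof (rule ennreal_le_epsilon)
      fix d :: real assume d: "0 < d"
      define e where "e = d / 2"
      have e: "e > 0" using d by (simp add: e_def)
      obtain z where z: "\<forall>i<n. z i \<le> 0" and le: "?T \<le> ennreal (g_c c n x q Q z + e)"
        using strong_duality[OF Q n e q_pos q_sum c_nonneg c_meas True] by blast
      have "\<exists>r. r \<in> \<rat> \<and> z i - e < r \<and> r < z i" for i
        using Rats_dense_in_real[of "z i - e" "z i"] e by auto
      then obtain r where r: "\<And>i. r i \<in> \<rat>" "\<And>i. z i - e < r i" "\<And>i. r i < z i" by metis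
      define w where "w = restrict r {..<n}"
      have "r i \<le> 0" if "i < n" for i using r(3)[of i] z that by force
      then have w: "w \<in> ?Z" using r(1) by (auto simp: w_def)
      have w_le: "w i \<le> 0" if "i < n" for i using w that by auto
      have "g_c c n x q Q z = (\<integral>y. fz c n x z y \<partial>Q) - (\<Sum>i<n. - z i * q i)" by (simp add: g_c_def sum_negf)
      also have "\<dots> \<le> (\<integral>y. fz c n x w y \<partial>Q) - ((\<Sum>i<n. - w i * q i) - e)"
      proof (rule diff_mono)
        show "(\<integral>y. fz c n x z y \<partial>Q) \<le> (\<integral>y. fz c n x w y \<partial>Q)"
        proof (intro integral_mono Q.fz_integrable_perturb[of n c x, OF n c_sec True] fz_greatest[OF n])
          fix y i assume i: "i < n"
          show "fz c n x z y \<le> c (x i) y - w i"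
            using fz_le[OF i, of c x z y] r(3)[of i] i by (simp add: w_def)
        qed
        have "(\<Sum>i<n. - w i * q i) \<le> (\<Sum>i<n. (e - z i) * q i)"
          using q_pos r(2) by (intro sum_mono mult_right_mono) (auto simp: w_def less_imp_le algebra_simps)
        also have "\<dots> = e + (\<Sum>i<n. - z i * q i)"
          using q_sum by (simp add: left_diff_distrib sum_subtractf sum_distrib_left[symmetric] sum_negf)
        finally show "(\<Sum>i<n. - w i * q i) - e \<le> (\<Sum>i<n. - z i * q i)" by simp
      qed
      finally have "ennreal (g_c c n x q Q z + e) \<le> ennreal (((\<integral>y. fz c n x w y \<partial>Q) - (\<Sum>i<n. - w i * q i)) + d)"
        by (intro ennreal_leI) (simp add: e_def)
      also have "\<dots> \<le> ennreal ((\<integral>y. fz c n x w y \<partial>Q) - (\<Sum>i<n. - w i * q i)) + ennreal d"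
        using d by (cases "0 \<le> (\<integral>y. fz c n x w y \<partial>Q) - (\<Sum>i<n. - w i * q i)") (auto simp: ennreal_neg intro!: ennreal_leI)
      also have "ennreal ((\<integral>y. fz c n x w y \<partial>Q) - (\<Sum>i<n. - w i * q i)) = ?F w"
      proof -
        have "0 \<le> (\<Sum>i<n. - w i * q i)"
          using w_le q_pos by (intro sum_nonneg mult_nonneg_nonneg) (auto intro: less_imp_le)
        then show ?thesis
          using Q.fz_integrable_perturb[of n c x, OF n c_sec True] fz_nonneg[of n c w x, OF n c_nonneg w_le]
          by (subst nn_integral_eq_integral) (auto simp: ennreal_minus)
      qed
      also have "?F w \<le> (SUP z\<in>?Z. ?F z)" by (intro SUP_upper w)
      finally show "?T \<le> (SUP z\<in>?Z. ?F z) + ennreal d" using le order.trans by (simp add: add_right_mono)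
    qed
  qed
qed

context
  fixes Q :: "'a::euclidean_space measure" and c :: "'a \<Rightarrow> 'a \<Rightarrow> real" and n :: nat and x :: "nat \<Rightarrow> 'a" and q :: "nat \<Rightarrow> real"
  assumes Q: "prob_space Q" "sets Q = sets borel" and n: "n \<ge> 1"
    and q_pos: "\<And>i. i < n \<Longrightarrow> q i > 0" and q_sum: "(\<Sum>i<n. q i) = 1"
    and c_nonneg: "\<And>u v. 0 \<le> c u v"
    and c_meas: "(\<lambda>u. c (fst u) (snd u)) \<in> borel_measurable (borel :: ('a \<times> 'a) measure)"
    and c_int: "\<And>i. i < n \<Longrightarrow> integrable Q (c (x i))"
begin

text \<open>Integrable costs give a finite dual bound, so \<open>enn2real\<close> has not collapsed
  an infinite infimum to 0.\<close>

lemma transport_cost_finite: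
  "transport_cost_enn c (discrete_law n x q) Q = ennreal (transport_cost c (discrete_law n x q) Q)"
proof -
  interpret Q: prob_space Q by (rule Q)
  obtain z where "transport_cost_enn c (discrete_law n x q) Q \<le> ennreal (g_c c n x q Q z + 1)"
    by (rule strong_duality[OF Q n zero_less_one q_pos q_sum c_nonneg c_meas Q.fz_integrable[of n c x, OF n c_nonneg c_int]])
  then have "transport_cost_enn c (discrete_law n x q) Q < top" by (simp add: order.strict_trans1)
  then show ?thesis by (simp add: transport_cost_def transport_cost_enn_def)
qed

text \<open>\<open>weak_duality\<close> asks for nonpositive parameters. Lowering all coordinates by
  the same \<open>t\<close> achieves this and leaves \<open>g_c\<close> unchanged, since both masses
  are 1.\<close>

lemma g_c_le_transport_cost: "g_c c n x q Q z \<le> transport_cost c (discrete_law n x q) Q"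
proof -
  interpret Q: prob_space Q by (rule Q)
  have fz_int: "integrable Q (fz c n x w)" for w by (rule Q.fz_integrable[of n c x, OF n c_nonneg c_int])
  define t where "t = (\<Sum>i<n. \<bar>z i\<bar>)"
  define w where "w i = z i + - t" for i
  have w: "w i \<le> 0" if "i < n" for i
  proof -
    have "\<bar>z i\<bar> \<le> t" unfolding t_def by (rule member_le_sum) (use that in auto)
    then show ?thesis by (simp add: w_def)
  qed
  have "fz c n x w y = fz c n x z y + t" for y
    using fz_shift[OF n, of c x z "- t" y] by (simp add: w_def[abs_def])
  then have "(\<integral>y. fz c n x w y \<partial>Q) = (\<integral>y. fz c n x z y \<partial>Q) + t" using fz_int by (simp add: Q.prob_space)
  moreover have "(\<Sum>i<n. w i * q i) = (\<Sum>i<n. z i * q i) - t"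
    using q_sum by (simp add: w_def left_diff_distrib sum_subtractf sum_distrib_left[symmetric])
  ultimately have eq: "g_c c n x q Q z = (\<integral>y. fz c n x w y \<partial>Q) - (\<Sum>i<n. - w i * q i)"
    by (simp add: g_c_def sum_negf)
  have nonneg: "0 \<le> (\<Sum>i<n. - w i * q i)"
    using w q_pos by (intro sum_nonneg mult_nonneg_nonneg) (auto intro: less_imp_le)
  have T_nonneg: "0 \<le> transport_cost c (discrete_law n x q) Q" by (simp add: transport_cost_def)
  have "ennreal (\<integral>y. fz c n x w y \<partial>Q) = (\<integral>\<^sup>+ y. ennreal (fz c n x w y) \<partial>Q)"
    using fz_int fz_nonneg[of n c w x, OF n c_nonneg w] by (subst nn_integral_eq_integral) auto
  also have "\<dots> \<le> transport_cost_enn c (discrete_law n x q) Q + ennreal (\<Sum>i<n. - w i * q i)"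
    by (rule weak_duality[OF n less_imp_le[OF q_pos] w c_nonneg c_meas])
  also have "\<dots> = ennreal (transport_cost c (discrete_law n x q) Q + (\<Sum>i<n. - w i * q i))"
    using nonneg T_nonneg by (simp add: transport_cost_finite)
  finally have "(\<integral>y. fz c n x w y \<partial>Q) \<le> transport_cost c (discrete_law n x q) Q + (\<Sum>i<n. - w i * q i)"
    using nonneg T_nonneg by (subst (asm) ennreal_le_iff) auto
  then show ?thesis using eq by simp
qed

lemma transport_cost_le_g_c:
  assumes e: "e > 0"
  obtains z where "transport_cost c (discrete_law n x q) Q \<le> g_c c n x q Q z + e"
proof -
  interpret Q: prob_space Q by (rule Q)
  obtain z where z: "transport_cost_enn c (discrete_law n x q) Q \<le> ennreal (g_c c n x q Q z + e)"
    by (rule strong_duality[OF Q n e q_pos q_sum c_nonneg c_meas Q.fz_integrable[of n c x, OF n c_nonneg c_int]])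
  have T_nonneg: "0 \<le> transport_cost c (discrete_law n x q) Q" by (simp add: transport_cost_def)
  show ?thesis
  proof (cases "0 \<le> g_c c n x q Q z + e")
    case True
    then show ?thesis using z that by (simp add: transport_cost_finite)
  next
    case False
    \<comment> \<open>A negative dual value is truncated by \<open>ennreal\<close>, so the bound
      says only that the cost is 0; the zero potential, whose value is nonnegative, then
      serves.\<close>
    from z False have "transport_cost c (discrete_law n x q) Q = 0"
      using T_nonneg by (simp add: transport_cost_finite ennreal_neg)
    moreover have "g_c c n x q Q (\<lambda>_. 0) \<ge> 0"
      using fz_nonneg[of n c "\<lambda>_. 0" x, OF n c_nonneg] by (auto simp: g_c_def intro!: integral_nonneg_AE)
    ultimately show ?thesis using that[of "\<lambda>_. 0"] e by simp
  qed
qed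

end

text \<open>The couplings depend on \<open>\<omega>\<close>, but the dual side is a countable
  supremum over parameters that do not. Points and target measure may both be random, which covers
  either sample.\<close>

lemma transport_cost_measurable:
  fixes A :: "nat \<Rightarrow> 'b \<Rightarrow> 'a::euclidean_space" and R :: "'b \<Rightarrow> 'a measure"
  assumes R: "\<And>\<omega>. \<omega> \<in> space M \<Longrightarrow> prob_space (R \<omega>)" "\<And>\<omega>. \<omega> \<in> space M \<Longrightarrow> sets (R \<omega>) = sets borel"
    and n: "n \<ge> 1" and q_pos: "\<And>i. i < n \<Longrightarrow> q i > 0" and q_sum: "(\<Sum>i<n. q i) = 1"
    and c_nonneg: "\<And>u v. 0 \<le> c u v"
    and c_meas: "(\<lambda>u. c (fst u) (snd u)) \<in> borel_measurable (borel :: ('a \<times> 'a) measure)"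
    and int_meas: "\<And>z. (\<lambda>\<omega>. \<integral>\<^sup>+ y. ennreal (fz c n (\<lambda>k. A k \<omega>) z y) \<partial>R \<omega>) \<in> borel_measurable M"
  shows "(\<lambda>\<omega>. transport_cost c (discrete_law n (\<lambda>k. A k \<omega>) q) (R \<omega>)) \<in> borel_measurable M"
proof -
  have "countable (PiE {..<n} (\<lambda>_. {r \<in> \<rat>. r \<le> (0::real)}))"
    by (intro countable_PiE) (auto intro: countable_subset[OF _ countable_rat])
  then have "(\<lambda>\<omega>. SUP z\<in>PiE {..<n} (\<lambda>_. {r \<in> \<rat>. r \<le> 0}).
         (\<integral>\<^sup>+ y. ennreal (fz c n (\<lambda>k. A k \<omega>) z y) \<partial>R \<omega>) - ennreal (\<Sum>i<n. - z i * q i)) \<in> borel_measurable M"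
    by (intro borel_measurable_SUP borel_measurable_minus_ennreal int_meas) auto
  then have "(\<lambda>\<omega>. transport_cost_enn c (discrete_law n (\<lambda>k. A k \<omega>) q) (R \<omega>)) \<in> borel_measurable M"
    by (subst measurable_cong[OF transport_cost_enn_eq_SUP[OF R n q_pos q_sum c_nonneg c_meas]]) auto
  then show ?thesis unfolding transport_cost_def transport_cost_enn_def[symmetric] by measurable
qed

section \<open>Empirical measures as discrete laws\<close>

lemma empirical_eq_discrete_law:
  assumes "n > 0"
  shows "empirical f n = discrete_law n f (\<lambda>_. 1 / real n)"
proof (rule measure_eqI)
  fix A assume "A \<in> sets (empirical f n)"
  then have A: "A \<in> sets borel" by (simp add: empirical_def)
  have "emeasure (distr (count_space {..<n}) borel f) A = (\<Sum>i<n. indicator A (f i))"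
    using A by (subst nn_integral_indicator[symmetric], simp, subst nn_integral_distr) (auto simp: nn_integral_count_space_finite)
  then show "emeasure (empirical f n) A = emeasure (discrete_law n f (\<lambda>_. 1 / real n)) A"
    using A by (simp add: empirical_def emeasure_discrete_law sum_distrib_left)
qed (simp add: empirical_def)

lemma integral_discrete_law:
  fixes g :: "'a::topological_space \<Rightarrow> real"
  assumes "g \<in> borel_measurable borel" "\<And>i. i < N \<Longrightarrow> 0 \<le> p i"
  shows "(\<integral>u. g u \<partial>discrete_law N x p) = (\<Sum>i<N. p i * g (x i))" "integrable (discrete_law N x p) g"
proof -
  have "(\<integral>u. g u \<partial>discrete_law N x p) = (\<integral>i. p i * g (x i) \<partial>count_space {..<N})"
    unfolding discrete_law_def using assms by (subst integral_distr, simp, simp) (subst integral_density, auto simp: AE_count_space)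
  then show "(\<integral>u. g u \<partial>discrete_law N x p) = (\<Sum>i<N. p i * g (x i))"
    by (simp add: lebesgue_integral_count_space_finite)
  show "integrable (discrete_law N x p) g"
    unfolding discrete_law_def using assms
    by (subst integrable_distr_eq, simp, simp) (subst integrable_density, auto simp: AE_count_space integrable_count_space)
qed

lemma prob_space_discrete_law:
  assumes "\<And>i. i < N \<Longrightarrow> 0 \<le> p i" "(\<Sum>i<N. p i) = 1"
  shows "prob_space (discrete_law N x p)"
proof
  have "space (discrete_law N x p) = UNIV" using sets_eq_imp_space_eq[OF sets_discrete_law, of N x p] by simp
  then show "emeasure (discrete_law N x p) (space (discrete_law N x p)) = 1"
    using assms by (simp add: emeasure_discrete_law) (subst sum_ennreal, auto)
qed

section \<open>Uniqueness of the potential and linearisation\<close>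

lemma emeasure_compl_msupport:
  fixes Q :: "'a::euclidean_space measure"
  assumes "sets Q = sets borel"
  shows "closed (msupport Q)" "emeasure Q (- msupport Q) = 0"
proof -
  define F where "F = {ball y e | y e. e > 0 \<and> emeasure Q (ball y e) = 0}"
  have eq: "- msupport Q = \<Union>F"
  proof (intro subset_antisym subsetI)
    fix y assume "y \<in> - msupport Q"
    then obtain e where "e > 0" "emeasure Q (ball y e) = 0"
      by (auto simp: msupport_def not_gr_zero)
    then show "y \<in> \<Union>F" unfolding F_def by (intro UnionI[of "ball y e"]) auto
  next
    fix y assume "y \<in> \<Union>F"
    then obtain u e where u: "y \<in> ball u e" "emeasure Q (ball u e) = 0" by (auto simp: F_def)
    obtain d where d: "d > 0" "ball y d \<subseteq> ball u e" using u(1) open_ball open_contains_ball by blast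
    then have "emeasure Q (ball y d) \<le> emeasure Q (ball u e)" using assms by (intro emeasure_mono) auto
    then show "y \<in> - msupport Q" using d u(2) by (auto simp: msupport_def)
  qed
  have "open (\<Union>F)" by (auto simp: F_def)
  then show "closed (msupport Q)" using eq by (metis closed_def)
  obtain F' where F': "F' \<subseteq> F" "countable F'" "\<Union>F' = \<Union>F"
    by (rule Lindelof[of F]) (auto simp: F_def)
  have "\<Union>F' \<in> null_sets Q"
  proof -
    have "(\<Union>S\<in>F'. S) \<in> null_sets Q"
      by (rule null_sets_UN'[OF F'(2)]) (use F'(1) assms in \<open>auto simp: F_def null_sets_def\<close>)
    then show ?thesis by simp
  qed
  then show "emeasure Q (- msupport Q) = 0" using eq F'(3) by auto
qed

section \<open>The dual functional: shift invariance, concavity, Lipschitz continuity\<close>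

context
  fixes c :: "'a \<Rightarrow> 'a \<Rightarrow> real" and N :: nat and x :: "nat \<Rightarrow> 'a" and q :: "nat \<Rightarrow> real" and R :: "'a measure"
  assumes N: "N \<ge> 1" and R: "prob_space R" and q_sum: "(\<Sum>i<N. q i) = 1"
    and fz_int: "\<And>w. integrable R (fz c N x w)"
begin

lemma g_c_shift: "g_c c N x q R (\<lambda>i. w i + t) = g_c c N x q R w"
proof -
  interpret R: prob_space R by (rule R)
  have "(\<Sum>i<N. (w i + t) * q i) = (\<Sum>i<N. w i * q i) + t"
    using q_sum by (simp add: distrib_right sum.distrib sum_distrib_left[symmetric])
  then show ?thesis using fz_int by (simp add: g_c_def fz_shift[OF N] R.prob_space)
qed

lemma g_c_concave:
  assumes "0 \<le> s" "s \<le> 1"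
  shows "(1 - s) * g_c c N x q R w + s * g_c c N x q R w' \<le> g_c c N x q R (\<lambda>i. (1 - s) * w i + s * w' i)"
proof -
  have "(\<integral>y. (1 - s) * fz c N x w y + s * fz c N x w' y \<partial>R) \<le> (\<integral>y. fz c N x (\<lambda>i. (1 - s) * w i + s * w' i) y \<partial>R)"
    using fz_int by (intro integral_mono fz_concave[OF N assms]) auto
  moreover have "(\<integral>y. (1 - s) * fz c N x w y + s * fz c N x w' y \<partial>R) = (1 - s) * (\<integral>y. fz c N x w y \<partial>R) + s * (\<integral>y. fz c N x w' y \<partial>R)"
    using fz_int by simp
  moreover have "(\<Sum>i<N. ((1 - s) * w i + s * w' i) * q i) = (1 - s) * (\<Sum>i<N. w i * q i) + s * (\<Sum>i<N. w' i * q i)"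
    by (simp add: sum_distrib_left sum.distrib distrib_right mult.assoc)
  ultimately show ?thesis unfolding g_c_def distrib_left by linarith
qed

lemma g_c_lipschitz:
  assumes "\<And>i. i < N \<Longrightarrow> 0 \<le> q i"
  shows "\<bar>g_c c N x q R w - g_c c N x q R w'\<bar> \<le> 2 * (\<Sum>i<N. \<bar>w i - w' i\<bar>)"
proof -
  interpret R: prob_space R by (rule R)
  define d where "d = (\<Sum>i<N. \<bar>w i - w' i\<bar>)"
  have "\<bar>fz c N x w y - fz c N x w' y\<bar> \<le> d" for y
    by (rule fz_lipschitz[OF N]) (auto simp: d_def intro!: member_le_sum)
  then have "\<bar>\<integral>y. fz c N x w y - fz c N x w' y \<partial>R\<bar> \<le> d"
    by (intro order.trans[OF integral_abs_bound] R.integral_le_const) (use fz_int in auto)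
  then have 1: "\<bar>(\<integral>y. fz c N x w y \<partial>R) - (\<integral>y. fz c N x w' y \<partial>R)\<bar> \<le> d" using fz_int by simp
  have q_le: "q i \<le> 1" if "i < N" for i
    using q_sum member_le_sum[of i "{..<N}" q] that assms by auto
  have "\<bar>(\<Sum>i<N. w i * q i) - (\<Sum>i<N. w' i * q i)\<bar> = \<bar>\<Sum>i<N. (w i - w' i) * q i\<bar>"
    by (simp add: sum_subtractf left_diff_distrib)
  also have "\<dots> \<le> (\<Sum>i<N. \<bar>w i - w' i\<bar>)"
    by (intro order.trans[OF sum_abs] sum_mono) (auto simp: abs_mult abs_of_nonneg[OF assms] q_le intro!: mult_left_le)
  finally show ?thesis using 1 by (simp add: g_c_def d_def)
qed

end

locale semidiscrete =
  fixes c :: "'a::euclidean_space \<Rightarrow> 'a \<Rightarrow> real" and N :: nat and x :: "nat \<Rightarrow> 'a"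
    and p :: "nat \<Rightarrow> real" and Q :: "'a measure" and z :: "nat \<Rightarrow> real"
  assumes N: "N \<ge> 1" and p_pos: "\<And>i. i < N \<Longrightarrow> p i > 0" and p_sum: "(\<Sum>i<N. p i) = 1"
    and Q_prob: "prob_space Q" and Q_sets: "sets Q = sets borel"
    and Q_conn: "connected (msupport Q)"
    and c_nonneg: "\<And>u v. 0 \<le> c u v" and c_cont: "continuous_on UNIV (\<lambda>u. c (fst u) (snd u))"
    and c_int: "\<And>i. i < N \<Longrightarrow> integrable Q (c (x i))"
    and z_max: "\<And>w. g_c c N x p Q w \<le> g_c c N x p Q z"
begin

sublocale Q: prob_space Q by (rule Q_prob)

lemma c_meas: "(\<lambda>u. c (fst u) (snd u)) \<in> borel_measurable borel"
  by (rule borel_measurable_continuous_onI[OF c_cont])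

lemma c_section_cont: "continuous_on A (c u)"
proof -
  have "continuous_on A (\<lambda>y. c (fst (u, y)) (snd (u, y)))"
    by (rule continuous_on_compose2[OF c_cont]) (auto intro!: continuous_intros)
  then show ?thesis by simp
qed

lemma fz_cont: "continuous_on A (fz c N x w)"
proof -
  have *: "finite I \<Longrightarrow> I \<noteq> {} \<Longrightarrow> continuous_on A (\<lambda>y. Min ((\<lambda>i. c (x i) y - w i) ` I))" for I
  proof (induction I rule: finite_ne_induct)
    case (insert i I)
    then show ?case by (simp add: insert continuous_on_min c_section_cont continuous_intros)
  qed (auto intro!: continuous_intros c_section_cont)
  show ?thesis unfolding fz_def[abs_def] by (rule *) (use N in \<open>auto simp: lessThan_empty_iff\<close>)
qed

lemma fz_int: "integrable Q (fz c N x w)"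
  by (rule Q.fz_integrable[of N c x, OF N c_nonneg c_int])

lemma fz_borel: "fz c N x w \<in> borel_measurable borel"
  by (rule borel_measurable_continuous_onI[OF fz_cont])

text \<open>On the support, \<open>f\<^sub>z - f\<^sub>w\<close> is continuous and takes only the finitely many values
  \<open>w i - z i\<close>; hence it is constant when the support is connected.\<close>

lemma potential_unique:
  assumes w: "g_c c N x p Q w = g_c c N x p Q z" "w 0 = z 0" and j: "j < N"
  shows "w j = z j"
proof -
  let ?g = "g_c c N x p Q" and ?f = "fz c N x"
  \<comment> \<open>Of two maximisers the midpoint \<open>m\<close> is a third, so the nonnegative
    concavity defect \<open>D\<close> integrates to 0. Where \<open>D\<close> vanishes, a label
    active for \<open>m\<close> is active for \<open>z\<close> and for \<open>w\<close>, which
    determines the difference of the two potentials.\<close>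
  define m where "m i = (1 - 1 / 2) * z i + 1 / 2 * w i" for i
  have g_m: "?g m = ?g z"
  proof (rule antisym[OF z_max])
    have "(1 - 1 / 2) * ?g z + 1 / 2 * ?g w \<le> ?g m"
      unfolding m_def by (rule g_c_concave[OF N Q_prob p_sum fz_int]) auto
    then show "?g z \<le> ?g m" using w by simp
  qed
  define D where "D y = ?f m y - ((1 - 1 / 2) * ?f z y + 1 / 2 * ?f w y)" for y
  have D_nonneg: "0 \<le> D y" for y
    unfolding D_def m_def using fz_concave[OF N, of "1 / 2" c x z y w] by simp
  have D_int: "integrable Q D" unfolding D_def using fz_int by auto
  have "(\<integral>y. D y \<partial>Q) = (\<integral>y. ?f m y \<partial>Q) - ((1 - 1 / 2) * (\<integral>y. ?f z y \<partial>Q) + 1 / 2 * (\<integral>y. ?f w y \<partial>Q))"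
    unfolding D_def using fz_int by simp
  also have "\<dots> = ?g m - ((1 - 1 / 2) * ?g z + 1 / 2 * ?g w)"
    by (simp add: g_c_def m_def sum_distrib_left sum.distrib distrib_right mult.assoc add_divide_distrib sum_divide_distrib)
  also have "\<dots> = 0" using g_m w by simp
  finally have D_AE: "AE y in Q. D y = 0"
    using integral_nonneg_eq_0_iff_AE[OF D_int] D_nonneg by simp
  have D_cont: "continuous_on UNIV D" unfolding D_def by (intro continuous_intros fz_cont)
  \<comment> \<open>A nonzero value of the continuous \<open>D\<close> at a support point would
    persist on a ball of positive mass.\<close>
  have D0: "D y = 0" if y: "y \<in> msupport Q" for y
  proof (rule ccontr)
    assume "D y \<noteq> 0"
    have "open {y. D y \<noteq> 0}"
      using D_cont by (simp add: Collect_neg_eq open_closed closed_Collect_eq continuous_on_const)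
    then obtain e where e: "e > 0" "ball y e \<subseteq> {y. D y \<noteq> 0}"
      using \<open>D y \<noteq> 0\<close> unfolding open_contains_ball by blast
    have "AE u in Q. u \<notin> ball y e" using D_AE by (rule AE_mp) (use e(2) in \<open>auto intro!: AE_I2\<close>)
    then have "emeasure Q (ball y e) = 0"
      using Q_sets by (subst (asm) AE_iff_measurable[of "ball y e"]) (auto simp: sets_eq_imp_space_eq[OF Q_sets])
    then show False using y e(1) by (auto simp: msupport_def)
  qed
  have active: "?f z y - ?f w y = w i - z i" if "y \<in> msupport Q" "i < N" "?f m y = c (x i) y - m i" for y i
  proof -
    have "?f z y \<le> c (x i) y - z i" "?f w y \<le> c (x i) y - w i" using that by (auto intro: fz_le)
    then show ?thesis using D0[OF that(1)] that(3) by (simp add: D_def m_def)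
  qed
  \<comment> \<open>Every label is active somewhere on the support. Otherwise the points where label
    \<open>i\<close> misses activity by less than \<open>inverse (Suc k)\<close> lose all mass as
    \<open>k\<close> grows. Once they weigh less than \<open>p i\<close>, raising \<open>m i\<close>
    by that slack gains more in the linear part than the integral loses.\<close>
  have act_ex: "\<exists>y\<in>msupport Q. ?f m y = c (x i) y - m i" if i: "i < N" for i
  proof (rule ccontr)
    assume no: "\<not> ?thesis"
    define A where "A k = {y. c (x i) y - m i - inverse (real (Suc k)) < ?f m y}" for k
    have A_meas: "A k \<in> sets Q" for k
    proof -
      have "open (A k)" unfolding A_def
        by (intro open_Collect_less continuous_intros c_section_cont fz_cont)
      then show ?thesis using Q_sets by auto
    qed
    have "decseq A" unfolding decseq_def A_def
      by (auto intro: order.strict_trans1[rotated] simp: le_imp_inverse_le)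
    then have "(\<lambda>k. Q.prob (A k)) \<longlonglongrightarrow> Q.prob (\<Inter>k. A k)"
      using A_meas by (intro Q.finite_Lim_measure_decseq) auto
    moreover have "(\<Inter>k. A k) \<subseteq> - msupport Q"
    proof
      fix y assume y: "y \<in> (\<Inter>k. A k)"
      have "(\<lambda>k. c (x i) y - m i - inverse (real (Suc k))) \<longlonglongrightarrow> c (x i) y - m i - 0"
        by (intro tendsto_intros LIMSEQ_inverse_real_of_nat)
      then have "c (x i) y - m i - 0 \<le> ?f m y"
        by (rule LIMSEQ_le_const2) (use y in \<open>auto simp: A_def intro!: less_imp_le\<close>)
      then have "?f m y = c (x i) y - m i" using fz_le[OF i, of c x m y] by simp
      then show "y \<in> - msupport Q" using no by auto
    qed
    then have "emeasure Q (\<Inter>k. A k) \<le> emeasure Q (- msupport Q)"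
      by (rule emeasure_mono) (use emeasure_compl_msupport(1)[OF Q_sets] Q_sets in auto)
    then have "Q.prob (\<Inter>k. A k) = 0"
      using emeasure_compl_msupport(2)[OF Q_sets] by (simp add: measure_def)
    ultimately have "(\<lambda>k. Q.prob (A k)) \<longlonglongrightarrow> 0" by simp
    then have "eventually (\<lambda>k. Q.prob (A k) < p i) sequentially"
      by (rule order_tendstoD) (use p_pos[OF i] in auto)
    then obtain k where k: "Q.prob (A k) < p i" by (auto simp: eventually_sequentially)
    define t where "t = inverse (real (Suc k))"
    have t: "t > 0" by (simp add: t_def)
    have Ak: "A k = {y. c (x i) y - m i - t < ?f m y}" by (simp add: A_def t_def)
    have "?f m y - t * indicator (A k) y \<le> ?f (m(i := m i + t)) y" for y
    proof (rule fz_greatest[OF N])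
      fix l assume l: "l < N"
      show "?f m y - t * indicator (A k) y \<le> c (x l) y - (m(i := m i + t)) l"
        using fz_le[OF l, of c x m y] t
        by (cases "l = i"; cases "y \<in> A k") (auto simp: Ak)
    qed
    then have "(\<integral>y. ?f m y - t * indicator (A k) y \<partial>Q) \<le> (\<integral>y. ?f (m(i := m i + t)) y \<partial>Q)"
      by (intro integral_mono fz_int) (use fz_int A_meas in \<open>auto simp: Q.emeasure_eq_measure\<close>)
    also have "(\<integral>y. ?f m y - t * indicator (A k) y \<partial>Q) = (\<integral>y. ?f m y \<partial>Q) - t * Q.prob (A k)"
      using fz_int A_meas by (simp add: Q.emeasure_eq_measure)
    finally have "(\<integral>y. ?f m y \<partial>Q) - t * Q.prob (A k) \<le> (\<integral>y. ?f (m(i := m i + t)) y \<partial>Q)" .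
    moreover have "(\<Sum>l<N. (m(i := m i + t)) l * p l) = (\<Sum>l<N. m l * p l) + t * p i"
      using i by (simp add: sum.remove[of "{..<N}" i] algebra_simps)
    moreover have "t * Q.prob (A k) < t * p i" using k t by simp
    ultimately have "?g m < ?g (m(i := m i + t))" by (simp add: g_c_def)
    then show False using z_max[of "m(i := m i + t)"] g_m by simp
  qed
  have "(\<lambda>y. ?f z y - ?f w y) constant_on msupport Q"
  proof (rule continuous_finite_range_constant[OF Q_conn])
    show "continuous_on (msupport Q) (\<lambda>y. ?f z y - ?f w y)" by (intro continuous_intros fz_cont)
    have "(\<lambda>y. ?f z y - ?f w y) ` msupport Q \<subseteq> (\<lambda>i. w i - z i) ` {..<N}"
    proof (rule image_subsetI)
      fix y assume y: "y \<in> msupport Q"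
      obtain i where "i < N" "?f m y = c (x i) y - m i" by (rule fz_attained[OF N])
      then show "?f z y - ?f w y \<in> (\<lambda>i. w i - z i) ` {..<N}" using active[OF y] by auto
    qed
    then show "finite ((\<lambda>y. ?f z y - ?f w y) ` msupport Q)" by (rule finite_subset) auto
  qed
  then obtain k where k: "\<And>y. y \<in> msupport Q \<Longrightarrow> ?f z y - ?f w y = k" unfolding constant_on_def by blast
  have "w i - z i = k" if i: "i < N" for i
  proof -
    obtain y where "y \<in> msupport Q" "?f m y = c (x i) y - m i" using act_ex[OF i] by blast
    then show ?thesis using active[OF _ i] k by metis
  qed
  from this[OF j] this[of 0] show ?thesis using N w(2) by simp
qed

text \<open>On each face of the cube the functional attains its maximum, which by uniqueness lies
  strictly below the value at \<open>z\<close>. There are finitely many faces, so the least of the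
  differences works.\<close>

lemma potential_gap:
  assumes e: "e > 0"
  obtains d where "d > 0"
    "\<forall>w. w 0 = z 0 \<and> (\<forall>i<N. \<bar>w i - z i\<bar> \<le> e) \<and> (\<exists>i<N. \<bar>w i - z i\<bar> = e)
       \<longrightarrow> g_c c N x p Q w \<le> g_c c N x p Q z - d"
proof -
  let ?g = "g_c c N x p Q"
  have face: "\<exists>d>0. \<forall>w. w 0 = z 0 \<and> (\<forall>i<N. \<bar>w i - z i\<bar> \<le> e) \<and> w j - z j = s \<longrightarrow> ?g w \<le> ?g z - d"
    if j: "0 < j" "j < N" and s: "\<bar>s\<bar> = e" for j s
  proof -
    define l where "l i = (if i = 0 then z 0 else if i = j then z j + s else z i - e)" for i
    define u where "u i = (if i = 0 then z 0 else if i = j then z j + s else z i + e)" for i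
    have lip: "\<bar>?g w - ?g w'\<bar> \<le> 2 * (\<Sum>i<N. \<bar>w i - w' i\<bar>)" for w w'
      by (rule g_c_lipschitz[OF N Q_prob p_sum fz_int less_imp_le[OF p_pos]])
    obtain v where v: "\<forall>i<N. l i \<le> v i \<and> v i \<le> u i"
      and v_max: "\<forall>w. (\<forall>i<N. l i \<le> w i \<and> w i \<le> u i) \<longrightarrow> ?g w \<le> ?g v"
      by (rule lipschitz_attains_max_on_box[of ?g, OF lip, of l u]) (use e in \<open>auto simp: l_def u_def\<close>)
    have "v j \<noteq> z j" "v 0 = z 0" using v[rule_format, of j] v[rule_format, of 0] j s e by (auto simp: l_def u_def split: if_splits)
    then have "?g v \<noteq> ?g z" using potential_unique[of v j] j by auto
    then have "?g v < ?g z" using z_max[of v] by simp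
    moreover have "?g w \<le> ?g v" if "w 0 = z 0" "\<forall>i<N. \<bar>w i - z i\<bar> \<le> e" "w j - z j = s" for w
      by (rule v_max[rule_format]) (use that in \<open>auto simp: l_def u_def abs_le_iff algebra_simps\<close>)
    ultimately show ?thesis by (intro exI[of _ "?g z - ?g v"]) auto
  qed
  define I where "I = {1..<N} \<times> {e, - e}"
  have "\<forall>a\<in>I. \<exists>d>0. \<forall>w. w 0 = z 0 \<and> (\<forall>i<N. \<bar>w i - z i\<bar> \<le> e) \<and> w (fst a) - z (fst a) = snd a \<longrightarrow> ?g w \<le> ?g z - d"
    using face e by (auto simp: I_def)
  then obtain D where D: "\<And>a. a \<in> I \<Longrightarrow> D a > 0"
    "\<And>a w. a \<in> I \<Longrightarrow> w 0 = z 0 \<Longrightarrow> \<forall>i<N. \<bar>w i - z i\<bar> \<le> e \<Longrightarrow> w (fst a) - z (fst a) = snd a \<Longrightarrow> ?g w \<le> ?g z - D a"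
    by metis
  \<comment> \<open>The entry 1 keeps the set nonempty when \<open>N = 1\<close> and there are no
    faces.\<close>
  define d where "d = Min (insert 1 (D ` I))"
  have fin: "finite I" by (simp add: I_def)
  show ?thesis
  proof (rule that[of d])
    show "d > 0" using fin D(1) by (auto simp: d_def)
    show "\<forall>w. w 0 = z 0 \<and> (\<forall>i<N. \<bar>w i - z i\<bar> \<le> e) \<and> (\<exists>i<N. \<bar>w i - z i\<bar> = e) \<longrightarrow> ?g w \<le> ?g z - d"
    proof (intro allI impI, elim conjE exE)
      fix w j assume w: "w 0 = z 0" "\<forall>i<N. \<bar>w i - z i\<bar> \<le> e" and j: "j < N" "\<bar>w j - z j\<bar> = e"
      have "j \<noteq> 0" using w(1) j(2) e by (cases "j = 0") auto
      then have a: "(j, w j - z j) \<in> I" using j by (auto simp: I_def abs_if split: if_splits)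
      then have "?g w \<le> ?g z - D (j, w j - z j)" using w by (intro D(2)) auto
      moreover have "d \<le> D (j, w j - z j)" unfolding d_def using a fin by (intro Min_le) auto
      ultimately show "?g w \<le> ?g z - d" by simp
    qed
  qed
qed

text \<open>Passing from \<open>(p, Q)\<close> to \<open>(q, R)\<close> changes increments of the
  dual functional by \<open>E\<close>, which is at most \<open>S\<close> on the cube. On its
  boundary the gap \<open>d\<close> exceeds \<open>S\<close>, so there the perturbed functional is
  below its value at \<open>z\<close>; by concavity it stays below outside the cube. Hence its
  supremum exceeds the value at \<open>z\<close> by at most \<open>S\<close>, and duality identifies
  that supremum with the cost.\<close>

lemma transport_cost_linearisation:
  assumes e: "e > 0" and gap: "\<forall>w. w 0 = z 0 \<and> (\<forall>i<N. \<bar>w i - z i\<bar> \<le> e) \<and> (\<exists>i<N. \<bar>w i - z i\<bar> = e)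
       \<longrightarrow> g_c c N x p Q w \<le> g_c c N x p Q z - d"
    and R: "prob_space R" "sets R = sets borel" and c_int_R: "\<And>i. i < N \<Longrightarrow> integrable R (c (x i))"
    and q_pos: "\<And>i. i < N \<Longrightarrow> q i > 0" and q_sum: "(\<Sum>i<N. q i) = 1"
    and S: "\<And>w. w 0 = z 0 \<Longrightarrow> (\<forall>i<N. \<bar>w i - z i\<bar> \<le> e) \<Longrightarrow>
       \<bar>(\<Sum>i<N. (w i - z i) * (q i - p i)) + ((\<integral>y. fz c N x w y - fz c N x z y \<partial>R) - (\<integral>y. fz c N x w y - fz c N x z y \<partial>Q))\<bar> \<le> S"
    and Sd: "S < d"
  shows "\<bar>transport_cost c (discrete_law N x q) R - g_c c N x q R z\<bar> \<le> S"
proof -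
  interpret R: prob_space R by fact
  have fz_int_R: "integrable R (fz c N x w)" for w by (rule R.fz_integrable[of N c x, OF N c_nonneg c_int_R])
  let ?g = "g_c c N x p Q" and ?h = "g_c c N x q R" and ?T = "transport_cost c (discrete_law N x q) R"
  define E where "E w = (\<Sum>i<N. (w i - z i) * (q i - p i)) + ((\<integral>y. fz c N x w y - fz c N x z y \<partial>R) - (\<integral>y. fz c N x w y - fz c N x z y \<partial>Q))" for w
  have hE: "?h w - ?h z = (?g w - ?g z) + E w" for w
    using fz_int fz_int_R by (simp add: E_def g_c_def sum_subtractf left_diff_distrib right_diff_distrib)
  have E: "\<bar>E w\<bar> \<le> S" if "w 0 = z 0" "\<forall>i<N. \<bar>w i - z i\<bar> \<le> e" for w
    unfolding E_def using S that by blast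
  have h_le: "?h w \<le> ?h z + S" if w0: "w 0 = z 0" for w
  proof (cases "\<forall>i<N. \<bar>w i - z i\<bar> \<le> e")
    case True
    then show ?thesis using hE[of w] E[of w, OF w0] z_max[of w] by simp
  next
    case False
    define D where "D = Max ((\<lambda>i. \<bar>w i - z i\<bar>) ` {..<N})"
    have D_ge: "\<bar>w i - z i\<bar> \<le> D" if "i < N" for i unfolding D_def by (rule Max_ge) (use that in auto)
    have "D \<in> (\<lambda>i. \<bar>w i - z i\<bar>) ` {..<N}" unfolding D_def
      by (rule Max_in, simp, subst image_is_empty) (use N in \<open>simp add: lessThan_empty_iff\<close>)
    then obtain k where k: "k < N" "\<bar>w k - z k\<bar> = D" by auto
    have D: "D > e" using False D_ge by (meson not_le order.strict_trans2)
    \<comment> \<open>The segment from \<open>z\<close> to \<open>w\<close> leaves the cube at the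
      fraction \<open>s\<close>, at the point \<open>u\<close>.\<close>
    define s where "s = e / D"
    have s: "0 < s" "s \<le> 1" "s * D = e" using D e by (auto simp: s_def)
    define u where "u i = (1 - s) * z i + s * w i" for i
    have u_diff: "\<bar>u i - z i\<bar> = s * \<bar>w i - z i\<bar>" for i
    proof -
      have "u i - z i = s * (w i - z i)" by (simp add: u_def algebra_simps)
      then show ?thesis using s by (simp add: abs_mult)
    qed
    have u: "u 0 = z 0" "\<forall>i<N. \<bar>u i - z i\<bar> \<le> e" "\<exists>i<N. \<bar>u i - z i\<bar> = e"
      using w0 D_ge s k by (auto simp: u_diff simp flip: s(3)) (simp add: u_def algebra_simps)
    then have "?g u \<le> ?g z - d" using gap by blast
    then have "?h u < ?h z" using hE[of u] E[of u, OF u(1,2)] Sd by simp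
    moreover have "(1 - s) * ?h z + s * ?h w \<le> ?h u"
      unfolding u_def using s by (intro g_c_concave[OF N R(1) q_sum fz_int_R]) auto
    ultimately have "s * ?h w < s * ?h z" by (simp add: algebra_simps)
    then have "?h w < ?h z" using s by simp
    moreover have "0 \<le> S" using E[of z] e by simp
    ultimately show ?thesis by simp
  qed
  have h_le': "?h w \<le> ?h z + S" for w
    using h_le[of "\<lambda>i. w i + (z 0 - w 0)"] by (simp add: g_c_shift[OF N R(1) q_sum fz_int_R])
  have lower: "?h z \<le> ?T"
    by (rule g_c_le_transport_cost[OF R N q_pos q_sum c_nonneg c_meas c_int_R])
  have upper: "?T \<le> ?h z + S"
  proof (rule field_le_epsilon)
    fix a :: real assume a: "0 < a"
    obtain w where "?T \<le> ?h w + a"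
      by (rule transport_cost_le_g_c[where x = x and c = c and q = q, OF R N q_pos q_sum c_nonneg c_meas c_int_R a])
    then show "?T \<le> ?h z + S + a" using h_le'[of w] by simp
  qed
  show ?thesis using lower upper by simp
qed

end

section \<open>Characteristic functions\<close>

lemma cmod_iexp_diff_le: "cmod (iexp a - iexp b) \<le> \<bar>a - b\<bar>"
proof -
  have "iexp a - iexp b = iexp b * (iexp (a - b) - 1)"
    by (simp add: right_diff_distrib exp_add[symmetric] algebra_simps)
  then have "cmod (iexp a - iexp b) = cmod (iexp (a - b) - 1)" by (simp add: norm_mult)
  also have "\<dots> \<le> \<bar>a - b\<bar>" using iexp_approx1[of "a - b" 0] by simp
  finally show ?thesis .
qed

lemma char_distr:
  assumes "U \<in> borel_measurable M"
  shows "char (distr M borel U) t = (CLINT \<omega>|M. iexp (t * U \<omega>))"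
  unfolding char_def using assms by (subst integral_distr) auto

lemma char_distr_scale:
  assumes "U \<in> borel_measurable M"
  shows "char (distr M borel (\<lambda>\<omega>. a * U \<omega>)) t = char (distr M borel U) (a * t)"
  using assms by (subst (1 2) char_distr) (auto simp: mult_ac)

lemma (in prob_space) char_distr_diff_le:
  assumes [measurable]: "U \<in> borel_measurable M" "V \<in> borel_measurable M" and e: "e > 0"
  shows "cmod (char (distr M borel U) t - char (distr M borel V) t)
    \<le> \<bar>t\<bar> * e + 2 * prob {\<omega> \<in> space M. \<bar>V \<omega> - U \<omega>\<bar> > e}"
proof -
  define B where "B = {\<omega> \<in> space M. \<bar>V \<omega> - U \<omega>\<bar> > e}"
  have B [measurable]: "B \<in> events" unfolding B_def by measurable
  have "char (distr M borel U) t - char (distr M borel V) t = (CLINT \<omega>|M. iexp (t * U \<omega>) - iexp (t * V \<omega>))"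
    by (simp add: char_distr integrable_iexp)
  also have "cmod \<dots> \<le> (\<integral>\<omega>. cmod (iexp (t * U \<omega>) - iexp (t * V \<omega>)) \<partial>M)" by (rule integral_norm_bound)
  also have "\<dots> \<le> (\<integral>\<omega>. \<bar>t\<bar> * e + 2 * indicator B \<omega> \<partial>M)"
  proof (rule integral_mono)
    fix \<omega> assume \<omega>: "\<omega> \<in> space M"
    show "cmod (iexp (t * U \<omega>) - iexp (t * V \<omega>)) \<le> \<bar>t\<bar> * e + 2 * indicator B \<omega>"
    proof (cases "\<omega> \<in> B")
      case True
      have "cmod (iexp (t * U \<omega>) - iexp (t * V \<omega>)) \<le> 2"
        by (rule order.trans[OF norm_triangle_ineq4]) simp
      then show ?thesis using True e by (simp add: add_increasing)
    next
      case False
      have "cmod (iexp (t * U \<omega>) - iexp (t * V \<omega>)) \<le> \<bar>t * U \<omega> - t * V \<omega>\<bar>" by (rule cmod_iexp_diff_le)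
      also have "\<dots> = \<bar>t\<bar> * \<bar>V \<omega> - U \<omega>\<bar>" by (simp add: abs_mult[symmetric] algebra_simps abs_minus_commute)
      also have "\<dots> \<le> \<bar>t\<bar> * e" using False \<omega> by (intro mult_left_mono) (auto simp: B_def)
      finally show ?thesis using False by simp
    qed
  qed (auto intro!: integrable_iexp integrable_norm Bochner_Integration.integrable_diff simp: emeasure_eq_measure)
  also have "\<dots> = \<bar>t\<bar> * e + 2 * prob B" by (simp add: prob_space emeasure_eq_measure)
  finally show ?thesis by (simp add: B_def)
qed

text \<open>Slutsky's theorem: a perturbation tending to 0 in probability does not change the limit
  law. Asking only for the characteristic functions of \<open>U\<close> lets the two-sample case
  enter as a product.\<close>

lemma (in prob_space) weak_conv_m_of_char_approx:
  assumes U: "\<And>n. U n \<in> borel_measurable M" and V: "\<And>n. V n \<in> borel_measurable M"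
    and \<mu>: "real_distribution \<mu>"
    and conv: "\<And>t. (\<lambda>n. char (distr M borel (U n)) t) \<longlonglongrightarrow> char \<mu> t"
    and approx: "\<And>e. e > 0 \<Longrightarrow> (\<lambda>n. prob {\<omega> \<in> space M. \<bar>V n \<omega> - U n \<omega>\<bar> > e}) \<longlonglongrightarrow> 0"
  shows "weak_conv_m (\<lambda>n. distr M borel (V n)) \<mu>"
proof (rule levy_continuity[OF _ \<mu>])
  show "real_distribution (distr M borel (V n))" for n using V by simp
  fix t
  have "(\<lambda>n. char (distr M borel (V n)) t - char (distr M borel (U n)) t) \<longlonglongrightarrow> 0"
  proof (rule LIMSEQ_I)
    fix r :: real assume r: "0 < r"
    define e where "e = r / (2 * (\<bar>t\<bar> + 1))"
    have e: "e > 0" using r by (simp add: e_def add_nonneg_pos)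
    have te: "\<bar>t\<bar> * e \<le> r / 2"
      using r by (simp add: e_def field_simps)
    have "eventually (\<lambda>n. prob {\<omega> \<in> space M. \<bar>V n \<omega> - U n \<omega>\<bar> > e} < r / 4) sequentially"
      by (rule order_tendstoD[OF approx[OF e]]) (use r in auto)
    then obtain n0 where n0: "\<And>n. n \<ge> n0 \<Longrightarrow> prob {\<omega> \<in> space M. \<bar>V n \<omega> - U n \<omega>\<bar> > e} < r / 4"
      by (auto simp: eventually_sequentially)
    have "norm (char (distr M borel (V n)) t - char (distr M borel (U n)) t - 0) < r" if "n \<ge> n0" for n
      using char_distr_diff_le[OF U[of n] V[of n] e, of t] n0[OF that] te
      by (simp add: norm_minus_commute)
    then show "\<exists>n0. \<forall>n\<ge>n0. norm (char (distr M borel (V n)) t - char (distr M borel (U n)) t - 0) < r" by blast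
  qed
  from tendsto_add[OF this conv[of t]] show "(\<lambda>n. char (distr M borel (V n)) t) \<longlonglongrightarrow> char \<mu> t" by simp
qed

text \<open>Serves the two-sample case, where the argument carries a factor that varies with the
  sample sizes and merely converges. Skorohod's representation makes the variables converge
  pointwise, and dominated convergence then absorbs the moving argument.\<close>

lemma char_tendsto_moving:
  assumes \<mu>: "\<And>n. real_distribution (\<mu> n)" "real_distribution \<nu>" and conv: "weak_conv_m \<mu> \<nu>"
    and s: "s \<longlonglongrightarrow> t"
  shows "(\<lambda>n. char (\<mu> n) (s n)) \<longlonglongrightarrow> char \<nu> t"
proof -
  obtain \<Omega> :: "real measure" and Y Y' where "prob_space \<Omega>" and Y: "\<And>n. Y n \<in> \<Omega> \<rightarrow>\<^sub>M borel" "\<And>n. distr \<Omega> borel (Y n) = \<mu> n"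
    and Y': "Y' \<in> \<Omega> \<rightarrow>\<^sub>M lborel" "distr \<Omega> borel Y' = \<nu>" and lim: "\<And>x. x \<in> space \<Omega> \<Longrightarrow> (\<lambda>n. Y n x) \<longlonglongrightarrow> Y' x"
    using Skorohod[OF \<mu> conv] by blast
  interpret prob_space \<Omega> by fact
  have Y'_meas: "Y' \<in> \<Omega> \<rightarrow>\<^sub>M borel" using Y'(1) by simp
  have "(\<lambda>n. CLINT x|\<Omega>. iexp (s n * Y n x)) \<longlonglongrightarrow> (CLINT x|\<Omega>. iexp (t * Y' x))"
    by (rule integral_dominated_convergence[where w = "\<lambda>_. 1"])
       (use Y(1) Y'_meas in \<open>auto intro!: tendsto_intros s lim\<close>)
  then show ?thesis
    using char_distr[OF Y(1)] char_distr[OF Y'_meas] Y(2) Y'(2) by simp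
qed

text \<open>Scaling covers the point mass at \<open>v = 0\<close> and the densities alike, so that
  the characteristic function has a single form.\<close>

lemma normal_law_eq_distr:
  assumes "v \<ge> 0"
  shows "normal_law v = distr std_normal_distribution borel (\<lambda>u. sqrt v * u)"
proof (cases "v = 0")
  case True
  interpret real_distribution std_normal_distribution by (rule real_dist_normal_dist)
  show ?thesis using True by (simp add: normal_law_def distr_const)
next
  case False
  interpret real_distribution std_normal_distribution by (rule real_dist_normal_dist)
  have "distr std_normal_distribution lborel (\<lambda>u. u) = std_normal_distribution"
    by (rule distr_id2) simp
  then have "distributed std_normal_distribution lborel (\<lambda>u. u) (normal_density 0 1)"
    unfolding distributed_def by auto
  from normal_density_affine[OF this, of "sqrt v" 0] False assms
  have "distributed std_normal_distribution lborel (\<lambda>u. sqrt v * u) (normal_density 0 (sqrt v))" by simp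
  then have "distr std_normal_distribution lborel (\<lambda>u. sqrt v * u) = density lborel (normal_density 0 (sqrt v))"
    by (simp add: distributed_def)
  moreover have "distr std_normal_distribution lborel (\<lambda>u. sqrt v * u) = distr std_normal_distribution borel (\<lambda>u. sqrt v * u)"
    by (rule distr_cong) auto
  ultimately show ?thesis using False by (simp add: normal_law_def)
qed

lemma real_distribution_normal_law: "v \<ge> 0 \<Longrightarrow> real_distribution (normal_law v)"
  using prob_space.real_distribution_distr[OF real_distribution.axioms(1)[OF real_dist_normal_dist], of "\<lambda>u. sqrt v * u"]
  by (simp add: normal_law_eq_distr)

lemma char_normal_law: "v \<ge> 0 \<Longrightarrow> char (normal_law v) t = char std_normal_distribution (sqrt v * t)"
proof -
  assume "v \<ge> 0"
  moreover have "distr std_normal_distribution borel (\<lambda>u. u) = std_normal_distribution"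
    by (rule distr_id2) simp
  ultimately show ?thesis using char_distr_scale[of "\<lambda>u. u" std_normal_distribution "sqrt v" t]
    by (simp add: normal_law_eq_distr)
qed

lemma char_normal_law_product:
  assumes v: "v \<ge> 0" "w \<ge> 0"
  shows "real_distribution (distr (normal_law v \<Otimes>\<^sub>M normal_law w) borel (\<lambda>(r, s). a * r + b * s))" (is ?dist)
    and "char (distr (normal_law v \<Otimes>\<^sub>M normal_law w) borel (\<lambda>(r, s). a * r + b * s)) t
      = char (normal_law v) (a * t) * char (normal_law w) (b * t)"
proof -
  interpret V: real_distribution "normal_law v" by (rule real_distribution_normal_law[OF v(1)])
  interpret W: real_distribution "normal_law w" by (rule real_distribution_normal_law[OF v(2)])
  interpret P: pair_prob_space "normal_law v" "normal_law w" ..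
  have m [measurable]: "(\<lambda>(r, s). a * r + b * s) \<in> borel_measurable (normal_law v \<Otimes>\<^sub>M normal_law w)" by measurable
  show ?dist using m by (rule P.real_distribution_distr)
  have "char (distr (normal_law v \<Otimes>\<^sub>M normal_law w) borel (\<lambda>(r, s). a * r + b * s)) t
      = (CLINT u|normal_law v \<Otimes>\<^sub>M normal_law w. iexp (t * (case u of (r, s) \<Rightarrow> a * r + b * s)))"
    by (rule char_distr[OF m])
  also have "\<dots> = (CLINT r|normal_law v. CLINT s|normal_law w. iexp (t * (a * r + b * s)))"
    by (subst P.integral_fst'[symmetric]) (auto intro!: P.integrable_iexp)
  also have "\<dots> = (CLINT r|normal_law v. iexp (a * t * r) * (CLINT s|normal_law w. iexp (b * t * s)))"
    by (subst integral_mult_right_zero[symmetric]) (auto intro!: Bochner_Integration.integral_cong simp: exp_add[symmetric] algebra_simps)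
  also have "\<dots> = char (normal_law v) (a * t) * char (normal_law w) (b * t)"
    by (simp add: char_def)
  finally show "char (distr (normal_law v \<Otimes>\<^sub>M normal_law w) borel (\<lambda>(r, s). a * r + b * s)) t
      = char (normal_law v) (a * t) * char (normal_law w) (b * t)" .
qed

text \<open>Degenerate variance is included: for \<open>v = 0\<close> the centred summands vanish
  almost surely and the limit is the point mass at 0. This does occur, for instance for
  \<open>sigma2_P\<close> with \<open>N = 1\<close>.\<close>

lemma (in prob_space) clt_normal_law:
  fixes X :: "nat \<Rightarrow> 'a \<Rightarrow> real"
  assumes indep: "indep_vars (\<lambda>_. borel) X UNIV"
    and mean: "\<And>n. expectation (X n) = m"
    and sq: "\<And>n. integrable M (\<lambda>\<omega>. (X n \<omega>)\<^sup>2)"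
    and var: "\<And>n. variance (X n) = v"
    and dist: "\<And>n. distr M borel (X n) = \<mu>"
  shows "v \<ge> 0" "weak_conv_m (\<lambda>n. distr M borel (\<lambda>\<omega>. (\<Sum>i<n. X i \<omega> - m) / sqrt n)) (normal_law v)"
proof -
  have X_meas [measurable]: "X n \<in> borel_measurable M" for n
    using indep unfolding indep_vars_def by auto
  show v: "v \<ge> 0" using variance_positive[of "X 0"] var[of 0] by simp
  have meas [measurable]: "(\<lambda>\<omega>. \<Sum>i<n. X i \<omega> - m) \<in> borel_measurable M" for n by measurable
  show "weak_conv_m (\<lambda>n. distr M borel (\<lambda>\<omega>. (\<Sum>i<n. X i \<omega> - m) / sqrt n)) (normal_law v)"
  proof (rule levy_continuity[OF _ real_distribution_normal_law[OF v]])
    show "real_distribution (distr M borel (\<lambda>\<omega>. (\<Sum>i<n. X i \<omega> - m) / sqrt n))" for n by simp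
    fix t
    show "(\<lambda>n. char (distr M borel (\<lambda>\<omega>. (\<Sum>i<n. X i \<omega> - m) / sqrt n)) t) \<longlonglongrightarrow> char (normal_law v) t"
    proof (cases "v = 0")
      case False
      define s where "s = sqrt v"
      have s: "s > 0" "s\<^sup>2 = v" using v False by (auto simp: s_def)
      have "weak_conv_m (\<lambda>n. distr M borel (\<lambda>\<omega>. (\<Sum>i<n. X i \<omega> - m) / sqrt (n * s\<^sup>2))) std_normal_distribution"
        by (rule central_limit_theorem[OF indep mean s(1) sq _ dist]) (simp add: var s)
      then have "(\<lambda>n. char (distr M borel (\<lambda>\<omega>. (\<Sum>i<n. X i \<omega> - m) / sqrt (n * s\<^sup>2))) (s * t)) \<longlonglongrightarrow> char std_normal_distribution (s * t)"
        by (intro levy_continuity1 real_dist_normal_dist) auto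
      moreover have "char (distr M borel (\<lambda>\<omega>. (\<Sum>i<n. X i \<omega> - m) / sqrt (n * s\<^sup>2))) (s * t)
          = char (distr M borel (\<lambda>\<omega>. (\<Sum>i<n. X i \<omega> - m) / sqrt n)) t" for n
      proof -
        have "(\<lambda>\<omega>. (\<Sum>i<n. X i \<omega> - m) / sqrt n) = (\<lambda>\<omega>. s * ((\<Sum>i<n. X i \<omega> - m) / sqrt (n * s\<^sup>2)))"
          using s by (auto simp: real_sqrt_mult)
        then show ?thesis by (simp only:) (subst char_distr_scale, auto)
      qed
      ultimately show ?thesis using v by (simp add: char_normal_law s_def)
    next
      case True
      have X_int: "integrable M (X i)" for i using square_integrable_imp_integrable[OF X_meas sq] .
      have "AE \<omega> in M. X i \<omega> - m = 0" for i
      proof -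
        have "(\<integral>\<omega>. (X i \<omega> - m)\<^sup>2 \<partial>M) = 0" using var[of i] mean[of i] True by simp
        moreover have "integrable M (\<lambda>\<omega>. (X i \<omega> - m)\<^sup>2)"
          using sq[of i] X_int[of i] by (simp add: power2_diff)
        ultimately have "AE \<omega> in M. (X i \<omega> - m)\<^sup>2 = 0"
          by (subst (asm) integral_nonneg_eq_0_iff_AE) auto
        then show ?thesis by simp
      qed
      then have "AE \<omega> in M. \<forall>i. X i \<omega> - m = 0" by (simp add: AE_all_countable)
      then have "char (distr M borel (\<lambda>\<omega>. (\<Sum>i<n. X i \<omega> - m) / sqrt n)) t = (CLINT \<omega>|M. 1)" for n
        by (subst char_distr, simp) (rule integral_cong_AE, auto)
      then have "char (distr M borel (\<lambda>\<omega>. (\<Sum>i<n. X i \<omega> - m) / sqrt n)) t = 1" for n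
        by (simp add: prob_space)
      moreover have "char (normal_law v) t = 1"
        using True real_distribution.char_zero[OF real_dist_normal_dist] by (simp add: char_normal_law)
      ultimately show ?thesis by simp
    qed
  qed
qed

section \<open>A chaining bound for finite-dimensional Lipschitz classes\<close>

text \<open>The threshold is measured in units of \<open>sqrt m\<close> times the range
  \<open>w\<close>, so the tail depends on \<open>s\<close> alone and the same bound serves every
  mesh of a chain.\<close>

lemma (in prob_space) hoeffding_iid:
  fixes Y :: "nat \<Rightarrow> 'a \<Rightarrow> 'b::topological_space"
  assumes indep: "indep_vars (\<lambda>_. borel) Y {..<m}" and dist: "\<And>k. k < m \<Longrightarrow> distr M borel (Y k) = Q"
    and f: "f \<in> borel_measurable borel" and f_range: "\<And>y. f y \<in> {a..a + w}" and w: "w > 0" and m: "m \<ge> 1" and s: "s \<ge> 0"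
  shows "prob {\<omega> \<in> space M. \<bar>(\<Sum>k<m. f (Y k \<omega>)) - m * (\<integral>y. f y \<partial>Q)\<bar> \<ge> sqrt m * w * s} \<le> 2 * exp (- 2 * s\<^sup>2)"
proof -
  have Y_meas: "Y k \<in> M \<rightarrow>\<^sub>M borel" if "k < m" for k using indep that unfolding indep_vars_def by auto
  have mean: "expectation (\<lambda>\<omega>. f (Y k \<omega>)) = (\<integral>y. f y \<partial>Q)" if "k < m" for k
    using integral_distr[OF Y_meas[OF that] f] dist[OF that] by simp
  interpret H: Hoeffding_ineq M "{..<m}" "\<lambda>k \<omega>. f (Y k \<omega>)" "\<lambda>_. a" "\<lambda>_. a + w" "\<Sum>k<m. expectation (\<lambda>\<omega>. f (Y k \<omega>))"
  proof unfold_locales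
    show "indep_vars (\<lambda>_. borel) (\<lambda>k \<omega>. f (Y k \<omega>)) {..<m}"
      by (rule indep_vars_compose2[OF indep]) (use f in auto)
  qed (use f_range in auto)
  have \<mu>: "(\<Sum>k<m. expectation (\<lambda>\<omega>. f (Y k \<omega>))) = m * (\<integral>y. f y \<partial>Q)" using mean by simp
  have "prob {\<omega> \<in> space M. \<bar>(\<Sum>k<m. f (Y k \<omega>)) - m * (\<integral>y. f y \<partial>Q)\<bar> \<ge> sqrt m * w * s}
     \<le> 2 * exp (- 2 * (sqrt m * w * s)\<^sup>2 / (\<Sum>k<m. (a + w - a)\<^sup>2))"
    using H.Hoeffding_ineq_abs_ge[of "sqrt m * w * s"] w s m unfolding \<mu> by simp
  also have "- 2 * (sqrt m * w * s)\<^sup>2 / (\<Sum>k<m. (a + w - a)\<^sup>2) = - 2 * s\<^sup>2"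
    using w m by (simp add: power_mult_distrib)
  finally show ?thesis .
qed

lemma sum_halves_le: "(\<Sum>k=1..K. real k / 2 ^ k) \<le> 2"
proof -
  have "(\<Sum>k=1..K. real k / 2 ^ k) = 2 - (real K + 2) / 2 ^ K"
    by (induction K) (auto simp: field_simps)
  then show ?thesis by simp
qed

lemma sum_powers_le:
  fixes r :: real
  assumes "0 \<le> r" "r \<le> 1 / 2"
  shows "(\<Sum>k=1..K. r ^ k) \<le> 2 * r"
proof -
  have eq: "(1 - r) * (\<Sum>k=1..K. r ^ k) = r - r ^ Suc K"
  proof (induction K)
    case (Suc K)
    have "(1 - r) * (\<Sum>k=1..Suc K. r ^ k) = (1 - r) * (\<Sum>k=1..K. r ^ k) + (1 - r) * r ^ Suc K"
      by (simp add: distrib_left)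
    also have "\<dots> = r - r ^ Suc K + (1 - r) * r ^ Suc K" by (simp only: Suc)
    also have "\<dots> = r - r ^ Suc (Suc K)" by (simp add: algebra_simps)
    finally show ?case .
  qed simp
  have "1 / 2 * (\<Sum>k=1..K. r ^ k) \<le> (1 - r) * (\<Sum>k=1..K. r ^ k)"
    using assms by (intro mult_right_mono sum_nonneg) auto
  also have "\<dots> \<le> r" unfolding eq using assms by simp
  finally show ?thesis by simp
qed

text \<open>Dyadic chaining. The increments between consecutive dyadic grids are bounded by the mesh, so
  Hoeffding's inequality beats the number of grid points at every level. After \<open>m\<close> levels the
  remaining discretisation error is negligible because \<open>m \<le> 2 ^ m\<close>.\<close>

lemma (in prob_space) chaining_bound:
  fixes Y :: "nat \<Rightarrow> 'a \<Rightarrow> 'b::topological_space" and F :: "(nat \<Rightarrow> real) \<Rightarrow> 'b \<Rightarrow> real"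
  assumes indep: "indep_vars (\<lambda>_. borel) Y {..<m}" and dist: "\<And>k. k < m \<Longrightarrow> distr M borel (Y k) = Q"
    and m: "m \<ge> 1"
    and F_meas: "\<And>w. F w \<in> borel_measurable borel" and F_int: "\<And>w. integrable Q (F w)"
    and F_lip: "\<And>w w' d y. (\<And>i. i < N \<Longrightarrow> \<bar>w i - w' i\<bar> \<le> d) \<Longrightarrow> \<bar>F w y - F w' y\<bar> \<le> d"
    and e: "e > 0" and L: "L \<ge> 0" and r: "2 ^ N * exp (- L\<^sup>2 / 2) \<le> 1 / 2"
  obtains A where "A \<in> events" "prob A \<le> 4 * (2 ^ N * exp (- L\<^sup>2 / 2))"
    "\<forall>\<omega>\<in>space M - A. \<forall>w. (\<forall>i<N. \<bar>w i - z i\<bar> \<le> e) \<longrightarrow>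
       \<bar>(\<Sum>k<m. F w (Y k \<omega>) - F z (Y k \<omega>)) - m * (\<integral>y. F w y - F z y \<partial>Q)\<bar> \<le> sqrt m * e * (16 * L + 16)"
proof -
  have Y_meas: "Y k \<in> M \<rightarrow>\<^sub>M borel" if "k < m" for k using indep that unfolding indep_vars_def by auto
  have "Q = distr M borel (Y 0)" using dist[of 0] m by simp
  then interpret Q: prob_space Q using prob_space_distr[OF Y_meas[of 0]] m by simp
  define G where "G w \<omega> = (\<Sum>k<m. F w (Y k \<omega>)) - m * (\<integral>y. F w y \<partial>Q)" for w \<omega>
  have G_meas: "G w \<in> borel_measurable M" for w
    unfolding G_def using measurable_compose[OF Y_meas F_meas[of w]] by measurable
  have G_lip: "\<bar>G w \<omega> - G w' \<omega>\<bar> \<le> 2 * real m * d" if d: "\<And>i. i < N \<Longrightarrow> \<bar>w i - w' i\<bar> \<le> d" for w w' \<omega> and d :: real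
  proof -
    have "\<bar>\<Sum>k<m. F w (Y k \<omega>) - F w' (Y k \<omega>)\<bar> \<le> (\<Sum>k<m. d)"
      by (intro order.trans[OF sum_abs] sum_mono F_lip d)
    moreover have "\<bar>\<integral>y. F w y - F w' y \<partial>Q\<bar> \<le> d"
      by (intro order.trans[OF integral_abs_bound] Q.integral_le_const AE_I2 F_lip d) (use F_int in auto)
    then have "\<bar>m * (\<integral>y. F w y - F w' y \<partial>Q)\<bar> \<le> m * d" by (simp add: abs_mult mult_left_mono)
    moreover have "G w \<omega> - G w' \<omega> = (\<Sum>k<m. F w (Y k \<omega>) - F w' (Y k \<omega>)) - m * (\<integral>y. F w y - F w' y \<partial>Q)"
      using F_int by (simp add: G_def sum_subtractf right_diff_distrib)
    ultimately show ?thesis by simp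
  qed
  have G_cong: "G w \<omega> = G w' \<omega>" if "\<And>i. i < N \<Longrightarrow> w i = w' i" for w w' \<omega>
    using G_lip[of w w' 0 \<omega>] that by simp
  \<comment> \<open>The offsets \<open>w i - z i + e\<close> fill the interval from 0 to
    \<open>2 * e\<close>. With mesh \<open>4 * e / 2 ^ k\<close> they use only the lower half of the
    index range, so the right end point needs no special case and level 0 is the single point
    \<open>z i - e\<close>.\<close>
  define hh where "hh k = 4 * e / 2 ^ k" for k :: nat
  have hh: "hh k > 0" "hh k = 2 * hh (Suc k)" for k using e by (auto simp: hh_def)
  define pt where "pt k j i = z i - e + hh k * real (j i)" for k and j :: "nat \<Rightarrow> nat" and i
  define par where "par j i = j i div 2" for j :: "nat \<Rightarrow> nat" and i :: nat
  define J where "J k = PiE {..<N} (\<lambda>_. {..<2 ^ k :: nat})" for k :: nat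
  have J: "finite (J k)" "card (J k) = (2 ^ k) ^ N" for k
    by (auto simp: J_def card_PiE intro: finite_PiE)
  \<comment> \<open>A threshold growing linearly in \<open>k\<close> makes the tail fall at least
    geometrically. Together with the number of grid points this gives a geometric series of ratio
    \<open>2 ^ N * exp (- L\<^sup>2 / 2)\<close>, while the thresholds, weighted by the mesh, remain
    summable.\<close>
  define B where "B k j = {\<omega> \<in> space M. \<bar>G (pt k j) \<omega> - G (pt (k - 1) (par j)) \<omega>\<bar> \<ge> sqrt m * hh k * (L * k)}" for k j
  have B_meas: "B k j \<in> events" for k j unfolding B_def using G_meas by measurable
  have B_prob: "prob (B k j) \<le> 2 * exp (- L\<^sup>2 / 2) ^ k" if k: "k \<ge> 1" for k j
  proof -
    obtain l where l: "k = Suc l" using k by (cases k) auto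
    define f where "f y = F (pt k j) y - F (pt (k - 1) (par j)) y" for y
    have "\<bar>pt k j i - pt (k - 1) (par j) i\<bar> \<le> hh k" for i
    proof -
      have "pt k j i - pt (k - 1) (par j) i = hh k * (real (j i) - 2 * real (j i div 2))"
        using hh(2)[of l] by (simp add: pt_def par_def l algebra_simps)
      also have "real (j i) - 2 * real (j i div 2) = real (j i mod 2)"
      proof -
        have "j i = 2 * (j i div 2) + j i mod 2" by simp
        then have "real (j i) = 2 * real (j i div 2) + real (j i mod 2)" by (metis of_nat_add of_nat_mult of_nat_numeral)
        then show ?thesis by simp
      qed
      finally have eq: "pt k j i - pt (k - 1) (par j) i = hh k * real (j i mod 2)" .
      have "j i mod 2 \<le> 1" by (simp add: less_Suc_eq_le[symmetric])
      then have "real (j i mod 2) \<le> 1" by simp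
      then show ?thesis unfolding eq using hh(1)[of k] by (simp add: abs_mult mult_left_le)
    qed
    then have f_abs: "\<bar>f y\<bar> \<le> hh k" for y unfolding f_def by (rule F_lip)
    have f_range: "f y \<in> {- hh k..- hh k + 2 * hh k}" for y using f_abs[of y] by (auto simp: abs_le_iff)
    have f_meas: "f \<in> borel_measurable borel" unfolding f_def using F_meas by measurable
    have "prob {\<omega> \<in> space M. \<bar>(\<Sum>k<m. f (Y k \<omega>)) - m * (\<integral>y. f y \<partial>Q)\<bar> \<ge> sqrt m * (2 * hh k) * (L * k / 2)} \<le> 2 * exp (- 2 * (L * k / 2)\<^sup>2)"
      using hh(1)[of k] L m by (intro hoeffding_iid[OF indep dist f_meas f_range]) simp_all
    also have "{\<omega> \<in> space M. \<bar>(\<Sum>k<m. f (Y k \<omega>)) - m * (\<integral>y. f y \<partial>Q)\<bar> \<ge> sqrt m * (2 * hh k) * (L * k / 2)} = B k j"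
    proof -
      have "(\<integral>y. f y \<partial>Q) = (\<integral>y. F (pt k j) y \<partial>Q) - (\<integral>y. F (pt (k - 1) (par j)) y \<partial>Q)"
        unfolding f_def using F_int by simp
      then have "(\<Sum>k<m. f (Y k \<omega>)) - m * (\<integral>y. f y \<partial>Q) = G (pt k j) \<omega> - G (pt (k - 1) (par j)) \<omega>" for \<omega>
        by (simp add: G_def f_def sum_subtractf right_diff_distrib)
      moreover have "sqrt m * (2 * hh k) * (L * k / 2) = sqrt m * hh k * (L * k)" by simp
      ultimately show ?thesis by (simp only: B_def)
    qed
    also have "exp (- 2 * (L * k / 2)\<^sup>2) \<le> exp (real k * (- L\<^sup>2 / 2))"
    proof -
      have "L\<^sup>2 * (real k * 1) \<le> L\<^sup>2 * (real k * real k)" using k by (intro mult_left_mono) auto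
      then show ?thesis by (simp add: power2_eq_square algebra_simps)
    qed
    also have "exp (real k * (- L\<^sup>2 / 2)) = exp (- L\<^sup>2 / 2) ^ k" by (rule exp_of_nat_mult)
    finally show ?thesis by simp
  qed
  define A where "A = (\<Union>k\<in>{1..m}. \<Union>j\<in>J k. B k j)"
  have U_meas: "(\<Union>j\<in>J k. B k j) \<in> events" for k by (intro sets.finite_UN J B_meas)
  have A_meas: "A \<in> events" unfolding A_def by (rule sets.finite_UN) (use U_meas in auto)
  have "prob A \<le> (\<Sum>k=1..m. prob (\<Union>j\<in>J k. B k j))"
    unfolding A_def using U_meas by (intro finite_measure_subadditive_finite) auto
  also have "\<dots> \<le> (\<Sum>k=1..m. \<Sum>j\<in>J k. prob (B k j))"
    using B_meas J(1) by (intro sum_mono finite_measure_subadditive_finite) auto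
  also have "\<dots> \<le> (\<Sum>k=1..m. \<Sum>j\<in>J k. 2 * exp (- L\<^sup>2 / 2) ^ k)"
    by (intro sum_mono B_prob) auto
  also have "\<dots> = 2 * (\<Sum>k=1..m. (2 ^ N * exp (- L\<^sup>2 / 2)) ^ k)"
    by (simp add: J(2) sum_distrib_left power_mult_distrib power_mult[symmetric] mult_ac)
  also have "\<dots> \<le> 2 * (2 * (2 ^ N * exp (- L\<^sup>2 / 2)))"
    using r by (intro mult_left_mono sum_powers_le) auto
  finally have A_prob: "prob A \<le> 4 * (2 ^ N * exp (- L\<^sup>2 / 2))" by simp
  have good: "\<bar>G w \<omega> - G (\<lambda>i. z i - e) \<omega>\<bar> \<le> sqrt m * e * (8 * L + 8)"
    if \<omega>: "\<omega> \<in> space M - A" and w: "\<forall>i<N. \<bar>w i - z i\<bar> \<le> e" for \<omega> w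
  proof -
    define v where "v k i = (w i - z i + e) / hh k" for k i
    have v_bounds: "0 \<le> v k i" "v k i \<le> 2 ^ k / 2" if "i < N" for k i
    proof -
      have "0 \<le> w i - z i + e" "w i - z i + e \<le> 2 * e" using w that by (auto simp: abs_le_iff)
      then have "0 \<le> v k i" "v k i \<le> 2 * e / hh k"
        using hh(1)[of k] by (auto simp: v_def intro!: divide_right_mono)
      moreover have "2 * e / hh k = 2 ^ k / 2" using e by (simp add: hh_def)
      ultimately show "0 \<le> v k i" "v k i \<le> 2 ^ k / 2" by auto
    qed
    define j where "j k i = nat \<lfloor>v k i\<rfloor>" for k i
    have j_J: "restrict (j k) {..<N} \<in> J k" for k
      unfolding J_def
    proof (rule restrict_PiE_iff[THEN iffD2], intro ballI)
      fix i assume "i \<in> {..<N}"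
      then have "0 \<le> v k i" "v k i \<le> 2 ^ k / 2" using v_bounds[of i k] by auto
      moreover from this(2) have "v k i < 2 ^ k" using zero_less_power[of "2::real" k] by linarith
      ultimately have "0 \<le> v k i" "v k i < 2 ^ k" by auto
      then show "j k i \<in> {..<2 ^ k}" by (simp add: j_def nat_less_iff floor_less_iff)
    qed
    \<comment> \<open>The mesh halves from one level to the next, so the floor at level
      \<open>k\<close> is the floor at level \<open>Suc k\<close> divided by 2: the roundings of one
      \<open>w\<close> form a chain of parents.\<close>
    have j_par: "par (j (Suc k)) i = j k i" if "i < N" for k i
    proof -
      have "v k i = v (Suc k) i / real_of_int 2" using hh(2)[of k] by (simp add: v_def)
      then have "\<lfloor>v k i\<rfloor> = \<lfloor>v (Suc k) i\<rfloor> div 2" by (simp only: floor_divide_real_eq_div)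
      then show ?thesis using v_bounds(1)[OF that, of "Suc k"] by (simp add: par_def j_def nat_div_distrib)
    qed
    have step: "\<bar>G (pt (Suc k) (j (Suc k))) \<omega> - G (pt k (j k)) \<omega>\<bar> \<le> sqrt m * hh (Suc k) * (L * Suc k)" if k: "k < m" for k
    proof -
      define j' where "j' = restrict (j (Suc k)) {..<N}"
      have "\<omega> \<notin> B (Suc k) j'" using \<omega> k j_J[of "Suc k"] by (auto simp: A_def j'_def)
      then have "\<bar>G (pt (Suc k) j') \<omega> - G (pt k (par j')) \<omega>\<bar> \<le> sqrt m * hh (Suc k) * (L * Suc k)"
        using \<omega> by (auto simp: B_def)
      moreover have "G (pt (Suc k) j') \<omega> = G (pt (Suc k) (j (Suc k))) \<omega>"
        by (rule G_cong) (simp add: pt_def j'_def)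
      moreover have "G (pt k (par j')) \<omega> = G (pt k (j k)) \<omega>"
        by (rule G_cong) (use j_par in \<open>simp add: pt_def j'_def par_def\<close>)
      ultimately show ?thesis by simp
    qed
    have "\<bar>G (pt k (j k)) \<omega> - G (pt 0 (j 0)) \<omega>\<bar> \<le> (\<Sum>l=1..k. sqrt m * hh l * (L * l))" if "k \<le> m" for k
      using that
    proof (induction k)
      case (Suc k)
      then show ?case using step[of k] by simp
    qed simp
    from this[of m] have "\<bar>G (pt m (j m)) \<omega> - G (pt 0 (j 0)) \<omega>\<bar> \<le> (\<Sum>l=1..m. sqrt m * hh l * (L * l))" by simp
    also have "\<dots> = sqrt m * (4 * e * L) * (\<Sum>l=1..m. real l / 2 ^ l)"
      by (simp add: sum_distrib_left hh_def mult_ac)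
    also have "\<dots> \<le> sqrt m * (4 * e * L) * 2"
      using e L by (intro mult_left_mono sum_halves_le) auto
    finally have 1: "\<bar>G (pt m (j m)) \<omega> - G (pt 0 (j 0)) \<omega>\<bar> \<le> sqrt m * e * (8 * L)" by (simp add: mult_ac)
    have 2: "G (pt 0 (j 0)) \<omega> = G (\<lambda>i. z i - e) \<omega>"
    proof (rule G_cong)
      fix i assume i: "i < N"
      have "\<lfloor>v 0 i\<rfloor> = 0" using v_bounds[OF i, of 0] by (intro floor_unique) auto
      then show "pt 0 (j 0) i = z i - e" by (simp add: pt_def j_def)
    qed
    have "\<bar>w i - pt m (j m) i\<bar> \<le> hh m" if i: "i < N" for i
    proof -
      have "w i - pt m (j m) i = hh m * (v m i - real (j m i))"
        using hh(1)[of m] by (simp add: v_def pt_def right_diff_distrib)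
      moreover have "real (j m i) = of_int \<lfloor>v m i\<rfloor>" using v_bounds[OF i, of m] by (simp add: j_def)
      then have "0 \<le> v m i - real (j m i)" "v m i - real (j m i) \<le> 1" by linarith+
      ultimately show ?thesis using hh(1)[of m] by (simp add: abs_mult mult_left_le)
    qed
    then have "\<bar>G w \<omega> - G (pt m (j m)) \<omega>\<bar> \<le> 2 * real m * hh m" by (rule G_lip)
    also have "\<dots> = 8 * e * (m / 2 ^ m)" by (simp add: hh_def)
    also have "\<dots> \<le> 8 * e * sqrt m"
    proof (intro mult_left_mono)
      have "real m \<le> 2 ^ m" by (metis less_exp less_imp_le of_nat_le_iff of_nat_numeral of_nat_power)
      then have "m / 2 ^ m \<le> (1 :: real)" by simp
      also have "1 \<le> sqrt m" using m by simp
      finally show "m / 2 ^ m \<le> sqrt m" .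
    qed (use e in auto)
    finally have "\<bar>G w \<omega> - G (pt m (j m)) \<omega>\<bar> \<le> 8 * e * sqrt m" .
    then have "\<bar>G w \<omega> - G (\<lambda>i. z i - e) \<omega>\<bar> \<le> sqrt m * e * (8 * L) + 8 * e * sqrt m"
      using 1 2 by linarith
    then show ?thesis by (simp add: algebra_simps)
  qed
  show ?thesis
  proof (rule that[OF A_meas A_prob], intro ballI allI impI)
    fix \<omega> w assume \<omega>: "\<omega> \<in> space M - A" and w: "\<forall>i<N. \<bar>w i - z i\<bar> \<le> e"
    \<comment> \<open>Both \<open>w\<close> and \<open>z\<close> are compared with the base point of
      the grid, which doubles the constants. In \<open>good\<close>, \<open>8 * L\<close> is the
      mesh factor 4 times the bound of \<open>sum_halves_le\<close>, and the other 8 is the rounding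
      at the last level.\<close>
    have "(\<Sum>k<m. F w (Y k \<omega>) - F z (Y k \<omega>)) - m * (\<integral>y. F w y - F z y \<partial>Q) = G w \<omega> - G z \<omega>"
      using F_int by (simp add: G_def sum_subtractf right_diff_distrib)
    moreover have "\<bar>G z \<omega> - G (\<lambda>i. z i - e) \<omega>\<bar> \<le> sqrt m * e * (8 * L + 8)"
      using good[OF \<omega>, of z] e by simp
    ultimately show "\<bar>(\<Sum>k<m. F w (Y k \<omega>) - F z (Y k \<omega>)) - m * (\<integral>y. F w y - F z y \<partial>Q)\<bar> \<le> sqrt m * e * (16 * L + 16)"
      using good[OF \<omega> w] by (simp add: algebra_simps abs_le_iff)
  qed
qed

section \<open>Limit theorems\<close>

text \<open>Turns independence of the joint family over \<open>nat + nat\<close> into independence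
  of each sample over \<open>nat\<close>.\<close>

lemma (in prob_space) indep_vars_reindex:
  assumes indep: "indep_vars N X (f ` I)" and inj: "inj_on f I"
  shows "indep_vars (\<lambda>i. N (f i)) (\<lambda>i. X (f i)) I"
  unfolding indep_vars_def2
proof (intro conjI ballI indep_setsI)
  have sets: "indep_sets (\<lambda>i. {X i -` A \<inter> space M |A. A \<in> sets (N i)}) (f ` I)"
    and rv: "\<And>i. i \<in> f ` I \<Longrightarrow> random_variable (N i) (X i)"
    using indep unfolding indep_vars_def2 by auto
  show "random_variable (N (f i)) (X (f i))" if "i \<in> I" for i using rv that by auto
  show "{X (f i) -` A \<inter> space M |A. A \<in> sets (N (f i))} \<subseteq> events" if "i \<in> I" for i
    using rv that by (auto intro: measurable_sets)
  fix A J assume J: "J \<noteq> {}" "J \<subseteq> I" "finite J" "\<forall>j\<in>J. A j \<in> {X (f j) -` A \<inter> space M |A. A \<in> sets (N (f j))}"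
  define A' where "A' j = A (the_inv_into I f j)" for j
  have A': "A' (f j) = A j" if "j \<in> J" for j
    using that J(2) inj by (auto simp: A'_def the_inv_into_f_f)
  have "prob (\<Inter>j\<in>f ` J. A' j) = (\<Prod>j\<in>f ` J. prob (A' j))"
    by (rule indep_setsD[OF sets]) (use J A' in auto)
  moreover have "(\<Inter>j\<in>f ` J. A' j) = (\<Inter>j\<in>J. A j)" using A' by auto
  moreover have "(\<Prod>j\<in>f ` J. prob (A' j)) = (\<Prod>j\<in>J. prob (A j))"
    using A' inj_on_subset[OF inj J(2)] by (subst prod.reindex) auto
  ultimately show "prob (\<Inter>j\<in>J. A j) = (\<Prod>j\<in>J. prob (A j))" by simp
qed

lemma exists_gaussian_tail:
  fixes K d :: real
  assumes "K > 0" "d > 0"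
  obtains L where "L \<ge> 1" "K * exp (- L\<^sup>2 / 2) \<le> d"
proof -
  define L where "L = max 1 (2 * K / d)"
  have L: "L \<ge> 1" "2 * K / d \<le> L" by (auto simp: L_def)
  have "L \<le> L\<^sup>2" using L by (simp add: power2_eq_square)
  then have "L / 2 \<le> exp (L\<^sup>2 / 2)" using exp_ge_add_one_self[of "L\<^sup>2 / 2"] by linarith
  moreover have "K / d \<le> L / 2" using L by (simp add: mult.commute)
  ultimately have "K / d \<le> exp (L\<^sup>2 / 2)" by linarith
  then have "K * exp (- L\<^sup>2 / 2) \<le> d" using assms by (simp add: exp_minus field_simps)
  then show ?thesis using L that by blast
qed

lemma fz_measurable_joint:
  fixes c :: "'a::euclidean_space \<Rightarrow> 'a \<Rightarrow> real"
  assumes c: "(\<lambda>u. c (fst u) (snd u)) \<in> borel_measurable (borel :: ('a \<times> 'a) measure)"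
    and A: "\<And>k. k < n \<Longrightarrow> A k \<in> M \<rightarrow>\<^sub>M borel" and g: "g \<in> M \<rightarrow>\<^sub>M borel"
  shows "(\<lambda>\<omega>. fz c n (\<lambda>k. A k \<omega>) z (g \<omega>)) \<in> borel_measurable M"
proof -
  have "(\<lambda>\<omega>. c (A k \<omega>) (g \<omega>)) \<in> borel_measurable M" if "k < n" for k
  proof -
    have "(\<lambda>\<omega>. (A k \<omega>, g \<omega>)) \<in> M \<rightarrow>\<^sub>M (borel :: ('a \<times> 'a) measure)"
      using A[OF that] g by (rule borel_measurable_Pair)
    from measurable_compose[OF this c] show ?thesis by simp
  qed
  then show ?thesis unfolding fz_def by (intro borel_measurable_Min) auto
qed

context semidiscrete
begin

text \<open>Collects what \<open>transport_cost_linearisation\<close> asks of one realisation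
  \<open>(q, R)\<close>. The deviation is multiplied by the rate \<open>t\<close>, so that
  \<open>B\<close> is comparable across sample sizes.\<close>

definition controlled :: "real \<Rightarrow> real \<Rightarrow> real \<Rightarrow> (nat \<Rightarrow> real) \<Rightarrow> 'a measure \<Rightarrow> bool" where
  "controlled t e B q R \<longleftrightarrow> prob_space R \<and> sets R = sets borel \<and> (\<forall>i<N. integrable R (c (x i)))
     \<and> (\<forall>i<N. q i > 0) \<and> (\<Sum>i<N. q i) = 1
     \<and> (\<forall>w. w 0 = z 0 \<longrightarrow> (\<forall>i<N. \<bar>w i - z i\<bar> \<le> e) \<longrightarrow>
          t * \<bar>(\<Sum>i<N. (w i - z i) * (q i - p i)) + ((\<integral>y. fz c N x w y - fz c N x z y \<partial>R) - (\<integral>y. fz c N x w y - fz c N x z y \<partial>Q))\<bar> \<le> B)"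

text \<open>\<open>V\<close> is the scaled cost and \<open>U\<close> its linear part. Since
  \<open>C\<close> does not depend on \<open>e\<close>, the half-width can be taken with
  \<open>C * e \<le> a\<close>; the gap of that cube is then fixed and exceeds
  \<open>C * e / \<tau> k\<close> for large \<open>k\<close>.\<close>

lemma linearisation_in_probability:
  fixes q :: "nat \<Rightarrow> 'b \<Rightarrow> nat \<Rightarrow> real" and R :: "nat \<Rightarrow> 'b \<Rightarrow> 'a measure"
  assumes "prob_space M" and tau: "filterlim \<tau> at_top sequentially"
    and H: "\<And>d. d > 0 \<Longrightarrow> \<exists>C\<ge>0. \<forall>e>0. \<forall>\<^sub>F k in sequentially. \<exists>A\<in>sets M. measure M A \<le> d \<and>
       (\<forall>\<omega>\<in>space M - A. controlled (\<tau> k) e (C * e) (q k \<omega>) (R k \<omega>)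
          \<and> V k \<omega> - U k \<omega> = \<tau> k * (transport_cost c (discrete_law N x (q k \<omega>)) (R k \<omega>) - g_c c N x (q k \<omega>) (R k \<omega>) z))"
    and a: "a > 0"
  shows "(\<lambda>k. measure M {\<omega> \<in> space M. \<bar>V k \<omega> - U k \<omega>\<bar> > a}) \<longlonglongrightarrow> 0"
proof (rule order_tendstoI)
  interpret M: prob_space M by fact
  show "\<forall>\<^sub>F k in sequentially. b < measure M {\<omega> \<in> space M. \<bar>V k \<omega> - U k \<omega>\<bar> > a}" if "b < 0" for b
    by (rule always_eventually) (use that in \<open>auto intro: less_le_trans\<close>)
  fix b :: real assume b: "0 < b"
  obtain C where C: "C \<ge> 0" "\<forall>e>0. \<forall>\<^sub>F k in sequentially. \<exists>A\<in>sets M. measure M A \<le> b / 2 \<and>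
       (\<forall>\<omega>\<in>space M - A. controlled (\<tau> k) e (C * e) (q k \<omega>) (R k \<omega>)
          \<and> V k \<omega> - U k \<omega> = \<tau> k * (transport_cost c (discrete_law N x (q k \<omega>)) (R k \<omega>) - g_c c N x (q k \<omega>) (R k \<omega>) z))"
    using H[OF half_gt_zero[OF b]] by blast
  define e where "e = a / (C + 1)"
  have e: "e > 0" "C * e \<le> a" using a C(1) by (auto simp: e_def field_simps)
  obtain d where d: "d > 0" and gap: "\<forall>w. w 0 = z 0 \<and> (\<forall>i<N. \<bar>w i - z i\<bar> \<le> e) \<and> (\<exists>i<N. \<bar>w i - z i\<bar> = e)
       \<longrightarrow> g_c c N x p Q w \<le> g_c c N x p Q z - d"
    by (rule potential_gap[OF e(1)])
  have "\<forall>\<^sub>F k in sequentially. C * e / d < \<tau> k"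
    using tau by (simp add: filterlim_at_top_dense)
  moreover have "\<forall>\<^sub>F k in sequentially. 0 < \<tau> k"
    using tau by (simp add: filterlim_at_top_dense)
  ultimately show "\<forall>\<^sub>F k in sequentially. measure M {\<omega> \<in> space M. \<bar>V k \<omega> - U k \<omega>\<bar> > a} < b"
    using C(2)[rule_format, OF e(1)]
  proof eventually_elim
    case (elim k)
    then obtain A where A: "A \<in> sets M" "measure M A \<le> b / 2" and good:
       "\<forall>\<omega>\<in>space M - A. controlled (\<tau> k) e (C * e) (q k \<omega>) (R k \<omega>)
          \<and> V k \<omega> - U k \<omega> = \<tau> k * (transport_cost c (discrete_law N x (q k \<omega>)) (R k \<omega>) - g_c c N x (q k \<omega>) (R k \<omega>) z)"
      by blast
    have "\<bar>V k \<omega> - U k \<omega>\<bar> \<le> a" if \<omega>: "\<omega> \<in> space M - A" for \<omega>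
    proof -
      note g = good[rule_format, OF \<omega>, unfolded controlled_def]
      have "\<bar>transport_cost c (discrete_law N x (q k \<omega>)) (R k \<omega>) - g_c c N x (q k \<omega>) (R k \<omega>) z\<bar> \<le> C * e / \<tau> k"
      proof (rule transport_cost_linearisation[OF e(1) gap])
        show "C * e / \<tau> k < d" using elim d by (simp add: field_simps)
        fix w assume "w 0 = z 0" "\<forall>i<N. \<bar>w i - z i\<bar> \<le> e"
        then show "\<bar>(\<Sum>i<N. (w i - z i) * (q k \<omega> i - p i)) + ((\<integral>y. fz c N x w y - fz c N x z y \<partial>R k \<omega>) - (\<integral>y. fz c N x w y - fz c N x z y \<partial>Q))\<bar> \<le> C * e / \<tau> k"
          using g elim by (simp add: pos_le_divide_eq mult.commute)
      qed (use g in auto)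
      then have "\<tau> k * \<bar>transport_cost c (discrete_law N x (q k \<omega>)) (R k \<omega>) - g_c c N x (q k \<omega>) (R k \<omega>) z\<bar> \<le> C * e"
        using elim by (simp add: pos_le_divide_eq mult.commute)
      then show ?thesis using g elim e(2) by (simp add: abs_mult)
    qed
    then have "{\<omega> \<in> space M. \<bar>V k \<omega> - U k \<omega>\<bar> > a} \<subseteq> A" by force
    then have "measure M {\<omega> \<in> space M. \<bar>V k \<omega> - U k \<omega>\<bar> > a} \<le> measure M A"
      using A(1) by (rule M.finite_measure_mono)
    then show ?case using A(2) b by simp
  qed
qed

end

section \<open>The two samples: frequencies, empirical measures and deviation bounds\<close>

locale semidiscrete_sampling = semidiscrete c N x p Q z + M: prob_space M
  for c :: "'a::euclidean_space \<Rightarrow> 'a \<Rightarrow> real" and N x p Q z and M :: "'b measure" +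
  fixes Xs Ys :: "nat \<Rightarrow> 'b \<Rightarrow> 'a"
  assumes x_inj: "inj_on x {..<N}"
    and indep: "M.indep_vars (\<lambda>_. borel) (\<lambda>k. case k of Inl i \<Rightarrow> Xs i | Inr j \<Rightarrow> Ys j) UNIV"
    and Xs_law: "\<And>i. distr M borel (Xs i) = discrete_law N x p"
    and Ys_law: "\<And>j. distr M borel (Ys j) = Q"
begin

lemma Xs_indep: "M.indep_vars (\<lambda>_. borel) Xs UNIV" and Ys_indep: "M.indep_vars (\<lambda>_. borel) Ys UNIV"
proof -
  have "M.indep_vars (\<lambda>_. borel) (\<lambda>k. case k of Inl i \<Rightarrow> Xs i | Inr j \<Rightarrow> Ys j) (range Inl)"
    "M.indep_vars (\<lambda>_. borel) (\<lambda>k. case k of Inl i \<Rightarrow> Xs i | Inr j \<Rightarrow> Ys j) (range Inr)"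
    by (rule M.indep_vars_subset[OF indep], simp)+
  from this[THEN M.indep_vars_reindex]
  show "M.indep_vars (\<lambda>_. borel) Xs UNIV" "M.indep_vars (\<lambda>_. borel) Ys UNIV" by simp_all
qed

lemma Xs_meas [measurable]: "Xs k \<in> M \<rightarrow>\<^sub>M borel" and Ys_meas [measurable]: "Ys k \<in> M \<rightarrow>\<^sub>M borel"
  using Xs_indep Ys_indep unfolding M.indep_vars_def by auto

lemma AE_Xs: "AE \<omega> in M. \<forall>k. Xs k \<omega> \<in> x ` {..<N}"
proof -
  have "AE \<omega> in M. Xs k \<omega> \<in> x ` {..<N}" for k
  proof -
    have "closed (x ` {..<N})" by (intro finite_imp_closed) auto
    then have "- x ` {..<N} \<in> sets borel" by auto
    then have "AE u in discrete_law N x p. u \<in> x ` {..<N}"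
      by (intro AE_I'[of "- x ` {..<N}"]) (auto simp: null_sets_def emeasure_discrete_law)
    then have "AE u in distr M borel (Xs k). u \<in> x ` {..<N}" unfolding Xs_law .
    then show ?thesis by (rule AE_distrD[OF Xs_meas])
  qed
  then show ?thesis by (simp add: AE_all_countable)
qed

definition phat :: "nat \<Rightarrow> 'b \<Rightarrow> nat \<Rightarrow> real" where
  "phat n \<omega> i = (\<Sum>k<n. indicator {x i} (Xs k \<omega>)) / n"

text \<open>Extends \<open>z\<close> from labels to points, with value 0 elsewhere; the linear part
  for the first sample becomes a sample mean.\<close>

definition zeta :: "'a \<Rightarrow> real" where
  "zeta u = (\<Sum>i<N. z i * indicator {x i} u)"

lemma indicator_sum:
  fixes f :: "nat \<Rightarrow> real"
  assumes "u \<in> x ` {..<N}"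
  shows "(\<Sum>i<N. f i * indicator {x i} u) = f (the_inv_into {..<N} x u)"
proof -
  obtain j where j: "j < N" "u = x j" using assms by auto
  have "(\<Sum>i<N. f i * indicator {x i} u) = (\<Sum>i<N. if i = j then f i else 0)"
    using x_inj j by (intro sum.cong) (auto simp: inj_on_def indicator_def)
  then show ?thesis using j x_inj by (simp add: the_inv_into_f_f)
qed

lemma zeta_point: "i < N \<Longrightarrow> zeta (x i) = z i"
  unfolding zeta_def by (subst indicator_sum) (auto simp: the_inv_into_f_f[OF x_inj])

lemma zeta_borel [measurable]: "zeta \<in> borel_measurable borel"
  unfolding zeta_def by measurable

lemma phat_sum:
  assumes "n \<ge> 1" "\<forall>k. Xs k \<omega> \<in> x ` {..<N}"
  shows "(\<Sum>i<N. phat n \<omega> i) = 1"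
proof -
  have "(\<Sum>i<N. phat n \<omega> i) = (\<Sum>k<n. \<Sum>i<N. 1 * indicator {x i} (Xs k \<omega>)) / n"
    unfolding phat_def by (subst sum.swap) (simp add: sum_divide_distrib)
  also have "\<dots> = (\<Sum>k<n. 1) / n" using assms(2) by (subst indicator_sum) auto
  finally show ?thesis using assms(1) by simp
qed

lemma sum_z_phat: "(\<Sum>i<N. z i * phat n \<omega> i) = (\<Sum>k<n. zeta (Xs k \<omega>)) / n"
  unfolding phat_def zeta_def times_divide_eq_right sum_distrib_left sum_divide_distrib by (rule sum.swap)

text \<open>Sampling from \<open>P\<close> only perturbs the weights on the fixed points, off a null
  event. The dual parameter thus keeps its \<open>N\<close> coordinates whatever the sample
  size.\<close>

lemma empirical_Xs:
  assumes "n \<ge> 1" "\<forall>k. Xs k \<omega> \<in> x ` {..<N}"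
  shows "empirical (\<lambda>k. Xs k \<omega>) n = discrete_law N x (phat n \<omega>)"
proof (rule measure_eqI)
  fix A assume "A \<in> sets (empirical (\<lambda>k. Xs k \<omega>) n)"
  then have A: "A \<in> sets borel" by (simp add: empirical_def)
  have ind: "(indicator A (Xs k \<omega>) :: real) = (\<Sum>i<N. indicator A (x i) * indicator {x i} (Xs k \<omega>))" for k
  proof -
    obtain i where i: "i < N" "Xs k \<omega> = x i" using assms(2) by blast
    show ?thesis using i assms(2) by (subst indicator_sum) (auto simp: the_inv_into_f_f[OF x_inj])
  qed
  have "emeasure (empirical (\<lambda>k. Xs k \<omega>) n) A = (\<Sum>k<n. ennreal (1 / n) * indicator A (Xs k \<omega>))"
    using A assms(1) by (simp add: empirical_eq_discrete_law emeasure_discrete_law)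
  also have "\<dots> = (\<Sum>k<n. ennreal (1 / n * indicator A (Xs k \<omega>)))"
    by (intro sum.cong) (auto simp: indicator_def)
  also have "\<dots> = ennreal (\<Sum>k<n. 1 / n * indicator A (Xs k \<omega>))" by (rule sum_ennreal) auto
  also have "(\<Sum>k<n. 1 / n * indicator A (Xs k \<omega>)) = (\<Sum>i<N. phat n \<omega> i * indicator A (x i))"
    unfolding ind phat_def sum_distrib_left sum_distrib_right sum_divide_distrib
    by (subst sum.swap) (simp add: mult_ac)
  also have "ennreal \<dots> = (\<Sum>i<N. ennreal (phat n \<omega> i * indicator A (x i)))"
    by (rule sum_ennreal[symmetric]) (auto simp: phat_def intro!: mult_nonneg_nonneg divide_nonneg_nonneg sum_nonneg)
  also have "\<dots> = (\<Sum>i<N. ennreal (phat n \<omega> i) * indicator A (x i))"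
    by (intro sum.cong) (auto simp: indicator_def)
  finally show "emeasure (empirical (\<lambda>k. Xs k \<omega>) n) A = emeasure (discrete_law N x (phat n \<omega>)) A"
    by (simp add: emeasure_discrete_law[OF A])
qed (simp add: empirical_def)

lemma integral_empirical:
  fixes g :: "'a \<Rightarrow> real"
  assumes "g \<in> borel_measurable borel" "m \<ge> 1"
  shows "(\<integral>y. g y \<partial>empirical (\<lambda>j. Ys j \<omega>) m) = (\<Sum>j<m. g (Ys j \<omega>)) / m"
    "integrable (empirical (\<lambda>j. Ys j \<omega>) m) g"
  using integral_discrete_law[of g m "\<lambda>_. 1 / m" "\<lambda>j. Ys j \<omega>"] assms
  by (simp_all add: empirical_eq_discrete_law sum_divide_distrib)

lemma prob_space_empirical:
  assumes "m \<ge> 1"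
  shows "prob_space (empirical (\<lambda>j. f j) m)" "sets (empirical f m) = sets borel"
  using prob_space_discrete_law[of m "\<lambda>_. 1 / m" f] assms by (simp_all add: empirical_eq_discrete_law)

lemma phat_deviation:
  assumes n: "n \<ge> 1" and L: "L \<ge> 0"
  obtains A where "A \<in> sets M" "measure M A \<le> 2 * N * exp (- L\<^sup>2 / 2)"
    "\<forall>\<omega>\<in>space M - A. \<forall>i<N. sqrt n * \<bar>phat n \<omega> i - p i\<bar> \<le> L"
proof -
  define B where "B i = {\<omega> \<in> space M. \<bar>(\<Sum>k<n. indicator {x i} (Xs k \<omega>)) - n * (\<integral>y. indicator {x i} y \<partial>discrete_law N x p)\<bar> \<ge> sqrt n * 1 * L}" for i
  have B_meas: "B i \<in> sets M" for i unfolding B_def by measurable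
  have mean: "(\<integral>y. indicator {x i} y \<partial>discrete_law N x p) = p i" if i: "i < N" for i
  proof -
    have "(\<integral>y. indicator {x i} y \<partial>discrete_law N x p) = (\<Sum>j<N. p j * indicator {x i} (x j))"
      using p_pos by (intro integral_discrete_law) (auto intro: less_imp_le)
    also have "\<dots> = (\<Sum>j<N. if j = i then p j else 0)"
      using x_inj i by (intro sum.cong) (auto simp: inj_on_def indicator_def)
    finally show ?thesis using i by simp
  qed
  have B_prob: "measure M (B i) \<le> 2 * exp (- L\<^sup>2 / 2)" for i
  proof -
    have "measure M (B i) \<le> 2 * exp (- 2 * L\<^sup>2)"
      unfolding B_def
      by (rule M.hoeffding_iid[where a = 0, OF M.indep_vars_subset[OF Xs_indep] Xs_law]) (use n L in \<open>auto simp: indicator_def\<close>)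
    \<comment> \<open>Weakened to the exponent of the chaining bound, so that one \<open>L\<close>
      serves both samples.\<close>
    also have "\<dots> \<le> 2 * exp (- L\<^sup>2 / 2)" by simp
    finally show ?thesis .
  qed
  define A where "A = (\<Union>i<N. B i)"
  show ?thesis
  proof (rule that[of A])
    show "A \<in> sets M" unfolding A_def by (rule sets.finite_UN) (use B_meas in auto)
    have "measure M A \<le> (\<Sum>i<N. measure M (B i))"
      unfolding A_def using B_meas by (intro M.finite_measure_subadditive_finite) auto
    also have "\<dots> \<le> (\<Sum>i<N. 2 * exp (- L\<^sup>2 / 2))" by (intro sum_mono B_prob)
    finally show "measure M A \<le> 2 * N * exp (- L\<^sup>2 / 2)" by simp
    show "\<forall>\<omega>\<in>space M - A. \<forall>i<N. sqrt n * \<bar>phat n \<omega> i - p i\<bar> \<le> L"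
    proof (intro ballI allI impI)
      fix \<omega> i assume \<omega>: "\<omega> \<in> space M - A" and i: "i < N"
      then have "\<omega> \<in> space M" "\<omega> \<notin> B i" by (auto simp: A_def)
      then have "\<bar>(\<Sum>k<n. indicator {x i} (Xs k \<omega>)) - n * p i\<bar> \<le> sqrt n * L"
        unfolding B_def mean[OF i] by simp
      moreover have "(\<Sum>k<n. indicator {x i} (Xs k \<omega>)) - n * p i = sqrt n * (sqrt n * (phat n \<omega> i - p i))"
        using n by (simp add: phat_def right_diff_distrib mult.assoc[symmetric])
      ultimately have "sqrt n * (sqrt n * \<bar>phat n \<omega> i - p i\<bar>) \<le> sqrt n * L" by (simp add: abs_mult)
      then show "sqrt n * \<bar>phat n \<omega> i - p i\<bar> \<le> L" using n by (simp add: mult_le_cancel_left_pos)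
    qed
  qed
qed

lemma empirical_process_deviation:
  assumes m: "m \<ge> 1" and L: "L \<ge> 0" and r: "2 ^ N * exp (- L\<^sup>2 / 2) \<le> 1 / 2" and e: "e > 0"
  obtains A where "A \<in> sets M" "measure M A \<le> 4 * 2 ^ N * exp (- L\<^sup>2 / 2)"
    "\<forall>\<omega>\<in>space M - A. \<forall>w. (\<forall>i<N. \<bar>w i - z i\<bar> \<le> e) \<longrightarrow>
      sqrt m * \<bar>(\<integral>y. fz c N x w y - fz c N x z y \<partial>empirical (\<lambda>j. Ys j \<omega>) m) - (\<integral>y. fz c N x w y - fz c N x z y \<partial>Q)\<bar> \<le> (16 * L + 16) * e"
proof -
  obtain A where A: "A \<in> sets M" "measure M A \<le> 4 * (2 ^ N * exp (- L\<^sup>2 / 2))" and good: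
    "\<forall>\<omega>\<in>space M - A. \<forall>w. (\<forall>i<N. \<bar>w i - z i\<bar> \<le> e) \<longrightarrow>
       \<bar>(\<Sum>k<m. fz c N x w (Ys k \<omega>) - fz c N x z (Ys k \<omega>)) - m * (\<integral>y. fz c N x w y - fz c N x z y \<partial>Q)\<bar> \<le> sqrt m * e * (16 * L + 16)"
    by (rule M.chaining_bound[where F = "fz c N x" and z = z, OF M.indep_vars_subset[OF Ys_indep] Ys_law m fz_borel fz_int fz_lipschitz[OF N] e L r]) auto
  show ?thesis
  proof (rule that[OF A(1)])
    show "measure M A \<le> 4 * 2 ^ N * exp (- L\<^sup>2 / 2)" using A(2) by simp
    show "\<forall>\<omega>\<in>space M - A. \<forall>w. (\<forall>i<N. \<bar>w i - z i\<bar> \<le> e) \<longrightarrow>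
      sqrt m * \<bar>(\<integral>y. fz c N x w y - fz c N x z y \<partial>empirical (\<lambda>j. Ys j \<omega>) m) - (\<integral>y. fz c N x w y - fz c N x z y \<partial>Q)\<bar> \<le> (16 * L + 16) * e"
    proof (intro ballI allI impI)
      fix \<omega> w assume \<omega>: "\<omega> \<in> space M - A" and w: "\<forall>i<N. \<bar>w i - z i\<bar> \<le> e"
      define I where "I = (\<integral>y. fz c N x w y - fz c N x z y \<partial>Q)"
      define S where "S = (\<Sum>k<m. fz c N x w (Ys k \<omega>) - fz c N x z (Ys k \<omega>))"
      have "(\<integral>y. fz c N x w y - fz c N x z y \<partial>empirical (\<lambda>j. Ys j \<omega>) m) = S / m"
        unfolding S_def by (rule integral_empirical) (use fz_borel m in auto)
      moreover have "S - m * I = sqrt m * (sqrt m * (S / m - I))"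
        using m by (simp add: right_diff_distrib mult.assoc[symmetric])
      then have "sqrt m * (sqrt m * \<bar>S / m - I\<bar>) \<le> sqrt m * ((16 * L + 16) * e)"
        using good[rule_format, OF \<omega>, of w] w by (simp add: S_def[symmetric] I_def[symmetric] abs_mult mult_ac)
      then have "sqrt m * \<bar>S / m - I\<bar> \<le> (16 * L + 16) * e" using m by (simp add: mult_le_cancel_left_pos)
      ultimately show "sqrt m * \<bar>(\<integral>y. fz c N x w y - fz c N x z y \<partial>empirical (\<lambda>j. Ys j \<omega>) m) - (\<integral>y. fz c N x w y - fz c N x z y \<partial>Q)\<bar> \<le> (16 * L + 16) * e"
        by (simp add: I_def)
    qed
  qed
qed

end

lemma weak_conv_m_subseq:
  assumes "weak_conv_m \<mu> \<nu>" "filterlim s sequentially sequentially"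
  shows "weak_conv_m (\<lambda>k. \<mu> (s k)) \<nu>"
  using assms unfolding weak_conv_m_def weak_conv_def by (auto intro: filterlim_compose)

lemma normalised_sum:
  assumes "n \<ge> 1"
  shows "(S - real n * I) / sqrt n = sqrt n * (S / n - I)"
proof -
  define s where "s = sqrt n"
  have s: "s > 0" "real n = s * s" using assms by (auto simp: s_def)
  show ?thesis unfolding s_def[symmetric] s(2) using s(1) by (simp add: field_simps)
qed

context semidiscrete_sampling
begin

lemma transport_cost_eq_g_c: "transport_cost c (discrete_law N x p) Q = g_c c N x p Q z"
proof (rule antisym)
  show "g_c c N x p Q z \<le> transport_cost c (discrete_law N x p) Q"
    by (rule g_c_le_transport_cost[OF Q_prob Q_sets N p_pos p_sum c_nonneg c_meas c_int])
  show "transport_cost c (discrete_law N x p) Q \<le> g_c c N x p Q z"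
  proof (rule field_le_epsilon)
    fix a :: real assume a: "0 < a"
    obtain w where "transport_cost c (discrete_law N x p) Q \<le> g_c c N x p Q w + a"
      by (rule transport_cost_le_g_c[where x = x and c = c and q = p, OF Q_prob Q_sets N p_pos p_sum c_nonneg c_meas c_int a])
    then show "transport_cost c (discrete_law N x p) Q \<le> g_c c N x p Q z + a" using z_max[of w] by simp
  qed
qed

text \<open>The scaled linear part for the first sample, written as a centred sum for the central
  limit theorem; \<open>UX_eq\<close> returns it to the form that appears in the expansion.\<close>

definition UX :: "nat \<Rightarrow> 'b \<Rightarrow> real" where
  "UX n \<omega> = (\<Sum>k<n. zeta (Xs k \<omega>) - (\<Sum>i<N. z i * p i)) / sqrt n"

definition UY :: "nat \<Rightarrow> 'b \<Rightarrow> real" where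
  "UY m \<omega> = (\<Sum>j<m. fz c N x z (Ys j \<omega>) - (\<integral>y. fz c N x z y \<partial>Q)) / sqrt m"

lemma UX_meas [measurable]: "UX n \<in> borel_measurable M"
  unfolding UX_def by measurable

lemma fz_Ys_meas [measurable]: "(\<lambda>\<omega>. fz c N x z (Ys j \<omega>)) \<in> borel_measurable M"
  by (rule measurable_compose[OF Ys_meas fz_borel])

lemma UY_meas [measurable]: "UY m \<in> borel_measurable M"
  unfolding UY_def by measurable

lemma UX_eq: "n \<ge> 1 \<Longrightarrow> UX n \<omega> = sqrt n * (\<Sum>i<N. z i * (phat n \<omega> i - p i))"
  by (simp add: UX_def right_diff_distrib sum_subtractf sum_z_phat normalised_sum)

lemma UY_eq: "m \<ge> 1 \<Longrightarrow> UY m \<omega> = sqrt m * ((\<integral>y. fz c N x z y \<partial>empirical (\<lambda>j. Ys j \<omega>) m) - (\<integral>y. fz c N x z y \<partial>Q))"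
  by (simp add: UY_def integral_empirical[OF fz_borel] right_diff_distrib sum_subtractf normalised_sum)

lemma UX_weak_conv:
  shows "sigma2_P N p z \<ge> 0" "weak_conv_m (\<lambda>n. distr M borel (UX n)) (normal_law (sigma2_P N p z))"
proof -
  have int: "(\<integral>\<omega>. g (Xs k \<omega>) \<partial>M) = (\<Sum>i<N. p i * g (x i))" "integrable M (\<lambda>\<omega>. g (Xs k \<omega>))"
    if g: "g \<in> borel_measurable borel" for g :: "'a \<Rightarrow> real" and k
    using integral_distr[OF Xs_meas[of k] g] integrable_distr_eq[OF Xs_meas[of k] g]
      integral_discrete_law[OF g less_imp_le[OF p_pos], where x = x] by (simp_all add: Xs_law)
  have mean: "(\<integral>\<omega>. zeta (Xs k \<omega>) \<partial>M) = (\<Sum>i<N. z i * p i)" for k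
    using int(1)[OF zeta_borel] by (simp add: zeta_point mult.commute)
  have sq: "(\<integral>\<omega>. (zeta (Xs k \<omega>))\<^sup>2 \<partial>M) = (\<Sum>i<N. (z i)\<^sup>2 * p i)" "integrable M (\<lambda>\<omega>. (zeta (Xs k \<omega>))\<^sup>2)" for k
    using int[of "\<lambda>u. (zeta u)\<^sup>2" k] by (simp_all add: zeta_point mult.commute)
  have var: "M.variance (\<lambda>\<omega>. zeta (Xs k \<omega>)) = sigma2_P N p z" for k
    using M.variance_eq[OF int(2)[OF zeta_borel] sq(2), of k] by (simp add: sq mean sigma2_P_def)
  have dist: "distr M borel (\<lambda>\<omega>. zeta (Xs k \<omega>)) = distr (discrete_law N x p) borel zeta" for k
    unfolding Xs_law[of k, symmetric] by (subst distr_distr) (auto simp: comp_def)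
  have "M.indep_vars (\<lambda>_. borel) (\<lambda>k \<omega>. zeta (Xs k \<omega>)) UNIV"
    by (rule M.indep_vars_compose2[OF Xs_indep]) simp
  from M.clt_normal_law[OF this mean sq(2) var dist]
  show "sigma2_P N p z \<ge> 0" "weak_conv_m (\<lambda>n. distr M borel (UX n)) (normal_law (sigma2_P N p z))"
    by (simp_all add: UX_def[abs_def])
qed

lemma UY_weak_conv:
  assumes c2: "\<And>i. i < N \<Longrightarrow> integrable Q (\<lambda>y. (c (x i) y)\<^sup>2)"
  shows "sigma2_Q c N x Q z \<ge> 0" "weak_conv_m (\<lambda>m. distr M borel (UY m)) (normal_law (sigma2_Q c N x Q z))"
proof -
  have fz_meas_Q: "fz c N x z \<in> borel_measurable Q" using fz_int by blast
  have fz2: "integrable Q (\<lambda>y. (fz c N x z y)\<^sup>2)"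
  proof (rule Bochner_Integration.integrable_bound)
    \<comment> \<open>The potential lies between \<open>- B\<close> and
      \<open>c (x 0) y + B\<close>, so its square is dominated through a single squared
      cost.\<close>
    define B where "B = (\<Sum>i<N. \<bar>z i\<bar>)"
    have B: "\<bar>z i\<bar> \<le> B" if "i < N" for i unfolding B_def by (rule member_le_sum) (use that in auto)
    show "integrable Q (\<lambda>y. 2 * (c (x 0) y)\<^sup>2 + 2 * B\<^sup>2)" using c2[of 0] N by auto
    have "(fz c N x z y)\<^sup>2 \<le> 2 * (c (x 0) y)\<^sup>2 + 2 * B\<^sup>2" for y
    proof -
      have "fz c N x z y \<le> c (x 0) y + B" using fz_le[of 0 N c x z y] B[of 0] N by force
      moreover have "- B \<le> fz c N x z y"
      proof (rule fz_greatest[OF N])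
        show "- B \<le> c (x i) y - z i" if "i < N" for i using B[OF that] c_nonneg[of "x i" y] by linarith
      qed
      ultimately have "\<bar>fz c N x z y\<bar> \<le> c (x 0) y + B" using c_nonneg[of "x 0" y] by linarith
      then have "(fz c N x z y)\<^sup>2 \<le> (c (x 0) y + B)\<^sup>2" by (rule power2_le_iff_abs_le[THEN iffD2, rotated]) (use B[of 0] N c_nonneg[of "x 0" y] in linarith)
      also have "\<dots> \<le> 2 * (c (x 0) y)\<^sup>2 + 2 * B\<^sup>2" using sum_squares_bound[of "c (x 0) y" B] by (simp add: power2_sum)
      finally show ?thesis .
    qed
    then show "AE y in Q. norm ((fz c N x z y)\<^sup>2) \<le> norm (2 * (c (x 0) y)\<^sup>2 + 2 * B\<^sup>2)" by simp
  qed (use fz_meas_Q in measurable)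
  have mean: "(\<integral>\<omega>. fz c N x z (Ys k \<omega>) \<partial>M) = (\<integral>y. fz c N x z y \<partial>Q)" for k
    using integral_distr[OF Ys_meas[of k] fz_borel[of z]] by (simp add: Ys_law)
  have int: "integrable M (\<lambda>\<omega>. fz c N x z (Ys k \<omega>))" for k
    using integrable_distr_eq[OF Ys_meas[of k] fz_borel[of z]] fz_int by (simp add: Ys_law)
  have fz2_borel: "(\<lambda>y. (fz c N x z y)\<^sup>2) \<in> borel_measurable borel" using fz_borel[of z] by measurable
  have sq: "(\<integral>\<omega>. (fz c N x z (Ys k \<omega>))\<^sup>2 \<partial>M) = (\<integral>y. (fz c N x z y)\<^sup>2 \<partial>Q)" "integrable M (\<lambda>\<omega>. (fz c N x z (Ys k \<omega>))\<^sup>2)" for k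
    using integral_distr[OF Ys_meas[of k] fz2_borel] integrable_distr_eq[OF Ys_meas[of k] fz2_borel] fz2
    by (simp_all add: Ys_law)
  have var: "M.variance (\<lambda>\<omega>. fz c N x z (Ys k \<omega>)) = sigma2_Q c N x Q z" for k
    using M.variance_eq[OF int sq(2), of k] by (simp add: sq mean sigma2_Q_def)
  have dist: "distr M borel (\<lambda>\<omega>. fz c N x z (Ys k \<omega>)) = distr Q borel (fz c N x z)" for k
  proof -
    have "distr (distr M borel (Ys k)) borel (fz c N x z) = distr M borel (\<lambda>\<omega>. fz c N x z (Ys k \<omega>))"
      by (subst distr_distr) (use fz_borel in \<open>auto simp: comp_def\<close>)
    then show ?thesis by (simp add: Ys_law)
  qed
  have "M.indep_vars (\<lambda>_. borel) (\<lambda>k \<omega>. fz c N x z (Ys k \<omega>)) UNIV"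
    by (rule M.indep_vars_compose2[OF Ys_indep]) (rule fz_borel)
  from M.clt_normal_law[OF this mean sq(2) var dist]
  show "sigma2_Q c N x Q z \<ge> 0" "weak_conv_m (\<lambda>m. distr M borel (UY m)) (normal_law (sigma2_Q c N x Q z))"
    by (simp_all add: UY_def[abs_def])
qed

text \<open>Splitting the product formula for the characteristic function of the whole sum replaces an
  argument on the independence of the two blocks.\<close>

lemma char_UX_UY:
  "char (distr M borel (\<lambda>\<omega>. a * UX n \<omega> + b * UY m \<omega>)) t
    = char (distr M borel (UX n)) (a * t) * char (distr M borel (UY m)) (b * t)"
proof -
  define g where "g k u = (case k of Inl _ \<Rightarrow> a * ((zeta u - (\<Sum>i<N. z i * p i)) / sqrt n)
     | Inr _ \<Rightarrow> b * ((fz c N x z u - (\<integral>y. fz c N x z y \<partial>Q)) / sqrt m))" for k :: "nat + nat" and u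
  define W where "W k \<omega> = g k ((case k of Inl i \<Rightarrow> Xs i | Inr j \<Rightarrow> Ys j) \<omega>)" for k :: "nat + nat" and \<omega>
  have W_indep: "M.indep_vars (\<lambda>_. borel) W UNIV"
    unfolding W_def
  proof (rule M.indep_vars_compose2[OF indep])
    show "g k \<in> borel_measurable borel" for k
      using fz_borel[of z] by (cases k) (simp_all add: g_def[abs_def])
  qed
  define A where "A = (Inl ` {..<n} :: (nat + nat) set)"
  define B where "B = (Inr ` {..<m} :: (nat + nat) set)"
  have AB: "finite A" "finite B" "A \<inter> B = {}" by (auto simp: A_def B_def)
  have sumA: "(\<Sum>k\<in>A. W k \<omega>) = a * UX n \<omega>" for \<omega>
    unfolding A_def by (subst sum.reindex) (auto simp: W_def g_def UX_def sum_divide_distrib sum_distrib_left)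
  have sumB: "(\<Sum>k\<in>B. W k \<omega>) = b * UY m \<omega>" for \<omega>
    unfolding B_def by (subst sum.reindex) (auto simp: W_def g_def UY_def sum_divide_distrib sum_distrib_left)
  have ch: "char (distr M borel (\<lambda>\<omega>. \<Sum>k\<in>D. W k \<omega>)) t = (\<Prod>k\<in>D. char (distr M borel (W k)) t)" for D
    by (rule M.char_distr_sum[OF M.indep_vars_subset[OF W_indep]]) simp
  have "char (distr M borel (\<lambda>\<omega>. a * UX n \<omega> + b * UY m \<omega>)) t = char (distr M borel (\<lambda>\<omega>. \<Sum>k\<in>A \<union> B. W k \<omega>)) t"
    using AB by (simp add: sum.union_disjoint sumA sumB)
  also have "\<dots> = (\<Prod>k\<in>A. char (distr M borel (W k)) t) * (\<Prod>k\<in>B. char (distr M borel (W k)) t)"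
    unfolding ch using AB by (simp add: prod.union_disjoint)
  also have "\<dots> = char (distr M borel (\<lambda>\<omega>. a * UX n \<omega>)) t * char (distr M borel (\<lambda>\<omega>. b * UY m \<omega>)) t"
    unfolding ch[symmetric] sumA sumB ..
  finally show ?thesis by (simp add: char_distr_scale)
qed

text \<open>The random points with equal weights are used here: the form with weights
  \<open>phat\<close> is valid only almost surely. Joint measurability of the potential and
  integration over \<open>Q\<close> then suffice.\<close>

lemma transport_cost_Xs_measurable:
  "(\<lambda>\<omega>. transport_cost c (empirical (\<lambda>k. Xs k \<omega>) n) Q) \<in> borel_measurable M" if "n \<ge> 1"
proof -
  have "(\<lambda>\<omega>. transport_cost c (discrete_law n (\<lambda>k. Xs k \<omega>) (\<lambda>_. 1 / n)) Q) \<in> borel_measurable M"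
  proof (rule transport_cost_measurable[OF Q_prob Q_sets that _ _ c_nonneg c_meas])
    fix w
    have "(\<lambda>u. fz c n (\<lambda>k. Xs k (fst u)) w (snd u)) \<in> borel_measurable (M \<Otimes>\<^sub>M Q)"
      using Q_sets by (intro fz_measurable_joint[OF c_meas]) (auto cong: measurable_cong_sets)
    then show "(\<lambda>\<omega>. \<integral>\<^sup>+ y. ennreal (fz c n (\<lambda>k. Xs k \<omega>) w y) \<partial>Q) \<in> borel_measurable M"
      by (intro Q.borel_measurable_nn_integral) (simp add: split_beta')
  qed (use that in auto)
  then show ?thesis using that by (simp add: empirical_eq_discrete_law)
qed

lemma transport_cost_Ys_measurable:
  assumes n: "n \<ge> 1" and m: "m \<ge> 1" and A: "\<And>k. A k \<in> M \<rightarrow>\<^sub>M borel"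
    and q: "\<And>i. i < n \<Longrightarrow> q i > 0" "(\<Sum>i<n. q i) = 1"
  shows "(\<lambda>\<omega>. transport_cost c (discrete_law n (\<lambda>k. A k \<omega>) q) (empirical (\<lambda>j. Ys j \<omega>) m)) \<in> borel_measurable M"
proof (rule transport_cost_measurable[OF prob_space_empirical[OF m] n q c_nonneg c_meas])
  fix w
  have sec: "fz c n a w \<in> borel_measurable borel" for a
    using fz_measurable[of n c a "\<lambda>y. y" borel w] borel_measurable_section[OF c_meas] by simp
  have "(\<integral>\<^sup>+ y. ennreal (fz c n (\<lambda>k. A k \<omega>) w y) \<partial>empirical (\<lambda>j. Ys j \<omega>) m)
      = (\<Sum>j<m. ennreal (1 / m) * ennreal (fz c n (\<lambda>k. A k \<omega>) w (Ys j \<omega>)))" for \<omega>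
    using m sec by (simp add: empirical_eq_discrete_law nn_integral_discrete_law)
  moreover have "(\<lambda>\<omega>. fz c n (\<lambda>k. A k \<omega>) w (Ys j \<omega>)) \<in> borel_measurable M" for j
    by (rule fz_measurable_joint[OF c_meas A Ys_meas])
  ultimately show "(\<lambda>\<omega>. \<integral>\<^sup>+ y. ennreal (fz c n (\<lambda>k. A k \<omega>) w y) \<partial>empirical (\<lambda>j. Ys j \<omega>) m) \<in> borel_measurable M"
    by simp
qed

lemma weight_perturbation_bound:
  fixes e t L :: real
  assumes "\<forall>i<N. \<bar>w i - z i\<bar> \<le> e" "\<forall>i<N. t * \<bar>q i - p i\<bar> \<le> L" "t \<ge> 0" "e \<ge> 0"
  shows "t * \<bar>\<Sum>i<N. (w i - z i) * (q i - p i)\<bar> \<le> N * L * e"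
proof -
  have "t * \<bar>\<Sum>i<N. (w i - z i) * (q i - p i)\<bar> \<le> t * (\<Sum>i<N. \<bar>w i - z i\<bar> * \<bar>q i - p i\<bar>)"
    using assms(3) by (intro mult_left_mono order.trans[OF sum_abs]) (auto simp: abs_mult)
  also have "\<dots> = (\<Sum>i<N. \<bar>w i - z i\<bar> * (t * \<bar>q i - p i\<bar>))" by (simp add: sum_distrib_left mult_ac)
  also have "\<dots> \<le> (\<Sum>i<N. e * L)"
    using assms by (intro sum_mono mult_mono) auto
  finally show ?thesis by (simp add: mult_ac)
qed

text \<open>Duality is available for positive weights, whereas a frequency may be 0. Off the
  deviation event, where \<open>phat\<close> is within \<open>L / sqrt n\<close> of
  \<open>p\<close>, this inequality forces all frequencies to be positive.\<close>

lemma eventually_weights_pos: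
  assumes ns: "filterlim ns at_top sequentially"
  shows "\<forall>\<^sub>F k in sequentially. \<forall>i<N. L < sqrt (real (ns k)) * p i"
proof -
  have "\<forall>\<^sub>F k in sequentially. L / p i < sqrt (real (ns k))" for i
    using filterlim_compose[OF sqrt_at_top filterlim_compose[OF filterlim_real_sequentially ns]]
    by (simp add: filterlim_at_top_dense)
  then have "\<forall>\<^sub>F k in sequentially. \<forall>i\<in>{..<N}. L / p i < sqrt (real (ns k))"
    by (intro eventually_ball_finite) auto
  then show ?thesis by eventually_elim (use p_pos in \<open>auto simp: pos_divide_less_eq\<close>)
qed

lemma phat_pos:
  assumes "sqrt (real n) * \<bar>phat n \<omega> i - p i\<bar> \<le> L" "L < sqrt (real n) * p i" "n \<ge> 1"
  shows "phat n \<omega> i > 0"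
proof -
  have "sqrt n * \<bar>phat n \<omega> i - p i\<bar> < sqrt n * p i" using assms by linarith
  then have "\<bar>phat n \<omega> i - p i\<bar> < p i" using assms(3) by (simp add: mult_less_cancel_left_pos)
  then show ?thesis by linarith
qed

section \<open>The three limit laws\<close>

lemma transport_cost_Xs_weak_conv:
  "weak_conv_m (\<lambda>n. distr M borel (\<lambda>\<omega>. sqrt n * (transport_cost c (empirical (\<lambda>k. Xs k \<omega>) n) Q - transport_cost c (discrete_law N x p) Q)))
     (normal_law (sigma2_P N p z))"
proof (rule M.weak_conv_m_of_char_approx[OF UX_meas])
  show "(\<lambda>\<omega>. sqrt n * (transport_cost c (empirical (\<lambda>k. Xs k \<omega>) n) Q - transport_cost c (discrete_law N x p) Q)) \<in> borel_measurable M" for n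
    \<comment> \<open>At \<open>n = 0\<close> the factor \<open>sqrt n\<close> makes the variable
      constant.\<close>
    using transport_cost_Xs_measurable[of n] by (cases "n = 0") auto
  show \<mu>: "real_distribution (normal_law (sigma2_P N p z))" by (rule real_distribution_normal_law[OF UX_weak_conv(1)])
  show "(\<lambda>n. char (distr M borel (UX n)) t) \<longlonglongrightarrow> char (normal_law (sigma2_P N p z)) t" for t
    by (rule levy_continuity1[OF _ \<mu> UX_weak_conv(2)]) simp
  fix a :: real assume a: "a > 0"
  have tau: "filterlim (\<lambda>n. sqrt (real n)) at_top sequentially"
    by (rule filterlim_compose[OF sqrt_at_top filterlim_real_sequentially])
  obtain N0 where N0: "N0 \<in> null_sets M" "{\<omega> \<in> space M. \<not> (\<forall>k. Xs k \<omega> \<in> x ` {..<N})} \<subseteq> N0"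
    using AE_Xs by (auto elim!: AE_E simp: null_sets_def)
  show "(\<lambda>n. measure M {\<omega> \<in> space M. \<bar>sqrt n * (transport_cost c (empirical (\<lambda>k. Xs k \<omega>) n) Q - transport_cost c (discrete_law N x p) Q) - UX n \<omega>\<bar> > a}) \<longlonglongrightarrow> 0"
  proof (rule linearisation_in_probability[OF M.prob_space_axioms tau _ a, where q = phat and R = "\<lambda>_ _. Q"])
    fix d :: real assume d: "d > 0"
    obtain L where L: "L \<ge> 1" "2 * N * exp (- L\<^sup>2 / 2) \<le> d"
      by (rule exists_gaussian_tail[of "2 * real N" d]) (use N d in auto)
    show "\<exists>C\<ge>0. \<forall>e>0. \<forall>\<^sub>F n in sequentially. \<exists>A\<in>sets M. measure M A \<le> d \<and>
       (\<forall>\<omega>\<in>space M - A. controlled (sqrt n) e (C * e) (phat n \<omega>) Q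
          \<and> sqrt n * (transport_cost c (empirical (\<lambda>k. Xs k \<omega>) n) Q - transport_cost c (discrete_law N x p) Q) - UX n \<omega>
              = sqrt n * (transport_cost c (discrete_law N x (phat n \<omega>)) Q - g_c c N x (phat n \<omega>) Q z))"
    \<comment> \<open>Only the weights are perturbed, so the integral part cancels and the constant
      is that of \<open>weight_perturbation_bound\<close>.\<close>
    proof (intro exI[of _ "N * L"] conjI allI impI)
      fix e :: real assume e: "e > 0"
      show "\<forall>\<^sub>F n in sequentially. \<exists>A\<in>sets M. measure M A \<le> d \<and>
       (\<forall>\<omega>\<in>space M - A. controlled (sqrt n) e (N * L * e) (phat n \<omega>) Q
          \<and> sqrt n * (transport_cost c (empirical (\<lambda>k. Xs k \<omega>) n) Q - transport_cost c (discrete_law N x p) Q) - UX n \<omega>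
              = sqrt n * (transport_cost c (discrete_law N x (phat n \<omega>)) Q - g_c c N x (phat n \<omega>) Q z))"
        using eventually_weights_pos[OF filterlim_ident, of L] eventually_ge_at_top[of 1]
      proof eventually_elim
        case (elim n)
        obtain A where A: "A \<in> sets M" "measure M A \<le> 2 * N * exp (- L\<^sup>2 / 2)"
          "\<forall>\<omega>\<in>space M - A. \<forall>i<N. sqrt n * \<bar>phat n \<omega> i - p i\<bar> \<le> L"
          by (rule phat_deviation[OF elim(2), of L]) (use L in auto)
        have "measure M (A \<union> N0) \<le> d"
          using A L(2) measure_Un_null_set[OF A(1) N0(1)] by simp
        moreover have "A \<union> N0 \<in> sets M" using A(1) N0(1) by auto
        moreover have "controlled (sqrt n) e (N * L * e) (phat n \<omega>) Q
          \<and> sqrt n * (transport_cost c (empirical (\<lambda>k. Xs k \<omega>) n) Q - transport_cost c (discrete_law N x p) Q) - UX n \<omega>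
              = sqrt n * (transport_cost c (discrete_law N x (phat n \<omega>)) Q - g_c c N x (phat n \<omega>) Q z)"
          if \<omega>: "\<omega> \<in> space M - (A \<union> N0)" for \<omega>
        unfolding controlled_def
        proof (intro conjI allI impI)
          have X: "\<forall>k. Xs k \<omega> \<in> x ` {..<N}" using \<omega> N0(2) by blast
          have dev: "\<forall>i<N. sqrt n * \<bar>phat n \<omega> i - p i\<bar> \<le> L" using A(3) \<omega> by blast
          show "phat n \<omega> i > 0" if "i < N" for i using phat_pos[of n \<omega> i L] dev elim that by blast
          show "(\<Sum>i<N. phat n \<omega> i) = 1" by (rule phat_sum[OF elim(2) X])
          show "sqrt n * \<bar>(\<Sum>i<N. (w i - z i) * (phat n \<omega> i - p i)) + ((\<integral>y. fz c N x w y - fz c N x z y \<partial>Q) - (\<integral>y. fz c N x w y - fz c N x z y \<partial>Q))\<bar> \<le> N * L * e"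
            if "\<forall>i<N. \<bar>w i - z i\<bar> \<le> e" for w
            using weight_perturbation_bound[OF that dev] e by simp
          have g_eq: "g_c c N x (phat n \<omega>) Q z = g_c c N x p Q z + (\<Sum>i<N. z i * (phat n \<omega> i - p i))"
            by (simp add: g_c_def right_diff_distrib sum_subtractf)
          show "sqrt n * (transport_cost c (empirical (\<lambda>k. Xs k \<omega>) n) Q - transport_cost c (discrete_law N x p) Q) - UX n \<omega>
              = sqrt n * (transport_cost c (discrete_law N x (phat n \<omega>)) Q - g_c c N x (phat n \<omega>) Q z)"
            unfolding UX_eq[OF elim(2)] empirical_Xs[OF elim(2) X] transport_cost_eq_g_c g_eq by (simp add: algebra_simps)
        qed (use Q_prob Q_sets c_int in auto)
        ultimately show ?case by blast
      qed
    qed (use L in auto)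
  qed
qed

lemma transport_cost_Ys_weak_conv:
  assumes c2: "\<And>i. i < N \<Longrightarrow> integrable Q (\<lambda>y. (c (x i) y)\<^sup>2)"
  shows "weak_conv_m (\<lambda>m. distr M borel (\<lambda>\<omega>. sqrt m * (transport_cost c (discrete_law N x p) (empirical (\<lambda>j. Ys j \<omega>) m) - transport_cost c (discrete_law N x p) Q)))
     (normal_law (sigma2_Q c N x Q z))"
proof (rule M.weak_conv_m_of_char_approx[OF UY_meas])
  let ?E = "\<lambda>m \<omega>. empirical (\<lambda>j. Ys j \<omega>) m"
  show "(\<lambda>\<omega>. sqrt m * (transport_cost c (discrete_law N x p) (?E m \<omega>) - transport_cost c (discrete_law N x p) Q)) \<in> borel_measurable M" for m
    using transport_cost_Ys_measurable[OF N, of m "\<lambda>k _. x k" p] p_pos p_sum by (cases "m = 0") auto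
  show \<mu>: "real_distribution (normal_law (sigma2_Q c N x Q z))" by (rule real_distribution_normal_law[OF UY_weak_conv(1)[OF c2]])
  show "(\<lambda>m. char (distr M borel (UY m)) t) \<longlonglongrightarrow> char (normal_law (sigma2_Q c N x Q z)) t" for t
    by (rule levy_continuity1[OF _ \<mu> UY_weak_conv(2)[OF c2]]) simp
  fix a :: real assume a: "a > 0"
  have tau: "filterlim (\<lambda>n. sqrt (real n)) at_top sequentially"
    by (rule filterlim_compose[OF sqrt_at_top filterlim_real_sequentially])
  show "(\<lambda>m. measure M {\<omega> \<in> space M. \<bar>sqrt m * (transport_cost c (discrete_law N x p) (?E m \<omega>) - transport_cost c (discrete_law N x p) Q) - UY m \<omega>\<bar> > a}) \<longlonglongrightarrow> 0"
  proof (rule linearisation_in_probability[OF M.prob_space_axioms tau _ a, where q = "\<lambda>_ _. p" and R = ?E])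
    fix d :: real assume d: "d > 0"
    \<comment> \<open>The cap 2 forces \<open>2 ^ N * exp (- L\<^sup>2 / 2) \<le> 1 / 2\<close>, the
      ratio condition of the chaining bound.\<close>
    obtain L where L: "L \<ge> 1" "4 * 2 ^ N * exp (- L\<^sup>2 / 2) \<le> min d 2"
      by (rule exists_gaussian_tail[of "4 * 2 ^ N" "min d 2"]) (use d in auto)
    show "\<exists>C\<ge>0. \<forall>e>0. \<forall>\<^sub>F m in sequentially. \<exists>A\<in>sets M. measure M A \<le> d \<and>
       (\<forall>\<omega>\<in>space M - A. controlled (sqrt m) e (C * e) p (?E m \<omega>)
          \<and> sqrt m * (transport_cost c (discrete_law N x p) (?E m \<omega>) - transport_cost c (discrete_law N x p) Q) - UY m \<omega>
              = sqrt m * (transport_cost c (discrete_law N x p) (?E m \<omega>) - g_c c N x p (?E m \<omega>) z))"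
    proof (intro exI[of _ "16 * L + 16"] conjI allI impI)
      fix e :: real assume e: "e > 0"
      show "\<forall>\<^sub>F m in sequentially. \<exists>A\<in>sets M. measure M A \<le> d \<and>
       (\<forall>\<omega>\<in>space M - A. controlled (sqrt m) e ((16 * L + 16) * e) p (?E m \<omega>)
          \<and> sqrt m * (transport_cost c (discrete_law N x p) (?E m \<omega>) - transport_cost c (discrete_law N x p) Q) - UY m \<omega>
              = sqrt m * (transport_cost c (discrete_law N x p) (?E m \<omega>) - g_c c N x p (?E m \<omega>) z))"
        using eventually_ge_at_top[of 1]
      proof eventually_elim
        case m: (elim m)
        obtain A where A: "A \<in> sets M" "measure M A \<le> 4 * 2 ^ N * exp (- L\<^sup>2 / 2)"
          "\<forall>\<omega>\<in>space M - A. \<forall>w. (\<forall>i<N. \<bar>w i - z i\<bar> \<le> e) \<longrightarrow>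
            sqrt m * \<bar>(\<integral>y. fz c N x w y - fz c N x z y \<partial>?E m \<omega>) - (\<integral>y. fz c N x w y - fz c N x z y \<partial>Q)\<bar> \<le> (16 * L + 16) * e"
          by (rule empirical_process_deviation[OF m _ _ e, of L]) (use L in auto)
        have "measure M A \<le> d" using A(2) L(2) by simp
        moreover have "controlled (sqrt m) e ((16 * L + 16) * e) p (?E m \<omega>)
          \<and> sqrt m * (transport_cost c (discrete_law N x p) (?E m \<omega>) - transport_cost c (discrete_law N x p) Q) - UY m \<omega>
              = sqrt m * (transport_cost c (discrete_law N x p) (?E m \<omega>) - g_c c N x p (?E m \<omega>) z)"
          if \<omega>: "\<omega> \<in> space M - A" for \<omega>
        unfolding controlled_def
        proof (intro conjI allI impI)
          show "prob_space (?E m \<omega>)" "sets (?E m \<omega>) = sets borel" by (rule prob_space_empirical[OF m])+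
          show "integrable (?E m \<omega>) (c (x i))" for i
            by (rule integral_empirical(2)[OF borel_measurable_section[OF c_meas] m])
          show "sqrt m * \<bar>(\<Sum>i<N. (w i - z i) * (p i - p i)) + ((\<integral>y. fz c N x w y - fz c N x z y \<partial>?E m \<omega>) - (\<integral>y. fz c N x w y - fz c N x z y \<partial>Q))\<bar> \<le> (16 * L + 16) * e"
            if "\<forall>i<N. \<bar>w i - z i\<bar> \<le> e" for w
            using A(3)[rule_format, OF \<omega>, of w] that by simp
          have g_eq: "g_c c N x p (?E m \<omega>) z = g_c c N x p Q z + ((\<integral>y. fz c N x z y \<partial>?E m \<omega>) - (\<integral>y. fz c N x z y \<partial>Q))"
            by (simp add: g_c_def)
          show "sqrt m * (transport_cost c (discrete_law N x p) (?E m \<omega>) - transport_cost c (discrete_law N x p) Q) - UY m \<omega>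
              = sqrt m * (transport_cost c (discrete_law N x p) (?E m \<omega>) - g_c c N x p (?E m \<omega>) z)"
            unfolding UY_eq[OF m] transport_cost_eq_g_c g_eq by (simp add: algebra_simps)
        qed (use p_pos p_sum in auto)
        ultimately show ?case using A(1) by blast
      qed
    qed (use L in auto)
  qed
qed

lemma transport_cost_Xs_Ys_weak_conv:
  assumes c2: "\<And>i. i < N \<Longrightarrow> integrable Q (\<lambda>y. (c (x i) y)\<^sup>2)"
    and ns: "filterlim ns at_top sequentially" and ms: "filterlim ms at_top sequentially"
    and lam: "0 < lam" "lam < 1" "(\<lambda>k. real (ms k) / (real (ns k) + real (ms k))) \<longlonglongrightarrow> lam"
  shows "weak_conv_m (\<lambda>k. distr M borel (\<lambda>\<omega>. sqrt (real (ns k) * real (ms k) / (real (ns k) + real (ms k))) *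
      (transport_cost c (empirical (\<lambda>i. Xs i \<omega>) (ns k)) (empirical (\<lambda>j. Ys j \<omega>) (ms k)) - transport_cost c (discrete_law N x p) Q)))
     (distr (normal_law (sigma2_P N p z) \<Otimes>\<^sub>M normal_law (sigma2_Q c N x Q z)) borel (\<lambda>(u, v). sqrt lam * u + sqrt (1 - lam) * v))"
proof -
  let ?E = "\<lambda>k \<omega>. empirical (\<lambda>j. Ys j \<omega>) (ms k)" and ?F = "\<lambda>k \<omega>. empirical (\<lambda>i. Xs i \<omega>) (ns k)"
    and ?P = "discrete_law N x p"
  \<comment> \<open>The common rate factors as \<open>\<tau> k = \<alpha> k * sqrt (ns k) = \<beta>
    k * sqrt (ms k)\<close>: each sample enters at its own rate, with a factor that is at most 1 and
    converges to its coefficient in the limit.\<close>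
  define \<alpha> where "\<alpha> k = sqrt (real (ms k) / (real (ns k) + real (ms k)))" for k
  define \<beta> where "\<beta> k = sqrt (real (ns k) / (real (ns k) + real (ms k)))" for k
  define \<tau> where "\<tau> k = sqrt (real (ns k) * real (ms k) / (real (ns k) + real (ms k)))" for k
  define U where "U k \<omega> = \<alpha> k * UX (ns k) \<omega> + \<beta> k * UY (ms k) \<omega>" for k \<omega>
  have \<tau>_\<alpha>: "\<tau> k = \<alpha> k * sqrt (ns k)" and \<tau>_\<beta>: "\<tau> k = \<beta> k * sqrt (ms k)" for k
    by (simp_all add: \<tau>_def \<alpha>_def \<beta>_def real_sqrt_mult[symmetric] mult.commute)
  have \<alpha>1: "\<alpha> k \<le> 1" and \<beta>1: "\<beta> k \<le> 1" for k
    by (auto simp: \<alpha>_def \<beta>_def divide_le_eq_1)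
  have ns1: "\<forall>\<^sub>F k in sequentially. ns k \<ge> 1" using ns by (auto simp: filterlim_at_top)
  have ms1: "\<forall>\<^sub>F k in sequentially. ms k \<ge> 1" using ms by (auto simp: filterlim_at_top)
  have \<alpha>_lim: "\<alpha> \<longlonglongrightarrow> sqrt lam" unfolding \<alpha>_def by (intro tendsto_real_sqrt lam)
  have \<beta>_lim: "\<beta> \<longlonglongrightarrow> sqrt (1 - lam)" unfolding \<beta>_def
  proof (intro tendsto_real_sqrt)
    have "(\<lambda>k. 1 - real (ms k) / (real (ns k) + real (ms k))) \<longlonglongrightarrow> 1 - lam" by (intro tendsto_intros lam)
    moreover have "\<forall>\<^sub>F k in sequentially. 1 - real (ms k) / (real (ns k) + real (ms k)) = real (ns k) / (real (ns k) + real (ms k))"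
      using ns1 by eventually_elim (simp add: field_simps)
    ultimately show "(\<lambda>k. real (ns k) / (real (ns k) + real (ms k))) \<longlonglongrightarrow> 1 - lam"
      by (rule Lim_transform_eventually)
  qed
  have tau: "filterlim \<tau> at_top sequentially"
    unfolding \<tau>_\<alpha>
    by (rule filterlim_tendsto_pos_mult_at_top[OF \<alpha>_lim _ filterlim_compose[OF sqrt_at_top filterlim_compose[OF filterlim_real_sequentially ns]]])
       (use lam in simp)
  have U_meas: "U k \<in> borel_measurable M" for k unfolding U_def by measurable
  have V_meas: "(\<lambda>\<omega>. \<tau> k * (transport_cost c (?F k \<omega>) (?E k \<omega>) - transport_cost c ?P Q)) \<in> borel_measurable M" for k
  proof (cases "ns k \<ge> 1 \<and> ms k \<ge> 1")
    case True
    then have "(\<lambda>\<omega>. transport_cost c (discrete_law (ns k) (\<lambda>i. Xs i \<omega>) (\<lambda>_. 1 / real (ns k))) (?E k \<omega>)) \<in> borel_measurable M"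
      by (intro transport_cost_Ys_measurable Xs_meas) auto
    then show ?thesis using True by (simp add: empirical_eq_discrete_law)
  next
    case False
    then have "\<tau> k = 0" by (auto simp: \<tau>_def not_le)
    then show ?thesis by simp
  qed
  note vP = UX_weak_conv(1) and vQ = UY_weak_conv(1)[OF c2]
  have "weak_conv_m (\<lambda>k. distr M borel (\<lambda>\<omega>. \<tau> k * (transport_cost c (?F k \<omega>) (?E k \<omega>) - transport_cost c ?P Q)))
     (distr (normal_law (sigma2_P N p z) \<Otimes>\<^sub>M normal_law (sigma2_Q c N x Q z)) borel (\<lambda>(u, v). sqrt lam * u + sqrt (1 - lam) * v))"
  proof (rule M.weak_conv_m_of_char_approx[OF U_meas V_meas char_normal_law_product(1)[OF vP vQ]])
    fix t
    have "(\<lambda>k. char (distr M borel (UX (ns k))) (\<alpha> k * t)) \<longlonglongrightarrow> char (normal_law (sigma2_P N p z)) (sqrt lam * t)"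
      by (rule char_tendsto_moving[OF _ real_distribution_normal_law[OF vP] weak_conv_m_subseq[OF UX_weak_conv(2) ns]])
         (auto intro!: tendsto_intros \<alpha>_lim)
    moreover have "(\<lambda>k. char (distr M borel (UY (ms k))) (\<beta> k * t)) \<longlonglongrightarrow> char (normal_law (sigma2_Q c N x Q z)) (sqrt (1 - lam) * t)"
      by (rule char_tendsto_moving[OF _ real_distribution_normal_law[OF vQ] weak_conv_m_subseq[OF UY_weak_conv(2)[OF c2] ms]])
         (auto intro!: tendsto_intros \<beta>_lim)
    ultimately have lim: "(\<lambda>k. char (distr M borel (U k)) t)
        \<longlonglongrightarrow> char (normal_law (sigma2_P N p z)) (sqrt lam * t) * char (normal_law (sigma2_Q c N x Q z)) (sqrt (1 - lam) * t)"
      unfolding U_def[abs_def] char_UX_UY by (rule tendsto_mult)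
    have "char (distr (normal_law (sigma2_P N p z) \<Otimes>\<^sub>M normal_law (sigma2_Q c N x Q z)) borel (\<lambda>(u, v). sqrt lam * u + sqrt (1 - lam) * v)) t
        = char (normal_law (sigma2_P N p z)) (sqrt lam * t) * char (normal_law (sigma2_Q c N x Q z)) (sqrt (1 - lam) * t)"
      by (rule char_normal_law_product(2)[OF vP vQ])
    with lim show "(\<lambda>k. char (distr M borel (U k)) t) \<longlonglongrightarrow>
        char (distr (normal_law (sigma2_P N p z) \<Otimes>\<^sub>M normal_law (sigma2_Q c N x Q z)) borel (\<lambda>(u, v). sqrt lam * u + sqrt (1 - lam) * v)) t"
      by (simp only:)
  next
    fix a :: real assume a: "a > 0"
    obtain N0 where N0: "N0 \<in> null_sets M" "{\<omega> \<in> space M. \<not> (\<forall>k. Xs k \<omega> \<in> x ` {..<N})} \<subseteq> N0"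
      using AE_Xs by (auto elim!: AE_E simp: null_sets_def)
    show "(\<lambda>k. measure M {\<omega> \<in> space M. \<bar>\<tau> k * (transport_cost c (?F k \<omega>) (?E k \<omega>) - transport_cost c ?P Q) - U k \<omega>\<bar> > a}) \<longlonglongrightarrow> 0"
    proof (rule linearisation_in_probability[OF M.prob_space_axioms tau _ a, where q = "\<lambda>k. phat (ns k)" and R = ?E])
      fix d :: real assume d: "d > 0"
      \<comment> \<open>The sum of the two tail constants, so that a single \<open>L\<close> bounds
        the union of both bad events and meets the ratio condition of the chaining bound.\<close>
      define K where "K = 2 * real N + 4 * 2 ^ N"
      obtain L where L: "L \<ge> 1" "K * exp (- L\<^sup>2 / 2) \<le> min d 2"
        by (rule exists_gaussian_tail[of K "min d 2"]) (use d in \<open>auto simp: K_def add_nonneg_pos\<close>)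
      have Ld: "2 * N * exp (- L\<^sup>2 / 2) + 4 * 2 ^ N * exp (- L\<^sup>2 / 2) \<le> d"
        and Lr: "2 ^ N * exp (- L\<^sup>2 / 2) \<le> 1 / 2"
      proof -
        show "2 * N * exp (- L\<^sup>2 / 2) + 4 * 2 ^ N * exp (- L\<^sup>2 / 2) \<le> d"
          using L(2) by (simp add: K_def distrib_right)
        have "4 * 2 ^ N * exp (- L\<^sup>2 / 2) \<le> K * exp (- L\<^sup>2 / 2)" by (simp add: K_def)
        also have "\<dots> \<le> 2" using L(2) by simp
        finally show "2 ^ N * exp (- L\<^sup>2 / 2) \<le> 1 / 2" by simp
      qed
      define C where "C = N * L + (16 * L + 16)"
      show "\<exists>C\<ge>0. \<forall>e>0. \<forall>\<^sub>F k in sequentially. \<exists>A\<in>sets M. measure M A \<le> d \<and>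
       (\<forall>\<omega>\<in>space M - A. controlled (\<tau> k) e (C * e) (phat (ns k) \<omega>) (?E k \<omega>)
          \<and> \<tau> k * (transport_cost c (?F k \<omega>) (?E k \<omega>) - transport_cost c ?P Q) - U k \<omega>
              = \<tau> k * (transport_cost c (discrete_law N x (phat (ns k) \<omega>)) (?E k \<omega>) - g_c c N x (phat (ns k) \<omega>) (?E k \<omega>) z))"
      proof (intro exI[of _ C] conjI allI impI)
        show "0 \<le> C" using L by (simp add: C_def)
        fix e :: real assume e: "e > 0"
        show "\<forall>\<^sub>F k in sequentially. \<exists>A\<in>sets M. measure M A \<le> d \<and>
         (\<forall>\<omega>\<in>space M - A. controlled (\<tau> k) e (C * e) (phat (ns k) \<omega>) (?E k \<omega>)
          \<and> \<tau> k * (transport_cost c (?F k \<omega>) (?E k \<omega>) - transport_cost c ?P Q) - U k \<omega>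
              = \<tau> k * (transport_cost c (discrete_law N x (phat (ns k) \<omega>)) (?E k \<omega>) - g_c c N x (phat (ns k) \<omega>) (?E k \<omega>) z))"
          using eventually_weights_pos[OF ns, of L] ns1 ms1
        proof eventually_elim
          case (elim k)
          note n = elim(2) and m = elim(3)
          obtain A where A: "A \<in> sets M" "measure M A \<le> 2 * N * exp (- L\<^sup>2 / 2)"
            "\<forall>\<omega>\<in>space M - A. \<forall>i<N. sqrt (ns k) * \<bar>phat (ns k) \<omega> i - p i\<bar> \<le> L"
            by (rule phat_deviation[OF n, of L]) (use L in auto)
          obtain B where B: "B \<in> sets M" "measure M B \<le> 4 * 2 ^ N * exp (- L\<^sup>2 / 2)"
            "\<forall>\<omega>\<in>space M - B. \<forall>w. (\<forall>i<N. \<bar>w i - z i\<bar> \<le> e) \<longrightarrow>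
              sqrt (ms k) * \<bar>(\<integral>y. fz c N x w y - fz c N x z y \<partial>?E k \<omega>) - (\<integral>y. fz c N x w y - fz c N x z y \<partial>Q)\<bar> \<le> (16 * L + 16) * e"
            by (rule empirical_process_deviation[OF m _ Lr e]) (use L in auto)
          have "measure M (A \<union> B) \<le> d"
            using measure_Un_le[OF A(1) B(1)] A(2) B(2) Ld by linarith
          then have "measure M (A \<union> B \<union> N0) \<le> d"
            using measure_Un_null_set[OF sets.Un[OF A(1) B(1)] N0(1)] by simp
          moreover have "A \<union> B \<union> N0 \<in> sets M" using A(1) B(1) N0(1) by auto
          moreover have "controlled (\<tau> k) e (C * e) (phat (ns k) \<omega>) (?E k \<omega>)
            \<and> \<tau> k * (transport_cost c (?F k \<omega>) (?E k \<omega>) - transport_cost c ?P Q) - U k \<omega>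
                = \<tau> k * (transport_cost c (discrete_law N x (phat (ns k) \<omega>)) (?E k \<omega>) - g_c c N x (phat (ns k) \<omega>) (?E k \<omega>) z)"
            if \<omega>: "\<omega> \<in> space M - (A \<union> B \<union> N0)" for \<omega>
          unfolding controlled_def
          proof (intro conjI allI impI)
            have X: "\<forall>k. Xs k \<omega> \<in> x ` {..<N}" using \<omega> N0(2) by blast
            have dev: "\<forall>i<N. sqrt (ns k) * \<bar>phat (ns k) \<omega> i - p i\<bar> \<le> L" using A(3) \<omega> by blast
            show "prob_space (?E k \<omega>)" "sets (?E k \<omega>) = sets borel" by (rule prob_space_empirical[OF m])+
            show "integrable (?E k \<omega>) (c (x i))" for i
              by (rule integral_empirical(2)[OF borel_measurable_section[OF c_meas] m])
            show "phat (ns k) \<omega> i > 0" if "i < N" for i using phat_pos[of "ns k" \<omega> i L] dev elim that by blast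
            show "(\<Sum>i<N. phat (ns k) \<omega> i) = 1" by (rule phat_sum[OF n X])
            show "\<tau> k * \<bar>(\<Sum>i<N. (w i - z i) * (phat (ns k) \<omega> i - p i)) + ((\<integral>y. fz c N x w y - fz c N x z y \<partial>?E k \<omega>) - (\<integral>y. fz c N x w y - fz c N x z y \<partial>Q))\<bar> \<le> C * e"
              if w: "\<forall>i<N. \<bar>w i - z i\<bar> \<le> e" for w
            proof -
              define r where "r = \<bar>\<Sum>i<N. (w i - z i) * (phat (ns k) \<omega> i - p i)\<bar>"
              define s where "s = \<bar>(\<integral>y. fz c N x w y - fz c N x z y \<partial>?E k \<omega>) - (\<integral>y. fz c N x w y - fz c N x z y \<partial>Q)\<bar>"
              have r1: "sqrt (ns k) * r \<le> N * L * e"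
                unfolding r_def using weight_perturbation_bound[OF w dev] e by simp
              have "\<alpha> k * (sqrt (ns k) * r) \<le> 1 * (N * L * e)"
                by (rule mult_mono[OF \<alpha>1 r1]) (auto simp: r_def)
              then have 1: "\<tau> k * r \<le> N * L * e" by (simp add: \<tau>_\<alpha> mult.assoc)
              have s1: "sqrt (ms k) * s \<le> (16 * L + 16) * e"
                unfolding s_def using B(3) \<omega> w by blast
              have "\<beta> k * (sqrt (ms k) * s) \<le> 1 * ((16 * L + 16) * e)"
                by (rule mult_mono[OF \<beta>1 s1]) (auto simp: s_def)
              then have 2: "\<tau> k * s \<le> (16 * L + 16) * e" by (simp add: \<tau>_\<beta> mult.assoc)
              have "\<tau> k * \<bar>(\<Sum>i<N. (w i - z i) * (phat (ns k) \<omega> i - p i)) + ((\<integral>y. fz c N x w y - fz c N x z y \<partial>?E k \<omega>) - (\<integral>y. fz c N x w y - fz c N x z y \<partial>Q))\<bar> \<le> \<tau> k * (r + s)"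
                unfolding r_def s_def by (intro mult_left_mono abs_triangle_ineq) (simp add: \<tau>_def)
              also have "\<dots> \<le> C * e" using 1 2 by (simp add: C_def distrib_left distrib_right)
              finally show ?thesis .
            qed
            have g_eq: "g_c c N x (phat (ns k) \<omega>) (?E k \<omega>) z = g_c c N x p Q z + (\<Sum>i<N. z i * (phat (ns k) \<omega> i - p i))
                + ((\<integral>y. fz c N x z y \<partial>?E k \<omega>) - (\<integral>y. fz c N x z y \<partial>Q))"
              by (simp add: g_c_def right_diff_distrib sum_subtractf)
            have "U k \<omega> = \<tau> k * (\<Sum>i<N. z i * (phat (ns k) \<omega> i - p i)) + \<tau> k * ((\<integral>y. fz c N x z y \<partial>?E k \<omega>) - (\<integral>y. fz c N x z y \<partial>Q))"
              unfolding U_def UX_eq[OF n] UY_eq[OF m] mult.assoc[symmetric] \<tau>_\<alpha>[symmetric] \<tau>_\<beta>[symmetric] ..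
            then show "\<tau> k * (transport_cost c (?F k \<omega>) (?E k \<omega>) - transport_cost c ?P Q) - U k \<omega>
                = \<tau> k * (transport_cost c (discrete_law N x (phat (ns k) \<omega>)) (?E k \<omega>) - g_c c N x (phat (ns k) \<omega>) (?E k \<omega>) z)"
              unfolding empirical_Xs[OF n X] transport_cost_eq_g_c g_eq by (simp only: right_diff_distrib distrib_left)
          qed
          ultimately show ?case by blast
        qed
      qed
    qed
  qed
  then show ?thesis unfolding \<tau>_def .
qed

end

theorem theorem3:
  fixes N :: nat and x :: "nat \<Rightarrow> 'a::euclidean_space" and p :: "nat \<Rightarrow> real"
    and Q :: "'a measure" and h :: "'a \<Rightarrow> real" and z :: "nat \<Rightarrow> real"
    and M :: "'b measure" and Xs Ys :: "nat \<Rightarrow> 'b \<Rightarrow> 'a"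
  defines "c \<equiv> (\<lambda>u v. h (u - v))"
    and "P \<equiv> discrete_law N x p"
  assumes N: "N \<ge> 1"
    and x_distinct: "inj_on x {..<N}"
    and p_pos: "\<forall>i<N. p i > 0" and p_sum: "(\<Sum>i<N. p i) = 1"
    and Q_prob: "prob_space Q" and Q_sets: "sets Q = sets borel"
    and Q_ac: "absolutely_continuous lborel Q"
    and Q_supp_conn: "connected (msupport Q)"
    and Q_supp_bdry: "frontier (msupport Q) \<in> null_sets lborel"
    and h_nonneg: "\<forall>u. h u \<ge> 0"
    and h_diff: "\<forall>u. h differentiable (at u)"
    and A1: "strictly_convex h" and A2: "cone_condition h" and A3: "superlinear h"
    and c_int: "\<forall>i<N. integrable Q (\<lambda>y. c (x i) y)"
    and z_opt: "z \<in> Opt0 c N x p Q"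
    and M_prob: "prob_space M"
    and indep: "prob_space.indep_vars M (\<lambda>_. borel)
                  (\<lambda>k. case k of Inl i \<Rightarrow> Xs i | Inr j \<Rightarrow> Ys j) UNIV"
    and Xs_law: "\<forall>i. distr M borel (Xs i) = P"
    and Ys_law: "\<forall>j. distr M borel (Ys j) = Q"
  shows "weak_conv_m
           (\<lambda>n. distr M borel (\<lambda>\<omega>. sqrt (real n) *
              (transport_cost c (empirical (\<lambda>k. Xs k \<omega>) n) Q - transport_cost c P Q)))
           (normal_law (sigma2_P N p z))
       \<and> ((\<forall>i<N. integrable Q (\<lambda>y. (c (x i) y)\<^sup>2)) \<longrightarrow>
           weak_conv_m
             (\<lambda>m. distr M borel (\<lambda>\<omega>. sqrt (real m) *
                (transport_cost c P (empirical (\<lambda>k. Ys k \<omega>) m) - transport_cost c P Q)))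
             (normal_law (sigma2_Q c N x Q z))
         \<and> (\<forall>(ns :: nat \<Rightarrow> nat) (ms :: nat \<Rightarrow> nat) (lam::real).
              filterlim ns at_top sequentially \<and> filterlim ms at_top sequentially \<and>
              0 < lam \<and> lam < 1 \<and>
              (\<lambda>k. real (ms k) / (real (ns k) + real (ms k))) \<longlonglongrightarrow> lam \<longrightarrow>
              weak_conv_m
                (\<lambda>k. distr M borel (\<lambda>\<omega>.
                   sqrt (real (ns k) * real (ms k) / (real (ns k) + real (ms k))) *
                   (transport_cost c (empirical (\<lambda>i. Xs i \<omega>) (ns k))
                                     (empirical (\<lambda>j. Ys j \<omega>) (ms k))
                    - transport_cost c P Q)))
                (distr (normal_law (sigma2_P N p z) \<Otimes>\<^sub>M normal_law (sigma2_Q c N x Q z)) borel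
                   (\<lambda>(u, v). sqrt lam * u + sqrt (1 - lam) * v))))"
proof -
  interpret Q: prob_space Q by (rule Q_prob)
  have h_cont: "continuous_on UNIV h"
    using h_diff by (auto intro!: continuous_at_imp_continuous_on differentiable_imp_continuous_within)
  have c_cont: "continuous_on UNIV (\<lambda>u. c (fst u) (snd u))"
    unfolding c_def by (intro continuous_on_compose2[OF h_cont] continuous_intros) auto
  have c_nonneg: "0 \<le> c u v" for u v using h_nonneg by (simp add: c_def)
  have c_meas: "(\<lambda>u. c (fst u) (snd u)) \<in> borel_measurable borel"
    by (rule borel_measurable_continuous_onI[OF c_cont])
  have p_pos': "p i > 0" and c_int': "integrable Q (c (x i))" if "i < N" for i
    using that p_pos c_int by auto
  \<comment> \<open>Weak duality at an arbitrary \<open>w\<close>, set against the equality in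
    \<open>Opt0\<close>, makes \<open>z\<close> a maximiser of the dual functional.\<close>
  have z_max: "g_c c N x p Q w \<le> g_c c N x p Q z" for w
    using g_c_le_transport_cost[where x = x and c = c and q = p, OF Q_prob Q_sets N p_pos' p_sum c_nonneg c_meas c_int', of w]
      z_opt by (simp add: Opt0_def)
  interpret semidiscrete_sampling c N x p Q z M Xs Ys
  proof (intro semidiscrete_sampling.intro semidiscrete.intro semidiscrete_sampling_axioms.intro)
    show "distr M borel (Xs i) = discrete_law N x p" for i using Xs_law by (simp add: P_def)
  qed (fact N p_pos' p_sum Q_prob Q_sets Q_supp_conn c_nonneg c_cont c_int' z_max M_prob x_distinct indep Ys_law[rule_format])+
  show ?thesis
    using transport_cost_Xs_weak_conv transport_cost_Ys_weak_conv transport_cost_Xs_Ys_weak_conv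
    unfolding P_def by blast
qed

end
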